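(* Assume the following. (A1) $\{\mathcal T_{g,n}:1\le g\le G_n\}$ is a partition of $\{1,\dots,n\}$ such that the collections $\{(u_{i,n},x_{i,n}'):i\in\mathcal T_{g,n}\}$ are independent over $g$ conditional on $\mathcal W_n$, and $\max_{1\le g\le G_n}\#\mathcal T_{g,n}=O(1)$. (A2) $\mathbb P[\lambda_{\min}(\sum_{i=1}^n w_{i,n}w_{i,n}')>0]\to1$, $\limsup_{n\to\infty}K_n/n<1$, $\mathcal C_n=O_p(1)$ and $\Sigma_n^{-1}=O_p(1)$. (A3) $\mathbb E[u_{i,n}|\mathcal X_n,\mathcal W_n]=0$ for all $i,n$, $\chi_n=O(1)$, and $\max_{1\le i\le n}\|\hat v_{i,n}\|/\sqrt n=o_p(1)$. Then $$\hat\Sigma_n^{\mathrm{LZ}}=\frac1n\sum_{g_1=1}^{G_n}\sum_{g_2=1}^{G_n}\sum_{i_1,j_1\in\mathcal T_{g_1,n}}\sum_{i_2,j_2\in\mathcal T_{g_2,n}}\hat v_{i_1,n}\hat v_{j_1,n}'M_{i_1j_2,n}M_{j_1i_2,n}\,\mathbb E[u_{i_2,n}u_{j_2,n}|\mathcal X_n,\mathcal W_n]+o_p(1).$$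
   Context: All limits are as $n\to\infty$, in a triangular-array setting. For each $n$, the random data $\{(y_{i,n},x_{i,n}',w_{i,n}'):1\le i\le n\}$ are generated by $y_{i,n}=\beta'x_{i,n}+\gamma_n'w_{i,n}+u_{i,n}$, where $y_{i,n}$ is scalar, $x_{i,n}$ is $d\times1$ with $d$ fixed, $w_{i,n}$ is $K_n\times1$ ($K_n$ may grow with $n$), and $u_{i,n}$ is an unobserved scalar error. Put $\mathcal X_n=(x_{1,n},\dots,x_{n,n})$, $\mathcal W_n=(w_{1,n},\dots,w_{n,n})$. $\|\cdot\|$ is the Euclidean norm, $\lambda_{\min}(\cdot)$ the minimum eigenvalue, $\mathbb V$ the variance, $\#$ cardinality. $M_n=(M_{ij,n})$ is the $n\times n$ matrix $M_{ij,n}=\mathbf 1\{i=j\}-w_{i,n}'(\sum_{k=1}^n w_{k,n}w_{k,n}')^{-1}w_{j,n}$; $\hat v_{i,n}=\sum_{j=1}^nM_{ij,n}x_{j,n}$; the OLS estimator is $\hat\beta_n=(\sum_{i=1}^n\hat v_{i,n}\hat v_{i,n}')^{-1}\sum_{i=1}^n\hat v_{i,n}y_{i,n}$; residuals are $\hat u_{i,n}=\sum_{j=1}^nM_{ij,n}(y_{j,n}-\hat\beta_n'x_{j,n})$. $\Sigma_n=\mathbb V[\frac1{\sqrt n}\sum_{i=1}^n\hat v_{i,n}u_{i,n}|\mathcal X_n,\mathcal W_n]$. $v_{i,n}=x_{i,n}-(\sum_{j=1}^n\mathbb E[x_{j,n}w_{j,n}'])(\sum_{j=1}^n\mathbb E[w_{j,n}w_{j,n}'])^{-1}w_{i,n}$,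 $Q_{i,n}=\mathbb E[v_{i,n}|\mathcal W_n]$, $\chi_n=\frac1n\sum_{i=1}^n\mathbb E[\|Q_{i,n}\|^2]$. $V_{i,n}=x_{i,n}-\mathbb E[x_{i,n}|\mathcal W_n]$, $\tilde V_{i,n}=\sum_{j=1}^nM_{ij,n}V_{j,n}$, $\tilde\Gamma_n=\frac1n\sum_{i=1}^n\tilde V_{i,n}\tilde V_{i,n}'$, and $$\mathcal C_n=\max_{1\le i\le n}\{\mathbb E[u_{i,n}^4|\mathcal X_n,\mathcal W_n]+\mathbb E[\|V_{i,n}\|^4|\mathcal W_n]+1/\mathbb E[u_{i,n}^2|\mathcal X_n,\mathcal W_n]\}+1/\lambda_{\min}(\mathbb E[\tilde\Gamma_n|\mathcal W_n]).$$ The Liang–Zeger cluster-robust variance estimator is $\hat\Sigma_n^{\mathrm{LZ}}=\frac1n\sum_{g=1}^{G_n}\sum_{i,j\in\mathcal T_{g,n}}\hat v_{i,n}\hat v_{j,n}'\hat u_{i,n}\hat u_{j,n}$. *)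

theory Defs
  imports
    "HOL-Probability.Probability"
    "Jordan_Normal_Form.Char_Poly"
    "Jordan_Normal_Form.Gauss_Jordan_Elimination"
begin

hide_type (open) Matrix.vec

(* Vectors and matrices of the fixed dimension d are of type real^'d and real^'d^'d.
   The dimension K of the covariates w varies with n, so such a covariate is a function
   nat => real of which only the components k < K are used, and K x K matrices are
   elements of the type mat. *)

definition outer :: "real^'m \<Rightarrow> real^'k \<Rightarrow> real^'k^'m" where
  "outer a b = (\<chi> i j. vec_nth a i * vec_nth b j)"

definition lambda_min :: "real^'d^'d \<Rightarrow> real" where
  "lambda_min A = Min {l. \<exists>v. v \<noteq> 0 \<and> A *v v = l *\<^sub>R v}"

definition lambda_min_mat :: "real mat \<Rightarrow> real" where
  "lambda_min_mat A = Min {l. eigenvalue A l}"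

(* The value for a singular matrix is arbitrary. *)
definition mat_inv :: "real mat \<Rightarrow> real mat" where
  "mat_inv A = (case mat_inverse A of Some B \<Rightarrow> B | None \<Rightarrow> 0\<^sub>m (dim_row A) (dim_col A))"

(* A singular matrix has infinite inverse norm, so a bound in probability on this
   quantity includes invertibility with probability close to one. *)
definition inv_norm :: "real^'d^'d \<Rightarrow> ennreal" where
  "inv_norm A = (if invertible A then ennreal (norm (matrix_inv A)) else \<infinity>)"

(* The probability space may change with n.  Bounding probabilities from below means that
   a non-measurable event, whose measure is 0 by convention, never satisfies these
   conditions. *)

definition Op1 :: "(nat \<Rightarrow> 'a measure) \<Rightarrow> (nat \<Rightarrow> 'a \<Rightarrow> ennreal) \<Rightarrow> bool" where
  "Op1 P X \<longleftrightarrow> (\<forall>\<epsilon>>0. \<exists>C::real. \<forall>\<^sub>F n in sequentially.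
     measure (P n) {\<omega> \<in> space (P n). X n \<omega> \<le> ennreal C} \<ge> 1 - \<epsilon>)"

definition op1 :: "(nat \<Rightarrow> 'a measure) \<Rightarrow> (nat \<Rightarrow> 'a \<Rightarrow> real) \<Rightarrow> bool" where
  "op1 P X \<longleftrightarrow> (\<forall>\<epsilon>>0.
     (\<lambda>n. measure (P n) {\<omega> \<in> space (P n). \<bar>X n \<omega>\<bar> \<le> \<epsilon>}) \<longlonglongrightarrow> 1)"

definition sigma_W :: "'a measure \<Rightarrow> nat \<Rightarrow> nat \<Rightarrow> (nat \<Rightarrow> 'a \<Rightarrow> nat \<Rightarrow> real) \<Rightarrow> 'a measure" where
  "sigma_W P n K w = vimage_algebra (space P)
     (\<lambda>\<omega>. \<lambda>(i, k) \<in> {1..n} \<times> {..<K}. w i \<omega> k)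
     (PiM ({1..n} \<times> {..<K}) (\<lambda>_. borel))"

definition sigma_XW :: "'a measure \<Rightarrow> nat \<Rightarrow> nat \<Rightarrow> (nat \<Rightarrow> 'a \<Rightarrow> real^'d) \<Rightarrow>
    (nat \<Rightarrow> 'a \<Rightarrow> nat \<Rightarrow> real) \<Rightarrow> 'a measure" where
  "sigma_XW P n K x w = vimage_algebra (space P)
     (\<lambda>\<omega>. (\<lambda>i \<in> {1..n}. x i \<omega>, \<lambda>(i, k) \<in> {1..n} \<times> {..<K}. w i \<omega> k))
     (PiM {1..n} (\<lambda>_. borel) \<Otimes>\<^sub>M PiM ({1..n} \<times> {..<K}) (\<lambda>_. borel))"

(* real_cond_exp is the difference of the conditional expectations of the positive and
   negative parts; it is the conditional expectation wherever these are finite, also for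
   functions that are not integrable.  Conditional moments of nonnegative functions that
   may be infinite are taken with nn_cond_exp. *)

definition cond_exp_vec :: "'a measure \<Rightarrow> 'a measure \<Rightarrow> ('a \<Rightarrow> real^'d) \<Rightarrow> 'a \<Rightarrow> real^'d" where
  "cond_exp_vec P F f \<omega> = (\<chi> a. real_cond_exp P F (\<lambda>\<omega>'. vec_nth (f \<omega>') a) \<omega>)"

definition cond_exp_mat :: "'a measure \<Rightarrow> 'a measure \<Rightarrow> ('a \<Rightarrow> real^'d^'d) \<Rightarrow> 'a \<Rightarrow> real^'d^'d" where
  "cond_exp_mat P F f \<omega> =
     (\<chi> a b. real_cond_exp P F (\<lambda>\<omega>'. vec_nth (vec_nth (f \<omega>') a) b) \<omega>)"

definition cond_var :: "'a measure \<Rightarrow> 'a measure \<Rightarrow> ('a \<Rightarrow> real^'d) \<Rightarrow> 'a \<Rightarrow> real^'d^'d" where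
  "cond_var P F S = cond_exp_mat P F
     (\<lambda>\<omega>. outer (S \<omega> - cond_exp_vec P F S \<omega>) (S \<omega> - cond_exp_vec P F S \<omega>))"

definition cond_indep_vars :: "'a measure \<Rightarrow> 'a measure \<Rightarrow> ('i \<Rightarrow> 'b measure) \<Rightarrow>
    ('i \<Rightarrow> 'a \<Rightarrow> 'b) \<Rightarrow> 'i set \<Rightarrow> bool" where
  "cond_indep_vars P F N Z I \<longleftrightarrow>
     (\<forall>i\<in>I. Z i \<in> measurable P (N i)) \<and>
     (\<forall>J\<subseteq>I. J \<noteq> {} \<longrightarrow> finite J \<longrightarrow> (\<forall>A \<in> (\<Pi> j\<in>J. sets (N j)).
        AE \<omega> in P. real_cond_exp P F (indicator (\<Inter>j\<in>J. Z j -` A j \<inter> space P)) \<omega>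
          = (\<Prod>j\<in>J. real_cond_exp P F (indicator (Z j -` A j \<inter> space P)) \<omega>)))"

definition gram :: "nat \<Rightarrow> nat \<Rightarrow> (nat \<Rightarrow> 'a \<Rightarrow> nat \<Rightarrow> real) \<Rightarrow> 'a \<Rightarrow> real mat" where
  "gram n K w \<omega> = mat K K (\<lambda>(k, l). \<Sum>i=1..n. w i \<omega> k * w i \<omega> l)"

definition resid_mat :: "nat \<Rightarrow> nat \<Rightarrow> (nat \<Rightarrow> 'a \<Rightarrow> nat \<Rightarrow> real) \<Rightarrow> nat \<Rightarrow> nat \<Rightarrow> 'a \<Rightarrow> real" where
  "resid_mat n K w i j \<omega> = (if i = j then 1 else 0) -
     (\<Sum>k<K. \<Sum>l<K. w i \<omega> k * mat_inv (gram n K w \<omega>) $$ (k, l) * w j \<omega> l)"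

definition v_hat :: "nat \<Rightarrow> nat \<Rightarrow> (nat \<Rightarrow> 'a \<Rightarrow> nat \<Rightarrow> real) \<Rightarrow> (nat \<Rightarrow> 'a \<Rightarrow> real^'d) \<Rightarrow>
    nat \<Rightarrow> 'a \<Rightarrow> real^'d" where
  "v_hat n K w x i \<omega> = (\<Sum>j=1..n. resid_mat n K w i j \<omega> *\<^sub>R x j \<omega>)"

definition beta_hat :: "nat \<Rightarrow> nat \<Rightarrow> (nat \<Rightarrow> 'a \<Rightarrow> nat \<Rightarrow> real) \<Rightarrow> (nat \<Rightarrow> 'a \<Rightarrow> real^'d) \<Rightarrow>
    (nat \<Rightarrow> 'a \<Rightarrow> real) \<Rightarrow> 'a \<Rightarrow> real^'d" where
  "beta_hat n K w x y \<omega> =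
     matrix_inv (\<Sum>i=1..n. outer (v_hat n K w x i \<omega>) (v_hat n K w x i \<omega>)) *v
       (\<Sum>i=1..n. y i \<omega> *\<^sub>R v_hat n K w x i \<omega>)"

definition u_hat :: "nat \<Rightarrow> nat \<Rightarrow> (nat \<Rightarrow> 'a \<Rightarrow> nat \<Rightarrow> real) \<Rightarrow> (nat \<Rightarrow> 'a \<Rightarrow> real^'d) \<Rightarrow>
    (nat \<Rightarrow> 'a \<Rightarrow> real) \<Rightarrow> nat \<Rightarrow> 'a \<Rightarrow> real" where
  "u_hat n K w x y i \<omega> =
     (\<Sum>j=1..n. resid_mat n K w i j \<omega> * (y j \<omega> - inner (beta_hat n K w x y \<omega>) (x j \<omega>)))"

definition Sigma_cond :: "'a measure \<Rightarrow> nat \<Rightarrow> nat \<Rightarrow> (nat \<Rightarrow> 'a \<Rightarrow> nat \<Rightarrow> real) \<Rightarrow>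
    (nat \<Rightarrow> 'a \<Rightarrow> real^'d) \<Rightarrow> (nat \<Rightarrow> 'a \<Rightarrow> real) \<Rightarrow> 'a \<Rightarrow> real^'d^'d" where
  "Sigma_cond P n K w x u = cond_var P (sigma_XW P n K x w)
     (\<lambda>\<omega>. (1 / sqrt (real n)) *\<^sub>R (\<Sum>i=1..n. u i \<omega> *\<^sub>R v_hat n K w x i \<omega>))"

definition mean_gram :: "'a measure \<Rightarrow> nat \<Rightarrow> nat \<Rightarrow> (nat \<Rightarrow> 'a \<Rightarrow> nat \<Rightarrow> real) \<Rightarrow> real mat" where
  "mean_gram P n K w = mat K K (\<lambda>(k, l). \<Sum>j=1..n. \<integral>\<omega>. w j \<omega> k * w j \<omega> l \<partial>P)"

definition v_pop :: "'a measure \<Rightarrow> nat \<Rightarrow> nat \<Rightarrow> (nat \<Rightarrow> 'a \<Rightarrow> nat \<Rightarrow> real) \<Rightarrow>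
    (nat \<Rightarrow> 'a \<Rightarrow> real^'d) \<Rightarrow> nat \<Rightarrow> 'a \<Rightarrow> real^'d" where
  "v_pop P n K w x i \<omega> = x i \<omega> -
     (\<Sum>k<K. \<Sum>l<K. (mat_inv (mean_gram P n K w) $$ (k, l) * w i \<omega> l) *\<^sub>R
        (\<Sum>j=1..n. \<integral>\<omega>'. w j \<omega>' k *\<^sub>R x j \<omega>' \<partial>P))"

definition Q_proj :: "'a measure \<Rightarrow> nat \<Rightarrow> nat \<Rightarrow> (nat \<Rightarrow> 'a \<Rightarrow> nat \<Rightarrow> real) \<Rightarrow>
    (nat \<Rightarrow> 'a \<Rightarrow> real^'d) \<Rightarrow> nat \<Rightarrow> 'a \<Rightarrow> real^'d" where
  "Q_proj P n K w x i = cond_exp_vec P (sigma_W P n K w) (v_pop P n K w x i)"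

definition chi_n :: "'a measure \<Rightarrow> nat \<Rightarrow> nat \<Rightarrow> (nat \<Rightarrow> 'a \<Rightarrow> nat \<Rightarrow> real) \<Rightarrow>
    (nat \<Rightarrow> 'a \<Rightarrow> real^'d) \<Rightarrow> ennreal" where
  "chi_n P n K w x =
     (\<Sum>i=1..n. \<integral>\<^sup>+\<omega>. ennreal ((norm (Q_proj P n K w x i \<omega>))\<^sup>2) \<partial>P) / of_nat n"

definition V_err :: "'a measure \<Rightarrow> nat \<Rightarrow> nat \<Rightarrow> (nat \<Rightarrow> 'a \<Rightarrow> nat \<Rightarrow> real) \<Rightarrow>
    (nat \<Rightarrow> 'a \<Rightarrow> real^'d) \<Rightarrow> nat \<Rightarrow> 'a \<Rightarrow> real^'d" where
  "V_err P n K w x i \<omega> = x i \<omega> - cond_exp_vec P (sigma_W P n K w) (x i) \<omega>"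

definition V_tilde :: "'a measure \<Rightarrow> nat \<Rightarrow> nat \<Rightarrow> (nat \<Rightarrow> 'a \<Rightarrow> nat \<Rightarrow> real) \<Rightarrow>
    (nat \<Rightarrow> 'a \<Rightarrow> real^'d) \<Rightarrow> nat \<Rightarrow> 'a \<Rightarrow> real^'d" where
  "V_tilde P n K w x i \<omega> = (\<Sum>j=1..n. resid_mat n K w i j \<omega> *\<^sub>R V_err P n K w x j \<omega>)"

definition Gamma_tilde :: "'a measure \<Rightarrow> nat \<Rightarrow> nat \<Rightarrow> (nat \<Rightarrow> 'a \<Rightarrow> nat \<Rightarrow> real) \<Rightarrow>
    (nat \<Rightarrow> 'a \<Rightarrow> real^'d) \<Rightarrow> 'a \<Rightarrow> real^'d^'d" where
  "Gamma_tilde P n K w x \<omega> = (1 / real n) *\<^sub>R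
     (\<Sum>i=1..n. outer (V_tilde P n K w x i \<omega>) (V_tilde P n K w x i \<omega>))"

(* Extended-valued: the conditional moments may be infinite, and in ennreal 1 / 0 is
   infinite, so a vanishing conditional variance or minimum eigenvalue makes C_n infinite. *)
definition C_n :: "'a measure \<Rightarrow> nat \<Rightarrow> nat \<Rightarrow> (nat \<Rightarrow> 'a \<Rightarrow> nat \<Rightarrow> real) \<Rightarrow>
    (nat \<Rightarrow> 'a \<Rightarrow> real^'d) \<Rightarrow> (nat \<Rightarrow> 'a \<Rightarrow> real) \<Rightarrow> 'a \<Rightarrow> ennreal" where
  "C_n P n K w x u \<omega> =
     (MAX i\<in>{1..n}.
        nn_cond_exp P (sigma_XW P n K x w) (\<lambda>\<omega>'. ennreal ((u i \<omega>') ^ 4)) \<omega>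
      + nn_cond_exp P (sigma_W P n K w) (\<lambda>\<omega>'. ennreal ((norm (V_err P n K w x i \<omega>')) ^ 4)) \<omega>
      + 1 / nn_cond_exp P (sigma_XW P n K x w) (\<lambda>\<omega>'. ennreal ((u i \<omega>')\<^sup>2)) \<omega>)
   + 1 / ennreal (lambda_min (cond_exp_mat P (sigma_W P n K w) (Gamma_tilde P n K w x) \<omega>))"

definition Sigma_LZ :: "nat \<Rightarrow> nat \<Rightarrow> (nat \<Rightarrow> 'a \<Rightarrow> nat \<Rightarrow> real) \<Rightarrow> (nat \<Rightarrow> 'a \<Rightarrow> real^'d) \<Rightarrow>
    (nat \<Rightarrow> 'a \<Rightarrow> real) \<Rightarrow> nat \<Rightarrow> (nat \<Rightarrow> nat set) \<Rightarrow> 'a \<Rightarrow> real^'d^'d" where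
  "Sigma_LZ n K w x y G T \<omega> = (1 / real n) *\<^sub>R
     (\<Sum>g=1..G. \<Sum>i\<in>T g. \<Sum>j\<in>T g.
        (u_hat n K w x y i \<omega> * u_hat n K w x y j \<omega>) *\<^sub>R
          outer (v_hat n K w x i \<omega>) (v_hat n K w x j \<omega>))"

end

theory Submission
  imports Defs
begin

text \<open>
  Write \<open>v = M x\<close>, \<open>\<upsilon> = M u\<close> and \<open>\<delta>\<close> for the estimation error of the slope, so that the OLS residuals are
  \<open>\<upsilon>\<^sub>i - \<delta>' v\<^sub>i\<close>. With \<open>\<upsilon>\<close> in place of the residuals, every entry of the variance estimator is a
  quadratic form in \<open>u\<close> with weights \<open>M A M / n\<close>, where \<open>A\<close> is block diagonal with entries
  \<open>v\<^sub>i\<^sub>a v\<^sub>j\<^sub>b\<close>; the target is its expectation given \<open>(X, W)\<close>. The clusters of \<open>u\<close> are independent given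
  \<open>(X, W)\<close>, so products of centred terms are orthogonal unless they involve the same clusters, and the
  conditional variance is at most a constant times the squared Frobenius norm of the weights. As \<open>M\<close>
  is a projection this is at most a constant times \<open>(max |v\<^sub>i|\<^sup>2 / n) (\<Sum> |v\<^sub>i|\<^sup>2 / n)\<close>, and the second factor
  is bounded in probability because \<open>v = M (V + Q)\<close>.

  The estimation error is negligible because \<open>\<surd>n |\<delta>|\<close> is bounded in probability. The eigenvalue bound
  on the design needed for this comes from the bound on the inverse of the conditional variance of the
  score, whose bilinear form is dominated by that of the design.
\<close>

section \<open>Forms in conditionally clustered errors\<close>

text \<open>Two obstacles shape the development. The assumptions bound conditional moments in
  probability only, so neither errors nor regressors need be integrable. Every expectation is
  therefore taken with a factor that is bounded, known given (X, W), and zero outside an event in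
  the sigma-algebra of (X, W) on which the conditional fourth moments are at most a constant;
  products with such factors are integrable. Secondly, the clusters are independent given W, jointly
  in errors and regressors, whereas orthogonality is needed given (X, W). For each cluster a
  sigma-algebra is built that contains (X, W) and all errors of the other clusters; conditioning the
  errors of the cluster on it has almost surely the same result as conditioning on (X, W). Finally,
  no bound on the largest entry of M u is available, so the replacement of the residuals relies on
  the mean of |v_i|^2 (M u)_i^2, which is again a sum of squared linear forms in u.\<close>

lemma (in finite_measure) subalgebra_sigma_finite:
  "subalgebra M F \<Longrightarrow> sigma_finite_subalgebra M F"
  by (intro finite_measure_subalgebra_is_sigma_finite finite_measure_subalgebra.intro
      finite_measure_subalgebra_axioms.intro finite_measure_axioms)

section \<open>Second moments of sums with few correlated pairs\<close>

lemma integrable_mult_of_squares: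
  fixes f g :: "'a \<Rightarrow> real"
  assumes "integrable M (\<lambda>x. (f x)\<^sup>2)" "integrable M (\<lambda>x. (g x)\<^sup>2)"
    and [measurable]: "f \<in> borel_measurable M" "g \<in> borel_measurable M"
  shows "integrable M (\<lambda>x. f x * g x)"
proof (rule Bochner_Integration.integrable_bound)
  show "integrable M (\<lambda>x. (f x)\<^sup>2 + (g x)\<^sup>2)" using assms by simp
  have "\<bar>f x * g x\<bar> \<le> (f x)\<^sup>2 + (g x)\<^sup>2" for x
    using sum_squares_bound[of "\<bar>f x\<bar>" "\<bar>g x\<bar>"] mult_nonneg_nonneg[of "\<bar>f x\<bar>" "\<bar>g x\<bar>"]
    unfolding abs_mult power2_abs by linarith
  then show "AE x in M. norm (f x * g x) \<le> norm ((f x)\<^sup>2 + (g x)\<^sup>2)" by simp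
qed simp

text \<open>\<open>R\<close> marks the pairs that may be correlated. Off \<open>R\<close> products
  have mean zero; on \<open>R\<close> a product is bounded by half the sum of the two squares, and
  every index occurs in at most \<open>N\<close> such pairs.\<close>

lemma integral_square_sum_le:
  fixes \<xi> :: "'i \<Rightarrow> 'a \<Rightarrow> real"
  assumes fin: "finite I"
    and meas[measurable]: "\<And>i. i \<in> I \<Longrightarrow> \<xi> i \<in> borel_measurable M"
    and sq: "\<And>i. i \<in> I \<Longrightarrow> integrable M (\<lambda>\<omega>. (\<xi> i \<omega>)\<^sup>2)"
    and sym: "\<And>i j. R i j \<Longrightarrow> R j i"
    and card: "\<And>i. i \<in> I \<Longrightarrow> card {j\<in>I. R i j} \<le> N"
    and orth: "\<And>i j. i \<in> I \<Longrightarrow> j \<in> I \<Longrightarrow> \<not> R i j \<Longrightarrow> (\<integral>\<omega>. \<xi> i \<omega> * \<xi> j \<omega> \<partial>M) = 0"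
  shows "integrable M (\<lambda>\<omega>. (\<Sum>i\<in>I. \<xi> i \<omega>)\<^sup>2)"
    and "(\<integral>\<omega>. (\<Sum>i\<in>I. \<xi> i \<omega>)\<^sup>2 \<partial>M) \<le> real N * (\<Sum>i\<in>I. \<integral>\<omega>. (\<xi> i \<omega>)\<^sup>2 \<partial>M)"
proof -
  have int: "integrable M (\<lambda>\<omega>. \<xi> i \<omega> * \<xi> j \<omega>)" if "i \<in> I" "j \<in> I" for i j
    using that by (intro integrable_mult_of_squares sq meas)
  have eq: "(\<Sum>i\<in>I. \<xi> i \<omega>)\<^sup>2 = (\<Sum>i\<in>I. \<Sum>j\<in>I. \<xi> i \<omega> * \<xi> j \<omega>)" for \<omega>
    by (simp add: power2_eq_square sum_product)
  show "integrable M (\<lambda>\<omega>. (\<Sum>i\<in>I. \<xi> i \<omega>)\<^sup>2)"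
    unfolding eq by (intro Bochner_Integration.integrable_sum int)
  define q where "q i = (\<integral>\<omega>. (\<xi> i \<omega>)\<^sup>2 \<partial>M)" for i
  have q0: "q i \<ge> 0" for i by (simp add: q_def)
  have b: "(\<integral>\<omega>. \<xi> i \<omega> * \<xi> j \<omega> \<partial>M) \<le> (q i + q j) / 2" if "i \<in> I" "j \<in> I" for i j
  proof -
    have "(\<integral>\<omega>. \<xi> i \<omega> * \<xi> j \<omega> \<partial>M) \<le> (\<integral>\<omega>. ((\<xi> i \<omega>)\<^sup>2 + (\<xi> j \<omega>)\<^sup>2) / 2 \<partial>M)"
    proof (rule integral_mono)
      show "integrable M (\<lambda>\<omega>. ((\<xi> i \<omega>)\<^sup>2 + (\<xi> j \<omega>)\<^sup>2) / 2)"
        using that by (intro integrable_divide_zero Bochner_Integration.integrable_add sq)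
      show "\<xi> i \<omega> * \<xi> j \<omega> \<le> ((\<xi> i \<omega>)\<^sup>2 + (\<xi> j \<omega>)\<^sup>2) / 2" for \<omega>
        using sum_squares_bound[of "\<xi> i \<omega>" "\<xi> j \<omega>"] by simp
    qed (rule int[OF that])
    also have "\<dots> = (q i + q j) / 2"
      using that sq by (simp add: q_def)
    finally show ?thesis .
  qed
  have "(\<integral>\<omega>. (\<Sum>i\<in>I. \<xi> i \<omega>)\<^sup>2 \<partial>M) = (\<Sum>i\<in>I. \<Sum>j\<in>I. \<integral>\<omega>. \<xi> i \<omega> * \<xi> j \<omega> \<partial>M)"
    unfolding eq by (subst Bochner_Integration.integral_sum)
      (auto intro!: Bochner_Integration.integrable_sum int sum.cong Bochner_Integration.integral_sum)
  also have "\<dots> \<le> (\<Sum>i\<in>I. \<Sum>j\<in>I. if R i j then (q i + q j) / 2 else 0)"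
    using b orth by (intro sum_mono) auto
  also have "\<dots> = (\<Sum>i\<in>I. \<Sum>j\<in>I. if R i j then q i / 2 else 0)
                 + (\<Sum>i\<in>I. \<Sum>j\<in>I. if R i j then q j / 2 else 0)"
    by (simp add: sum.distrib[symmetric] add_divide_distrib if_distrib cong: if_cong)
  \<comment> \<open>Symmetry of \<open>R\<close> turns the half that carries \<open>q j\<close> into
    the half that carries \<open>q i\<close>, so one row count serves both.\<close>
  also have "(\<Sum>i\<in>I. \<Sum>j\<in>I. if R i j then q j / 2 else 0) = (\<Sum>j\<in>I. \<Sum>i\<in>I. if R j i then q j / 2 else 0)"
    by (subst sum.swap) (intro sum.cong refl if_cong, auto intro: sym)
  also have "(\<Sum>i\<in>I. \<Sum>j\<in>I. if R i j then q i / 2 else 0) \<le> (\<Sum>i\<in>I. real N * (q i / 2))"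
  proof (rule sum_mono)
    fix i assume i: "i \<in> I"
    have "(\<Sum>j\<in>I. if R i j then q i / 2 else 0) = real (card {j\<in>I. R i j}) * (q i / 2)"
      using fin by (simp add: sum.inter_filter[symmetric])
    also have "\<dots> \<le> real N * (q i / 2)"
      using card[OF i] q0[of i] by (intro mult_right_mono) auto
    finally show "(\<Sum>j\<in>I. if R i j then q i / 2 else 0) \<le> real N * (q i / 2)" .
  qed
  then have "(\<Sum>i\<in>I. \<Sum>j\<in>I. if R i j then q i / 2 else 0) + (\<Sum>i\<in>I. \<Sum>j\<in>I. if R i j then q i / 2 else 0)
       \<le> real N * (\<Sum>i\<in>I. q i)"
    by (simp add: sum_distrib_left[symmetric] sum_divide_distrib[symmetric])
  finally show "(\<integral>\<omega>. (\<Sum>i\<in>I. \<xi> i \<omega>)\<^sup>2 \<partial>M) \<le> real N * (\<Sum>i\<in>I. \<integral>\<omega>. (\<xi> i \<omega>)\<^sup>2 \<partial>M)"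
    by (simp add: q_def)
qed

text \<open>\<open>C_n\<close> controls fourth moments of the errors; this and the next two
  inequalities derive bounds for squares and products from them without a conditional Hoelder
  inequality.\<close>

lemma square_le_one_plus_fourth: "(x::real)\<^sup>2 \<le> 1 + x ^ 4"
proof -
  have "0 \<le> (x\<^sup>2 - 1)\<^sup>2 + x^4 + 1" by simp
  then show ?thesis by (simp add: power2_eq_square power4_eq_xxxx algebra_simps)
qed

lemma abs_mult_le_fourth: "\<bar>x * y\<bar> \<le> 1 + (x::real) ^ 4 + y ^ 4"
proof -
  have "2 * (\<bar>x\<bar> * \<bar>y\<bar>) \<le> x\<^sup>2 + y\<^sup>2" using sum_squares_bound[of "\<bar>x\<bar>" "\<bar>y\<bar>"] by simp
  then show ?thesis
    using square_le_one_plus_fourth[of x] square_le_one_plus_fourth[of y] zero_le_power2[of "x\<^sup>2"]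
      zero_le_power2[of "y\<^sup>2"] unfolding abs_mult power2_eq_square power4_eq_xxxx mult.assoc by linarith
qed

lemma square_mult_le_fourth: "((x::real) * y)\<^sup>2 \<le> x ^ 4 / 2 + y ^ 4 / 2"
  using sum_squares_bound[of "x\<^sup>2" "y\<^sup>2"] by (simp add: power_mult_distrib power2_eq_square power4_eq_xxxx algebra_simps)

section \<open>Errors that are orthogonal across clusters\<close>

text \<open>\<open>Fo g\<close> stands for what is known from (X, W) and the errors outside cluster
  \<open>g\<close>. Of conditional independence only its effect on first moments and on products
  within one cluster is kept; this is all that the orthogonality arguments use.\<close>

locale clustered_errors = prob_space M for M :: "'a measure" +
  fixes F :: "'a measure" and Fo :: "'c \<Rightarrow> 'a measure"
    and I :: "'i set" and cl :: "'i \<Rightarrow> 'c" and u :: "'i \<Rightarrow> 'a \<Rightarrow> real"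
  assumes F_sub: "subalgebra M F"
    and Fo_sub: "\<And>i. i \<in> I \<Longrightarrow> subalgebra M (Fo (cl i))"
    and F_sub_Fo: "\<And>i. i \<in> I \<Longrightarrow> subalgebra (Fo (cl i)) F"
    and fin_I: "finite I"
    and u_meas: "\<And>i. i \<in> I \<Longrightarrow> u i \<in> borel_measurable M"
    and u_Fo: "\<And>i j. i \<in> I \<Longrightarrow> j \<in> I \<Longrightarrow> cl j \<noteq> cl i \<Longrightarrow> u j \<in> borel_measurable (Fo (cl i))"
    and mean0: "\<And>i. i \<in> I \<Longrightarrow> AE \<omega> in M. real_cond_exp M F (u i) \<omega> = 0"
    and indep1: "\<And>i. i \<in> I \<Longrightarrow>
      AE \<omega> in M. real_cond_exp M (Fo (cl i)) (u i) \<omega> = real_cond_exp M F (u i) \<omega>"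
    and indep2: "\<And>i j. i \<in> I \<Longrightarrow> j \<in> I \<Longrightarrow> cl j = cl i \<Longrightarrow>
      AE \<omega> in M. real_cond_exp M (Fo (cl i)) (\<lambda>\<omega>. u i \<omega> * u j \<omega>) \<omega>
        = real_cond_exp M F (\<lambda>\<omega>. u i \<omega> * u j \<omega>) \<omega>"
begin

text \<open>As the conditional means vanish, this is the conditional covariance of two errors; it is
  the expectation that appears in the target.\<close>

definition cprod :: "'i \<Rightarrow> 'i \<Rightarrow> 'a \<Rightarrow> real" where
  "cprod i j = real_cond_exp M F (\<lambda>\<omega>. u i \<omega> * u j \<omega>)"

lemma cprod_commute: "cprod i j = cprod j i"
  by (simp add: cprod_def mult.commute)

lemma cprod_F [measurable]: "cprod i j \<in> borel_measurable F"
  by (simp add: cprod_def)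

lemma F_measD: "f \<in> borel_measurable F \<Longrightarrow> f \<in> borel_measurable M"
  using F_sub measurable_from_subalg by blast

lemma cprod_meas [measurable]: "cprod i j \<in> borel_measurable M"
  by (rule F_measD) measurable

lemma F_Fo: "i \<in> I \<Longrightarrow> f \<in> borel_measurable F \<Longrightarrow> f \<in> borel_measurable (Fo (cl i))"
  using F_sub_Fo measurable_from_subalg by blast

lemma Fo_measD: "i \<in> I \<Longrightarrow> f \<in> borel_measurable (Fo (cl i)) \<Longrightarrow> f \<in> borel_measurable M"
  using Fo_sub measurable_from_subalg by blast

text \<open>\<open>Y\<close> may contain errors of other clusters; conditioning on
  \<open>Fo (cl i)\<close> pulls it out and leaves the conditional mean of \<open>u i\<close>, which
  is zero.\<close>

lemma orth1:
  assumes i: "i \<in> I" and Y: "Y \<in> borel_measurable (Fo (cl i))"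
    and int: "integrable M (\<lambda>\<omega>. Y \<omega> * u i \<omega>)"
  shows "(\<integral>\<omega>. Y \<omega> * u i \<omega> \<partial>M) = 0"
proof -
  interpret Fo: sigma_finite_subalgebra M "Fo (cl i)"
    by (rule subalgebra_sigma_finite[OF Fo_sub[OF i]])
  have "(\<integral>\<omega>. Y \<omega> * u i \<omega> \<partial>M) = (\<integral>\<omega>. Y \<omega> * real_cond_exp M (Fo (cl i)) (u i) \<omega> \<partial>M)"
    by (rule Fo.real_cond_exp_intg(2)[symmetric, OF int Y u_meas[OF i]])
  also have "\<dots> = (\<integral>\<omega>. 0 \<partial>M)"
    using Fo_measD[OF i Y] indep1[OF i] mean0[OF i] by (intro integral_cong_AE) auto
  finally show ?thesis by simp
qed

text \<open>Within one cluster the conditional mean of the product given \<open>Fo (cl i)\<close> is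
  still \<open>cprod i j\<close>, so the centred product is orthogonal to whatever the other
  clusters determine.\<close>

lemma orth2:
  assumes i: "i \<in> I" and j: "j \<in> I" "cl j = cl i" and Y: "Y \<in> borel_measurable (Fo (cl i))"
    and int: "integrable M (\<lambda>\<omega>. Y \<omega> * (u i \<omega> * u j \<omega>))"
      "integrable M (\<lambda>\<omega>. Y \<omega> * cprod i j \<omega>)"
  shows "(\<integral>\<omega>. Y \<omega> * (u i \<omega> * u j \<omega> - cprod i j \<omega>) \<partial>M) = 0"
proof -
  interpret Fo: sigma_finite_subalgebra M "Fo (cl i)"
    by (rule subalgebra_sigma_finite[OF Fo_sub[OF i]])
  have [measurable]: "u i \<in> borel_measurable M" "u j \<in> borel_measurable M" "Y \<in> borel_measurable M"
    using u_meas i j Fo_measD[OF i Y] by auto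
  have "(\<integral>\<omega>. Y \<omega> * (u i \<omega> * u j \<omega>) \<partial>M)
      = (\<integral>\<omega>. Y \<omega> * real_cond_exp M (Fo (cl i)) (\<lambda>\<omega>. u i \<omega> * u j \<omega>) \<omega> \<partial>M)"
    by (rule Fo.real_cond_exp_intg(2)[symmetric, OF int(1) Y]) simp
  also have "\<dots> = (\<integral>\<omega>. Y \<omega> * cprod i j \<omega> \<partial>M)"
    using indep2[OF i j] by (intro integral_cong_AE) (auto simp: cprod_def)
  finally show ?thesis using int by (simp add: right_diff_distrib)
qed

end

text \<open>The moment bound holds only on \<open>A\<close>; elsewhere the errors are unrestricted.
  Since \<open>A\<close> lies in \<open>F\<close>, its indicator can be moved in and out of
  conditional expectations.\<close>

locale clustered_moments = clustered_errors M F Fo I cl u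
  for M :: "'a measure" and F :: "'a measure" and Fo :: "'c \<Rightarrow> 'a measure"
    and I :: "'i set" and cl :: "'i \<Rightarrow> 'c" and u :: "'i \<Rightarrow> 'a \<Rightarrow> real" +
  fixes A :: "'a set" and C :: real
  assumes A: "A \<in> sets F" and C0: "C \<ge> 0"
    and moment: "\<And>i. i \<in> I \<Longrightarrow>
      AE \<omega> in M. \<omega> \<in> A \<longrightarrow> nn_cond_exp M F (\<lambda>\<omega>. ennreal (u i \<omega> ^ 4)) \<omega> \<le> ennreal C"
begin

sublocale F: sigma_finite_subalgebra M F
  by (rule subalgebra_sigma_finite[OF F_sub])

text \<open>Coefficients that conditioning on \<open>F\<close> treats as constants. Boundedness and
  vanishing off \<open>A\<close> make their products with one or two errors
  square-integrable.\<close>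

definition weight :: "('a \<Rightarrow> real) \<Rightarrow> bool" where
  "weight b \<longleftrightarrow> b \<in> borel_measurable F \<and> (\<forall>\<omega>\<in>space M - A. b \<omega> = 0) \<and> (\<exists>\<beta>. \<forall>\<omega>\<in>space M. \<bar>b \<omega>\<bar> \<le> \<beta>)"

lemma weight_F [measurable_dest]: "weight b \<Longrightarrow> b \<in> borel_measurable F"
  by (simp add: weight_def)

lemma weight_M: "weight b \<Longrightarrow> b \<in> borel_measurable M"
  by (intro F_measD weight_F)

lemma weight_integrable_square:
  assumes "weight b" shows "integrable M (\<lambda>\<omega>. (b \<omega>)\<^sup>2)"
proof -
  obtain \<beta> where \<beta>: "\<forall>\<omega>\<in>space M. \<bar>b \<omega>\<bar> \<le> \<beta>" using assms by (auto simp: weight_def)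
  have [measurable]: "b \<in> borel_measurable M" by (rule weight_M[OF assms])
  have "AE \<omega> in M. norm ((b \<omega>)\<^sup>2) \<le> \<beta>\<^sup>2"
  proof (rule AE_I2)
    fix \<omega> assume "\<omega> \<in> space M"
    then have "\<bar>b \<omega>\<bar>\<^sup>2 \<le> \<beta>\<^sup>2" using \<beta> by (intro power_mono) auto
    then show "norm ((b \<omega>)\<^sup>2) \<le> \<beta>\<^sup>2" by simp
  qed
  then show ?thesis by (rule integrable_const_bound) simp
qed

text \<open>The defining identity of \<open>nn_cond_exp\<close> holds for every nonnegative
  function, so integrability is a consequence: the conditional moment is at most \<open>C\<close> on
  \<open>A\<close>, and \<open>b\<close> is zero elsewhere.\<close>

lemma weighted_fourth_moment:
  assumes b: "weight b" and i: "i \<in> I"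
  shows "integrable M (\<lambda>\<omega>. (b \<omega>)\<^sup>2 * u i \<omega> ^ 4)"
    and "(\<integral>\<omega>. (b \<omega>)\<^sup>2 * u i \<omega> ^ 4 \<partial>M) \<le> C * (\<integral>\<omega>. (b \<omega>)\<^sup>2 \<partial>M)"
proof -
  have [measurable]: "b \<in> borel_measurable F" "b \<in> borel_measurable M" "u i \<in> borel_measurable M"
    using weight_F[OF b] weight_M[OF b] u_meas[OF i] by auto
  have "(\<integral>\<^sup>+\<omega>. ennreal ((b \<omega>)\<^sup>2 * u i \<omega> ^ 4) \<partial>M) = (\<integral>\<^sup>+\<omega>. ennreal ((b \<omega>)\<^sup>2) * ennreal (u i \<omega> ^ 4) \<partial>M)"
    by (simp add: ennreal_mult)
  also have "\<dots> = (\<integral>\<^sup>+\<omega>. ennreal ((b \<omega>)\<^sup>2) * nn_cond_exp M F (\<lambda>\<omega>. ennreal (u i \<omega> ^ 4)) \<omega> \<partial>M)"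
    by (rule F.nn_cond_exp_intg[symmetric]) measurable
  also have "\<dots> \<le> (\<integral>\<^sup>+\<omega>. ennreal C * ennreal ((b \<omega>)\<^sup>2) \<partial>M)"
  proof (rule nn_integral_mono_AE)
    show "AE \<omega> in M. ennreal ((b \<omega>)\<^sup>2) * nn_cond_exp M F (\<lambda>\<omega>. ennreal (u i \<omega> ^ 4)) \<omega>
        \<le> ennreal C * ennreal ((b \<omega>)\<^sup>2)"
      using moment[OF i] AE_space
    proof eventually_elim
      case (elim \<omega>)
      show ?case
      proof (cases "\<omega> \<in> A")
        case True
        then have "nn_cond_exp M F (\<lambda>\<omega>. ennreal (u i \<omega> ^ 4)) \<omega> \<le> ennreal C" using elim by simp
        from mult_left_mono[OF this, of "ennreal ((b \<omega>)\<^sup>2)"] show ?thesis by (simp add: mult.commute)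
      next
        case False
        then show ?thesis using b elim by (simp add: weight_def)
      qed
    qed
  qed
  also have "\<dots> = ennreal C * (\<integral>\<^sup>+\<omega>. ennreal ((b \<omega>)\<^sup>2) \<partial>M)"
    by (rule nn_integral_cmult) measurable
  also have "\<dots> = ennreal (C * (\<integral>\<omega>. (b \<omega>)\<^sup>2 \<partial>M))"
    using C0 weight_integrable_square[OF b] by (simp add: nn_integral_eq_integral ennreal_mult)
  finally have le: "(\<integral>\<^sup>+\<omega>. ennreal ((b \<omega>)\<^sup>2 * u i \<omega> ^ 4) \<partial>M) \<le> ennreal (C * (\<integral>\<omega>. (b \<omega>)\<^sup>2 \<partial>M))" .
  show int: "integrable M (\<lambda>\<omega>. (b \<omega>)\<^sup>2 * u i \<omega> ^ 4)"
  proof (rule integrableI_nonneg)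
    show "(\<integral>\<^sup>+\<omega>. ennreal ((b \<omega>)\<^sup>2 * u i \<omega> ^ 4) \<partial>M) < \<infinity>"
      using le_less_trans[OF le ennreal_less_top] by simp
  qed auto
  show "(\<integral>\<omega>. (b \<omega>)\<^sup>2 * u i \<omega> ^ 4 \<partial>M) \<le> C * (\<integral>\<omega>. (b \<omega>)\<^sup>2 \<partial>M)"
    using le C0 int by (subst (asm) nn_integral_eq_integral) auto
qed

lemma weighted_second_moment:
  assumes b: "weight b" and i: "i \<in> I"
  shows "integrable M (\<lambda>\<omega>. (b \<omega> * u i \<omega>)\<^sup>2)"
    and "(\<integral>\<omega>. (b \<omega> * u i \<omega>)\<^sup>2 \<partial>M) \<le> (1 + C) * (\<integral>\<omega>. (b \<omega>)\<^sup>2 \<partial>M)"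
proof -
  have [measurable]: "b \<in> borel_measurable M" "u i \<in> borel_measurable M"
    using weight_M[OF b] u_meas[OF i] by auto
  have le: "(b \<omega> * u i \<omega>)\<^sup>2 \<le> (b \<omega>)\<^sup>2 + (b \<omega>)\<^sup>2 * u i \<omega> ^ 4" for \<omega>
    using mult_left_mono[OF square_le_one_plus_fourth[of "u i \<omega>"], of "(b \<omega>)\<^sup>2"]
    by (simp add: power_mult_distrib distrib_left)
  have int: "integrable M (\<lambda>\<omega>. (b \<omega>)\<^sup>2 + (b \<omega>)\<^sup>2 * u i \<omega> ^ 4)"
    by (intro Bochner_Integration.integrable_add weight_integrable_square[OF b] weighted_fourth_moment[OF b i])
  show 1: "integrable M (\<lambda>\<omega>. (b \<omega> * u i \<omega>)\<^sup>2)"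
    by (rule Bochner_Integration.integrable_bound[OF int])
       (use le in \<open>auto simp: abs_of_nonneg intro!: AE_I2\<close>)
  have "(\<integral>\<omega>. (b \<omega> * u i \<omega>)\<^sup>2 \<partial>M) \<le> (\<integral>\<omega>. (b \<omega>)\<^sup>2 + (b \<omega>)\<^sup>2 * u i \<omega> ^ 4 \<partial>M)"
    by (rule integral_mono[OF 1 int le])
  also have "\<dots> \<le> (1 + C) * (\<integral>\<omega>. (b \<omega>)\<^sup>2 \<partial>M)"
    using weighted_fourth_moment[OF b i] weight_integrable_square[OF b] by (simp add: distrib_right)
  finally show "(\<integral>\<omega>. (b \<omega> * u i \<omega>)\<^sup>2 \<partial>M) \<le> (1 + C) * (\<integral>\<omega>. (b \<omega>)\<^sup>2 \<partial>M)" .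
qed

text \<open>The square of \<open>u i * u j\<close> is at most the mean of the two fourth powers, so
  the constant \<open>C\<close> is preserved.\<close>

lemma weight_uu_square:
  assumes b: "weight b" and i: "i \<in> I" "j \<in> I"
  shows "integrable M (\<lambda>\<omega>. (b \<omega> * (u i \<omega> * u j \<omega>))\<^sup>2)"
    and "(\<integral>\<omega>. (b \<omega> * (u i \<omega> * u j \<omega>))\<^sup>2 \<partial>M) \<le> C * (\<integral>\<omega>. (b \<omega>)\<^sup>2 \<partial>M)"
proof -
  have [measurable]: "b \<in> borel_measurable M" "u i \<in> borel_measurable M" "u j \<in> borel_measurable M"
    using weight_M[OF b] u_meas i by auto
  have le: "(b \<omega> * (u i \<omega> * u j \<omega>))\<^sup>2 \<le> (b \<omega>)\<^sup>2 * u i \<omega> ^ 4 / 2 + (b \<omega>)\<^sup>2 * u j \<omega> ^ 4 / 2" for \<omega>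
    using mult_left_mono[OF square_mult_le_fourth[of "u i \<omega>" "u j \<omega>"], of "(b \<omega>)\<^sup>2"]
    by (simp add: power_mult_distrib distrib_left)
  have int: "integrable M (\<lambda>\<omega>. (b \<omega>)\<^sup>2 * u i \<omega> ^ 4 / 2 + (b \<omega>)\<^sup>2 * u j \<omega> ^ 4 / 2)"
    by (intro Bochner_Integration.integrable_add integrable_divide_zero weighted_fourth_moment[OF b] i)
  show 1: "integrable M (\<lambda>\<omega>. (b \<omega> * (u i \<omega> * u j \<omega>))\<^sup>2)"
    by (rule Bochner_Integration.integrable_bound[OF int])
       (use le in \<open>auto simp: abs_of_nonneg intro!: AE_I2\<close>)
  have "(\<integral>\<omega>. (b \<omega> * (u i \<omega> * u j \<omega>))\<^sup>2 \<partial>M)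
      \<le> (\<integral>\<omega>. (b \<omega>)\<^sup>2 * u i \<omega> ^ 4 / 2 + (b \<omega>)\<^sup>2 * u j \<omega> ^ 4 / 2 \<partial>M)"
    by (rule integral_mono[OF 1 int le])
  also have "\<dots> \<le> C * (\<integral>\<omega>. (b \<omega>)\<^sup>2 \<partial>M)"
    using weighted_fourth_moment[OF b i(1)] weighted_fourth_moment[OF b i(2)] by simp
  finally show "(\<integral>\<omega>. (b \<omega> * (u i \<omega> * u j \<omega>))\<^sup>2 \<partial>M) \<le> C * (\<integral>\<omega>. (b \<omega>)\<^sup>2 \<partial>M)" .
qed

lemma integrable_of_square:
  fixes f :: "'a \<Rightarrow> real"
  assumes "integrable M (\<lambda>\<omega>. (f \<omega>)\<^sup>2)" "f \<in> borel_measurable M"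
  shows "integrable M f"
  using integrable_mult_of_squares[of M f "\<lambda>_. 1", OF assms(1) _ assms(2)] by simp

lemma weight_uu_integrable:
  assumes b: "weight b" and i: "i \<in> I" "j \<in> I"
  shows "integrable M (\<lambda>\<omega>. b \<omega> * (u i \<omega> * u j \<omega>))"
proof (rule integrable_of_square[OF weight_uu_square(1)[OF assms]])
  have [measurable]: "b \<in> borel_measurable M" "u i \<in> borel_measurable M" "u j \<in> borel_measurable M"
    using weight_M[OF b] u_meas i by auto
  show "(\<lambda>\<omega>. b \<omega> * (u i \<omega> * u j \<omega>)) \<in> borel_measurable M" by measurable
qed

lemma weight_mult:
  assumes "weight b" "f \<in> borel_measurable F" "\<And>\<omega>. \<omega> \<in> space M \<Longrightarrow> \<bar>f \<omega>\<bar> \<le> 1"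
  shows "weight (\<lambda>\<omega>. f \<omega> * b \<omega>)"
proof -
  obtain \<beta> where \<beta>: "\<forall>\<omega>\<in>space M. \<bar>b \<omega>\<bar> \<le> \<beta>" using assms by (auto simp: weight_def)
  have "\<bar>f \<omega> * b \<omega>\<bar> \<le> \<beta>" if "\<omega> \<in> space M" for \<omega>
    using mult_mono[OF assms(3)[OF that] \<beta>[rule_format, OF that]] by (simp add: abs_mult)
  then show ?thesis using assms(1,2) unfolding weight_def by (intro conjI exI[of _ \<beta>]) auto
qed

lemma weight_A: "weight (indicator A)"
  unfolding weight_def
proof (intro conjI)
  show "(indicator A :: 'a \<Rightarrow> real) \<in> borel_measurable F" using A by simp
  show "\<forall>\<omega>\<in>space M - A. indicator A \<omega> = (0::real)" by simp
  show "\<exists>\<beta>. \<forall>\<omega>\<in>space M. \<bar>indicator A \<omega> :: real\<bar> \<le> \<beta>"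
    by (rule exI[of _ 1]) (simp add: indicator_def)
qed

text \<open>The product of two errors need not be integrable, so \<open>cprod\<close> is handled
  through the truncated product, to which the usual rules apply.\<close>

lemma cprod_indicator:
  assumes i: "i \<in> I" "j \<in> I"
  shows "AE \<omega> in M. real_cond_exp M F (\<lambda>\<omega>. indicator A \<omega> * (u i \<omega> * u j \<omega>)) \<omega> = indicator A \<omega> * cprod i j \<omega>"
  unfolding cprod_def using A u_meas i
  by (intro F.real_cond_exp_mult weight_uu_integrable[OF weight_A i]) auto

text \<open>Tested against a set \<open>D\<close> in \<open>F\<close>: if the clusters differ,
  \<open>u j\<close> is measurable for \<open>Fo (cl i)\<close>, and \<open>orth1\<close> removes
  \<open>u i\<close>.\<close>

lemma cprod_zero:
  assumes i: "i \<in> I" "j \<in> I" and ne: "cl i \<noteq> cl j"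
  shows "AE \<omega> in M. \<omega> \<in> A \<longrightarrow> cprod i j \<omega> = 0"
proof -
  have [measurable]: "A \<in> sets F" by (rule A)
  have "AE \<omega> in M. real_cond_exp M F (\<lambda>\<omega>. indicator A \<omega> * (u i \<omega> * u j \<omega>)) \<omega> = 0"
  proof (rule F.real_cond_exp_charact)
    fix D assume [measurable]: "D \<in> sets F"
    have w: "weight (\<lambda>\<omega>. indicator D \<omega> * indicator A \<omega>)"
      by (rule weight_mult[OF weight_A]) (auto simp: indicator_def)
    have "(\<integral>\<omega>. (indicator D \<omega> * indicator A \<omega> * u j \<omega>) * u i \<omega> \<partial>M) = 0"
    proof (rule orth1[OF i(1)])
      have "(\<lambda>\<omega>. indicator D \<omega> * indicator A \<omega>::real) \<in> borel_measurable (Fo (cl i))"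
        by (rule F_Fo[OF i(1)]) measurable
      then show "(\<lambda>\<omega>. indicator D \<omega> * indicator A \<omega> * u j \<omega>) \<in> borel_measurable (Fo (cl i))"
        using u_Fo[OF i ne[symmetric]] by measurable
      show "integrable M (\<lambda>\<omega>. indicator D \<omega> * indicator A \<omega> * u j \<omega> * u i \<omega>)"
        using weight_uu_integrable[OF w i(2,1)] by (simp add: mult.assoc)
    qed
    then show "(LINT \<omega>:D|M. indicator A \<omega> * (u i \<omega> * u j \<omega>)) = (LINT \<omega>:D|M. 0)"
      by (simp add: set_lebesgue_integral_def ac_simps)
  qed (auto intro: weight_uu_integrable[OF weight_A i])
  then show ?thesis using cprod_indicator[OF i]
    by eventually_elim auto
qed

text \<open>Passing to \<open>nn_cond_exp\<close> and using |x y| \<le> 1 + x^4 + y^4 gives 1 from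
  the constant and \<open>C\<close> from each of the two errors.\<close>

lemma cprod_bound:
  assumes i: "i \<in> I" "j \<in> I"
  shows "AE \<omega> in M. \<omega> \<in> A \<longrightarrow> \<bar>cprod i j \<omega>\<bar> \<le> 1 + 2 * C"
proof -
  have [measurable]: "u i \<in> borel_measurable M" "u j \<in> borel_measurable M"
    using u_meas i by auto
  let ?N = "nn_cond_exp M F"
  have 1: "AE \<omega> in M. ennreal \<bar>cprod i j \<omega>\<bar> \<le> ?N (\<lambda>\<omega>. ennreal \<bar>u i \<omega> * u j \<omega>\<bar>) \<omega>"
    unfolding cprod_def by (rule F.real_cond_exp_abs) measurable
  have 2: "AE \<omega> in M. ?N (\<lambda>\<omega>. ennreal \<bar>u i \<omega> * u j \<omega>\<bar>) \<omega>
     \<le> ?N (\<lambda>\<omega>. (1 + ennreal (u i \<omega> ^ 4)) + ennreal (u j \<omega> ^ 4)) \<omega>"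
  proof (rule F.nn_cond_exp_mono)
    have "ennreal \<bar>u i \<omega> * u j \<omega>\<bar> \<le> (1 + ennreal (u i \<omega> ^ 4)) + ennreal (u j \<omega> ^ 4)" for \<omega>
      using ennreal_leI[OF abs_mult_le_fourth[of "u i \<omega>" "u j \<omega>"]] by simp
    then show "AE \<omega> in M. ennreal \<bar>u i \<omega> * u j \<omega>\<bar> \<le> (1 + ennreal (u i \<omega> ^ 4)) + ennreal (u j \<omega> ^ 4)" by simp
  qed auto
  have 3: "AE \<omega> in M. ?N (\<lambda>\<omega>. 1 + ennreal (u i \<omega> ^ 4)) \<omega> + ?N (\<lambda>\<omega>. ennreal (u j \<omega> ^ 4)) \<omega>
      = ?N (\<lambda>\<omega>. (1 + ennreal (u i \<omega> ^ 4)) + ennreal (u j \<omega> ^ 4)) \<omega>"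
    by (rule F.nn_cond_exp_sum) auto
  have 4: "AE \<omega> in M. ?N (\<lambda>\<omega>. 1) \<omega> + ?N (\<lambda>\<omega>. ennreal (u i \<omega> ^ 4)) \<omega>
      = ?N (\<lambda>\<omega>. 1 + ennreal (u i \<omega> ^ 4)) \<omega>"
    by (rule F.nn_cond_exp_sum) auto
  have 5: "AE \<omega> in M. 1 = ?N (\<lambda>\<omega>. 1) \<omega>"
    by (rule F.nn_cond_exp_F_meas) auto
  show ?thesis
    using 1 2 3 4 5 moment[OF i(1)] moment[OF i(2)]
  proof eventually_elim
    case (elim \<omega>)
    show ?case
    proof
      assume "\<omega> \<in> A"
      with elim have m: "?N (\<lambda>\<omega>. ennreal (u i \<omega> ^ 4)) \<omega> \<le> ennreal C" "?N (\<lambda>\<omega>. ennreal (u j \<omega> ^ 4)) \<omega> \<le> ennreal C"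
        by auto
      have "ennreal \<bar>cprod i j \<omega>\<bar> \<le> 1 + ?N (\<lambda>\<omega>. ennreal (u i \<omega> ^ 4)) \<omega> + ?N (\<lambda>\<omega>. ennreal (u j \<omega> ^ 4)) \<omega>"
        using elim(1,2) unfolding elim(3)[symmetric] elim(4)[symmetric] elim(5)[symmetric] by (rule order_trans)
      also have "\<dots> \<le> 1 + ennreal C + ennreal C"
        using m by (intro add_mono) auto
      also have "\<dots> = ennreal (1 + 2 * C)" using C0
        by (simp add: ennreal_plus[symmetric] ennreal_1[symmetric] del: ennreal_plus ennreal_1)
      finally show "\<bar>cprod i j \<omega>\<bar> \<le> 1 + 2 * C"
        by (rule ennreal_le_iff[THEN iffD1, rotated]) (use C0 in simp)
    qed
  qed
qed

section \<open>Second moments of quadratic and linear forms\<close>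

text \<open>From (p - q)^2 \<le> 2 p^2 + 2 q^2: relative to the squared weight, \<open>C\<close>
  bounds the square of the product of two errors and (1 + 2 C)^2 the square of its conditional
  mean.\<close>

definition kap :: real where "kap = 2 * C + 2 * (1 + 2 * C)\<^sup>2"

lemma kap_nonneg: "kap \<ge> 0" using C0 by (simp add: kap_def)

definition xi :: "('a \<Rightarrow> real) \<Rightarrow> 'i \<Rightarrow> 'i \<Rightarrow> 'a \<Rightarrow> real" where
  "xi b i j \<omega> = b \<omega> * (u i \<omega> * u j \<omega> - cprod i j \<omega>)"

lemma weight_cprod_square:
  assumes b: "weight b" and i: "i \<in> I" "j \<in> I"
  shows "integrable M (\<lambda>\<omega>. (b \<omega> * cprod i j \<omega>)\<^sup>2)"
    and "(\<integral>\<omega>. (b \<omega> * cprod i j \<omega>)\<^sup>2 \<partial>M) \<le> (1 + 2 * C)\<^sup>2 * (\<integral>\<omega>. (b \<omega>)\<^sup>2 \<partial>M)"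
proof -
  have [measurable]: "b \<in> borel_measurable M" using weight_M[OF b] by auto
  have le: "AE \<omega> in M. (b \<omega> * cprod i j \<omega>)\<^sup>2 \<le> (1 + 2 * C)\<^sup>2 * (b \<omega>)\<^sup>2"
    using cprod_bound[OF i] AE_space
  proof eventually_elim
    case (elim \<omega>)
    show ?case
    proof (cases "\<omega> \<in> A")
      case True
      then have "(cprod i j \<omega>)\<^sup>2 \<le> (1 + 2 * C)\<^sup>2" using elim C0 by (intro abs_le_square_iff[THEN iffD1]) auto
      from mult_left_mono[OF this, of "(b \<omega>)\<^sup>2"] show ?thesis by (simp add: power_mult_distrib mult.commute)
    next
      case False
      then show ?thesis using b elim by (simp add: weight_def)
    qed
  qed
  have int: "integrable M (\<lambda>\<omega>. (1 + 2 * C)\<^sup>2 * (b \<omega>)\<^sup>2)"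
    using weight_integrable_square[OF b] by simp
  show 1: "integrable M (\<lambda>\<omega>. (b \<omega> * cprod i j \<omega>)\<^sup>2)"
    by (rule Bochner_Integration.integrable_bound[OF int]) (use le in \<open>auto elim!: eventually_mono simp: abs_of_nonneg\<close>)
  show "(\<integral>\<omega>. (b \<omega> * cprod i j \<omega>)\<^sup>2 \<partial>M) \<le> (1 + 2 * C)\<^sup>2 * (\<integral>\<omega>. (b \<omega>)\<^sup>2 \<partial>M)"
    using integral_mono_AE[OF 1 int le] by simp
qed

lemma xi_meas:
  assumes "weight b" "i \<in> I" "j \<in> I" shows "xi b i j \<in> borel_measurable M"
proof -
  have [measurable]: "b \<in> borel_measurable M" "u i \<in> borel_measurable M" "u j \<in> borel_measurable M"
    using weight_M u_meas assms by auto
  show ?thesis unfolding xi_def by measurable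
qed

lemma xi_square:
  assumes b: "weight b" and i: "i \<in> I" "j \<in> I"
  shows "integrable M (\<lambda>\<omega>. (xi b i j \<omega>)\<^sup>2)"
    and "(\<integral>\<omega>. (xi b i j \<omega>)\<^sup>2 \<partial>M) \<le> kap * (\<integral>\<omega>. (b \<omega>)\<^sup>2 \<partial>M)"
proof -
  have [measurable]: "b \<in> borel_measurable M" "u i \<in> borel_measurable M" "u j \<in> borel_measurable M"
    using weight_M[OF b] u_meas i by auto
  have le: "(xi b i j \<omega>)\<^sup>2 \<le> 2 * (b \<omega> * (u i \<omega> * u j \<omega>))\<^sup>2 + 2 * (b \<omega> * cprod i j \<omega>)\<^sup>2" for \<omega>
    using zero_le_power2[of "b \<omega> * (u i \<omega> * u j \<omega>) + b \<omega> * cprod i j \<omega>"]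
    unfolding xi_def right_diff_distrib power2_diff power2_sum by linarith
  have int: "integrable M (\<lambda>\<omega>. 2 * (b \<omega> * (u i \<omega> * u j \<omega>))\<^sup>2 + 2 * (b \<omega> * cprod i j \<omega>)\<^sup>2)"
    using weight_uu_square[OF assms] weight_cprod_square[OF assms] by simp
  show 1: "integrable M (\<lambda>\<omega>. (xi b i j \<omega>)\<^sup>2)"
    by (rule Bochner_Integration.integrable_bound[OF int])
       (use le xi_meas[OF assms] in \<open>auto simp: abs_of_nonneg intro!: AE_I2\<close>)
  have "(\<integral>\<omega>. (xi b i j \<omega>)\<^sup>2 \<partial>M) \<le> (\<integral>\<omega>. 2 * (b \<omega> * (u i \<omega> * u j \<omega>))\<^sup>2 + 2 * (b \<omega> * cprod i j \<omega>)\<^sup>2 \<partial>M)"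
    by (rule integral_mono[OF 1 int le])
  also have "\<dots> \<le> kap * (\<integral>\<omega>. (b \<omega>)\<^sup>2 \<partial>M)"
    using weight_uu_square[OF assms] weight_cprod_square[OF assms] by (simp add: kap_def algebra_simps)
  finally show "(\<integral>\<omega>. (xi b i j \<omega>)\<^sup>2 \<partial>M) \<le> kap * (\<integral>\<omega>. (b \<omega>)\<^sup>2 \<partial>M)" .
qed

lemma xi_Fo:
  assumes "weight b" "g \<in> I" "i \<in> I" "j \<in> I" "cl i \<noteq> cl g" "cl j \<noteq> cl g"
  shows "xi b i j \<in> borel_measurable (Fo (cl g))"
proof -
  have [measurable]: "b \<in> borel_measurable (Fo (cl g))" "cprod i j \<in> borel_measurable (Fo (cl g))"
    "u i \<in> borel_measurable (Fo (cl g))" "u j \<in> borel_measurable (Fo (cl g))"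
    by (rule F_Fo[OF assms(2) weight_F[OF assms(1)]] F_Fo[OF assms(2) cprod_F]
        u_Fo[OF assms(2,3,5)] u_Fo[OF assms(2,4,6)])+
  show ?thesis unfolding xi_def by measurable
qed

text \<open>Neither cluster of the second term equals that of \<open>i\<close>, so the second term
  is measurable for \<open>Fo (cl i)\<close>. If \<open>j\<close> shares the cluster of
  \<open>i\<close>, the centred product integrates to zero by \<open>orth2\<close>; otherwise
  \<open>u j\<close> is measurable as well and \<open>orth1\<close> applies to \<open>u i\<close>
  alone.\<close>

lemma xi_orth_aux:
  assumes b: "weight b" "weight b'" and i: "i \<in> I" "j \<in> I" "p \<in> I" "q \<in> I"
    and ne: "cl p \<noteq> cl i" "cl q \<noteq> cl i"
  shows "(\<integral>\<omega>. xi b i j \<omega> * xi b' p q \<omega> \<partial>M) = 0"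
proof -
  have [measurable]: "b \<in> borel_measurable M" "b \<in> borel_measurable (Fo (cl i))"
    "u i \<in> borel_measurable M" "u j \<in> borel_measurable M"
    "xi b' p q \<in> borel_measurable (Fo (cl i))" "xi b' p q \<in> borel_measurable M"
    by (rule weight_M[OF b(1)] F_Fo[OF i(1) weight_F[OF b(1)]] u_meas[OF i(1)] u_meas[OF i(2)]
        xi_Fo[OF b(2) i(1,3,4) ne] xi_meas[OF b(2) i(3,4)])+
  have 1: "integrable M (\<lambda>\<omega>. (b \<omega> * (u i \<omega> * u j \<omega>)) * xi b' p q \<omega>)"
    by (rule integrable_mult_of_squares[OF weight_uu_square(1)[OF b(1) i(1,2)] xi_square(1)[OF b(2) i(3,4)]])
       measurable
  have 2: "integrable M (\<lambda>\<omega>. (b \<omega> * cprod i j \<omega>) * xi b' p q \<omega>)"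
    by (rule integrable_mult_of_squares[OF weight_cprod_square(1)[OF b(1) i(1,2)] xi_square(1)[OF b(2) i(3,4)]])
       measurable
  show ?thesis
  proof (cases "cl j = cl i")
    case True
    have "(\<integral>\<omega>. (b \<omega> * xi b' p q \<omega>) * (u i \<omega> * u j \<omega> - cprod i j \<omega>) \<partial>M) = 0"
    proof (rule orth2[OF i(1,2) True])
      show "integrable M (\<lambda>\<omega>. b \<omega> * xi b' p q \<omega> * (u i \<omega> * u j \<omega>))"
        using 1 by (simp add: ac_simps)
      show "integrable M (\<lambda>\<omega>. b \<omega> * xi b' p q \<omega> * cprod i j \<omega>)"
        using 2 by (simp add: ac_simps)
    qed measurable
    then show ?thesis by (simp add: xi_def[of b] ac_simps)
  next
    case False
    then have [measurable]: "u j \<in> borel_measurable (Fo (cl i))" using u_Fo i by auto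
    have "(\<integral>\<omega>. (b \<omega> * u j \<omega> * xi b' p q \<omega>) * u i \<omega> \<partial>M) = 0"
    proof (rule orth1[OF i(1)])
      show "integrable M (\<lambda>\<omega>. b \<omega> * u j \<omega> * xi b' p q \<omega> * u i \<omega>)"
        using 1 by (simp add: ac_simps)
    qed measurable
    moreover have "(\<integral>\<omega>. xi b i j \<omega> * xi b' p q \<omega> \<partial>M) = (\<integral>\<omega>. (b \<omega> * u j \<omega> * xi b' p q \<omega>) * u i \<omega> \<partial>M)"
    proof (rule integral_cong_AE)
      \<comment> \<open>The centring term disappears: \<open>cprod i j\<close> is zero on
        \<open>A\<close> for different clusters, and \<open>b\<close> is zero off
        \<open>A\<close>.\<close>
      show "AE \<omega> in M. xi b i j \<omega> * xi b' p q \<omega> = (b \<omega> * u j \<omega> * xi b' p q \<omega>) * u i \<omega>"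
        using cprod_zero[OF i(1,2) False[symmetric]] AE_space
        by eventually_elim (use b(1) in \<open>auto simp: xi_def[of b] weight_def\<close>)
    qed (use xi_meas[OF b(1) i(1,2)] in simp_all)
    ultimately show ?thesis by simp
  qed
qed

lemma xi_commute: "xi b i j = xi b j i"
  by (auto simp: xi_def cprod_commute fun_eq_iff mult.commute)

text \<open>If two pairs of clusters differ as sets, one of the four clusters is missing from the
  other pair; symmetry of \<open>xi\<close> and of the product reduces this to
  \<open>xi_orth_aux\<close>.\<close>

lemma xi_orth:
  assumes b: "weight b" "weight b'" and i: "i \<in> I" "j \<in> I" "p \<in> I" "q \<in> I"
    and ne: "{cl i, cl j} \<noteq> {cl p, cl q}"
  shows "(\<integral>\<omega>. xi b i j \<omega> * xi b' p q \<omega> \<partial>M) = 0"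
proof -
  have "(cl p \<noteq> cl i \<and> cl q \<noteq> cl i) \<or> (cl p \<noteq> cl j \<and> cl q \<noteq> cl j)
      \<or> (cl i \<noteq> cl p \<and> cl j \<noteq> cl p) \<or> (cl i \<noteq> cl q \<and> cl j \<noteq> cl q)"
    using ne unfolding doubleton_eq_iff by metis
  then show ?thesis
  proof (elim disjE conjE)
    assume "cl p \<noteq> cl i" "cl q \<noteq> cl i"
    then show ?thesis by (rule xi_orth_aux[OF b i])
  next
    assume "cl p \<noteq> cl j" "cl q \<noteq> cl j"
    then show ?thesis unfolding xi_commute[of b i j] by (rule xi_orth_aux[OF b i(2,1,3,4)])
  next
    assume "cl i \<noteq> cl p" "cl j \<noteq> cl p"
    then have "(\<integral>\<omega>. xi b' p q \<omega> * xi b i j \<omega> \<partial>M) = 0" by (rule xi_orth_aux[OF b(2,1) i(3,4,1,2)])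
    then show ?thesis by (simp only: mult.commute)
  next
    assume "cl i \<noteq> cl q" "cl j \<noteq> cl q"
    then have "(\<integral>\<omega>. xi b' q p \<omega> * xi b i j \<omega> \<partial>M) = 0" by (rule xi_orth_aux[OF b(2,1) i(4,3,1,2)])
    then show ?thesis unfolding xi_commute[of b' p q] by (simp only: mult.commute)
  qed
qed

text \<open>Two index pairs are related when they have the same unordered pair of clusters. The
  clusters can be matched in two orders, with at most c^2 choices of indices for each, which is the
  factor 2 c^2.\<close>

lemma quadratic_form_variance:
  assumes b: "\<And>i j. i \<in> I \<Longrightarrow> j \<in> I \<Longrightarrow> weight (b i j)"
    and c: "\<And>i. i \<in> I \<Longrightarrow> card {j\<in>I. cl j = cl i} \<le> c"
  shows "integrable M (\<lambda>\<omega>. (\<Sum>i\<in>I. \<Sum>j\<in>I. b i j \<omega> * (u i \<omega> * u j \<omega> - cprod i j \<omega>))\<^sup>2)"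
    and "(\<integral>\<omega>. (\<Sum>i\<in>I. \<Sum>j\<in>I. b i j \<omega> * (u i \<omega> * u j \<omega> - cprod i j \<omega>))\<^sup>2 \<partial>M)
      \<le> 2 * real c ^ 2 * kap * (\<integral>\<omega>. (\<Sum>i\<in>I. \<Sum>j\<in>I. (b i j \<omega>)\<^sup>2) \<partial>M)"
proof -
  define \<xi> where "\<xi> = (\<lambda>(i, j). xi (b i j) i j)"
  define R where "R = (\<lambda>(i, j) (p, q). {cl i, cl j} = {cl p, cl q})"
  have N: "card {z \<in> I \<times> I. R y z} \<le> 2 * c ^ 2" if y0: "y \<in> I \<times> I" for y
  proof -
    obtain i j where y: "y = (i, j)" "i \<in> I" "j \<in> I" using y0 by (cases y) auto
    let ?P = "\<lambda>i. {j\<in>I. cl j = cl i}"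
    have "{z \<in> I \<times> I. R y z} \<subseteq> ?P i \<times> ?P j \<union> ?P j \<times> ?P i"
      by (auto simp: R_def y doubleton_eq_iff)
    then have "card {z \<in> I \<times> I. R y z} \<le> card (?P i \<times> ?P j \<union> ?P j \<times> ?P i)"
      using fin_I by (intro card_mono) auto
    also have "\<dots> \<le> card (?P i) * card (?P j) + card (?P j) * card (?P i)"
      using card_Un_le[of "?P i \<times> ?P j" "?P j \<times> ?P i"] by (simp only: card_cartesian_product)
    also have "\<dots> \<le> c * c + c * c"
      using c y by (intro add_mono mult_mono) auto
    finally show ?thesis by (simp add: power2_eq_square)
  qed
  have eq: "(\<Sum>i\<in>I. \<Sum>j\<in>I. b i j \<omega> * (u i \<omega> * u j \<omega> - cprod i j \<omega>)) = (\<Sum>y\<in>I \<times> I. \<xi> y \<omega>)" for \<omega>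
    by (simp add: sum.cartesian_product \<xi>_def xi_def split_def)
  note * = integral_square_sum_le[of "I \<times> I" \<xi> M R "2 * c ^ 2"]
  have m: "\<And>y. y \<in> I \<times> I \<Longrightarrow> \<xi> y \<in> borel_measurable M"
    and s: "\<And>y. y \<in> I \<times> I \<Longrightarrow> integrable M (\<lambda>\<omega>. (\<xi> y \<omega>)\<^sup>2)"
    using b by (auto simp: \<xi>_def intro: xi_meas xi_square)
  have R: "\<And>y z. R y z \<Longrightarrow> R z y" by (auto simp: R_def)
  have o: "\<And>y z. y \<in> I \<times> I \<Longrightarrow> z \<in> I \<times> I \<Longrightarrow> \<not> R y z \<Longrightarrow> (\<integral>\<omega>. \<xi> y \<omega> * \<xi> z \<omega> \<partial>M) = 0"
    using b by (auto simp: \<xi>_def R_def intro!: xi_orth)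
  show "integrable M (\<lambda>\<omega>. (\<Sum>i\<in>I. \<Sum>j\<in>I. b i j \<omega> * (u i \<omega> * u j \<omega> - cprod i j \<omega>))\<^sup>2)"
    unfolding eq by (rule *(1)) (use fin_I m s R N o in auto)
  have "(\<integral>\<omega>. (\<Sum>y\<in>I \<times> I. \<xi> y \<omega>)\<^sup>2 \<partial>M) \<le> real (2 * c ^ 2) * (\<Sum>y\<in>I \<times> I. \<integral>\<omega>. (\<xi> y \<omega>)\<^sup>2 \<partial>M)"
    by (rule *(2)) (use fin_I m s R N o in auto)
  also have "\<dots> \<le> real (2 * c ^ 2) * (\<Sum>y\<in>I \<times> I. kap * (\<integral>\<omega>. (b (fst y) (snd y) \<omega>)\<^sup>2 \<partial>M))"
    using b by (intro mult_left_mono sum_mono) (auto simp: \<xi>_def intro!: xi_square)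
  also have "\<dots> = real (2 * c ^ 2) * kap * (\<Sum>y\<in>I \<times> I. \<integral>\<omega>. (b (fst y) (snd y) \<omega>)\<^sup>2 \<partial>M)"
    by (simp add: sum_distrib_left mult.assoc)
  also have "(\<Sum>y\<in>I \<times> I. \<integral>\<omega>. (b (fst y) (snd y) \<omega>)\<^sup>2 \<partial>M) = (\<integral>\<omega>. (\<Sum>i\<in>I. \<Sum>j\<in>I. (b i j \<omega>)\<^sup>2) \<partial>M)"
    using b by (subst sum.cartesian_product, subst Bochner_Integration.integral_sum)
      (auto intro!: weight_integrable_square simp: split_def)
  finally show "(\<integral>\<omega>. (\<Sum>i\<in>I. \<Sum>j\<in>I. b i j \<omega> * (u i \<omega> * u j \<omega> - cprod i j \<omega>))\<^sup>2 \<partial>M)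
      \<le> 2 * real c ^ 2 * kap * (\<integral>\<omega>. (\<Sum>i\<in>I. \<Sum>j\<in>I. (b i j \<omega>)\<^sup>2) \<partial>M)"
    unfolding eq by simp
qed

text \<open>Single errors are related only within one cluster, so the count is \<open>c\<close>;
  they are centred already because their conditional means vanish.\<close>

lemma linear_form_variance:
  assumes b: "\<And>i. i \<in> I \<Longrightarrow> weight (b i)"
    and c: "\<And>i. i \<in> I \<Longrightarrow> card {j\<in>I. cl j = cl i} \<le> c"
  shows "integrable M (\<lambda>\<omega>. (\<Sum>i\<in>I. b i \<omega> * u i \<omega>)\<^sup>2)"
    and "(\<integral>\<omega>. (\<Sum>i\<in>I. b i \<omega> * u i \<omega>)\<^sup>2 \<partial>M) \<le> real c * (1 + C) * (\<integral>\<omega>. (\<Sum>i\<in>I. (b i \<omega>)\<^sup>2) \<partial>M)"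
proof -
  define \<xi> where "\<xi> i = (\<lambda>\<omega>. b i \<omega> * u i \<omega>)" for i
  define R where "R = (\<lambda>i j. cl j = cl i)"
  note * = integral_square_sum_le[of "I" \<xi> M R c]
  have m: "\<And>i. i \<in> I \<Longrightarrow> \<xi> i \<in> borel_measurable M"
    using b weight_M u_meas unfolding \<xi>_def by auto
  have s: "\<And>i. i \<in> I \<Longrightarrow> integrable M (\<lambda>\<omega>. (\<xi> i \<omega>)\<^sup>2)"
    using b by (auto simp: \<xi>_def intro: weighted_second_moment)
  have R: "\<And>y z. R y z \<Longrightarrow> R z y" by (auto simp: R_def)
  have N: "\<And>i. i \<in> I \<Longrightarrow> card {j\<in>I. R i j} \<le> c" using c by (auto simp: R_def)
  have o: "(\<integral>\<omega>. \<xi> i \<omega> * \<xi> j \<omega> \<partial>M) = 0" if ij: "i \<in> I" "j \<in> I" "\<not> R i j" for i j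
  proof -
    have [measurable]: "b i \<in> borel_measurable (Fo (cl i))" "b j \<in> borel_measurable (Fo (cl i))"
      "u j \<in> borel_measurable (Fo (cl i))"
      using F_Fo[OF ij(1) weight_F[OF b[OF ij(1)]]] F_Fo[OF ij(1) weight_F[OF b[OF ij(2)]]]
        u_Fo[OF ij(1,2)] ij(3) by (auto simp: R_def)
    have "(\<integral>\<omega>. (b i \<omega> * \<xi> j \<omega>) * u i \<omega> \<partial>M) = 0"
    proof (rule orth1[OF ij(1)])
      show "integrable M (\<lambda>\<omega>. b i \<omega> * \<xi> j \<omega> * u i \<omega>)"
        using integrable_mult_of_squares[OF s[OF ij(1)] s[OF ij(2)] m[OF ij(1)] m[OF ij(2)]]
        by (simp add: \<xi>_def ac_simps)
    qed (simp add: \<xi>_def)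
    then show ?thesis by (simp add: \<xi>_def ac_simps)
  qed
  show "integrable M (\<lambda>\<omega>. (\<Sum>i\<in>I. b i \<omega> * u i \<omega>)\<^sup>2)"
    using *(1)[OF fin_I m s R N o] by (simp add: \<xi>_def)
  have "(\<integral>\<omega>. (\<Sum>i\<in>I. \<xi> i \<omega>)\<^sup>2 \<partial>M) \<le> real c * (\<Sum>i\<in>I. \<integral>\<omega>. (\<xi> i \<omega>)\<^sup>2 \<partial>M)"
    by (rule *(2)) (use fin_I m s R N o in auto)
  also have "\<dots> \<le> real c * (\<Sum>i\<in>I. (1 + C) * (\<integral>\<omega>. (b i \<omega>)\<^sup>2 \<partial>M))"
    using b by (intro mult_left_mono sum_mono) (auto simp: \<xi>_def intro!: weighted_second_moment)
  also have "\<dots> = real c * (1 + C) * (\<integral>\<omega>. (\<Sum>i\<in>I. (b i \<omega>)\<^sup>2) \<partial>M)"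
    using b by (subst Bochner_Integration.integral_sum)
      (auto intro!: weight_integrable_square simp: sum_distrib_left mult.assoc)
  finally show "(\<integral>\<omega>. (\<Sum>i\<in>I. b i \<omega> * u i \<omega>)\<^sup>2 \<partial>M) \<le> real c * (1 + C) * (\<integral>\<omega>. (\<Sum>i\<in>I. (b i \<omega>)\<^sup>2) \<partial>M)"
    by (simp add: \<xi>_def)
qed

end

section \<open>Conditional independence of the clusters given the regressors\<close>

text \<open>Both sides integrate \<phi> against measures with densities \<alpha> and \<beta>, and
  these measures coincide on \<open>N\<close>. All sets of \<open>N\<close> are tested, so infinite
  integrals are allowed.\<close>

lemma nn_integral_mult_eq_of_sets:
  assumes sub: "subalgebra M N"
    and [measurable]: "\<alpha> \<in> borel_measurable M" "\<beta> \<in> borel_measurable M"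
    and eq: "\<And>c. c \<in> sets N \<Longrightarrow> (\<integral>\<^sup>+\<omega>. indicator c \<omega> * \<alpha> \<omega> \<partial>M) = (\<integral>\<^sup>+\<omega>. indicator c \<omega> * \<beta> \<omega> \<partial>M)"
    and \<phi>: "\<phi> \<in> borel_measurable N"
  shows "(\<integral>\<^sup>+\<omega>. \<phi> \<omega> * \<alpha> \<omega> \<partial>M) = (\<integral>\<^sup>+\<omega>. \<phi> \<omega> * \<beta> \<omega> \<partial>M)"
proof -
  have sub': "subalgebra (density M g) N" for g :: "'a \<Rightarrow> ennreal"
    using sub by (simp add: subalgebra_def)
  have [measurable]: "\<phi> \<in> borel_measurable M"
    using sub \<phi> measurable_from_subalg by blast
  have in_M: "c \<in> sets M" if "c \<in> sets N" for c
    using sub that by (auto simp: subalgebra_def)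
  have "restr_to_subalg (density M \<alpha>) N = restr_to_subalg (density M \<beta>) N"
  proof (rule measure_eqI)
    show "sets (restr_to_subalg (density M \<alpha>) N) = sets (restr_to_subalg (density M \<beta>) N)"
      by (simp add: sets_restr_to_subalg[OF sub'])
    fix c assume "c \<in> sets (restr_to_subalg (density M \<alpha>) N)"
    then have c: "c \<in> sets N" by (simp add: sets_restr_to_subalg[OF sub'])
    show "emeasure (restr_to_subalg (density M \<alpha>) N) c = emeasure (restr_to_subalg (density M \<beta>) N) c"
      using eq[OF c] in_M[OF c]
      by (simp add: emeasure_restr_to_subalg[OF sub' c] emeasure_density mult.commute)
  qed
  then have "(\<integral>\<^sup>+\<omega>. \<phi> \<omega> \<partial>density M \<alpha>) = (\<integral>\<^sup>+\<omega>. \<phi> \<omega> \<partial>density M \<beta>)"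
    using nn_integral_subalgebra2[OF sub' \<phi>, of \<alpha>] nn_integral_subalgebra2[OF sub' \<phi>, of \<beta>] by simp
  then show ?thesis by (simp add: nn_integral_density mult.commute)
qed

text \<open>Uniqueness of measures on an intersection-stable generator. The finite mass of \<alpha>
  and membership of the whole space in \<open>E\<close> supply the exhausting sequence.\<close>

lemma nn_integral_indicator_eq_of_generator:
  assumes sub: "subalgebra M N"
    and gen: "sets N = sigma_sets (space M) E" and Int: "Int_stable E" and space: "space M \<in> E"
    and [measurable]: "\<alpha> \<in> borel_measurable M" "\<beta> \<in> borel_measurable M"
    and fin: "(\<integral>\<^sup>+\<omega>. \<alpha> \<omega> \<partial>M) \<noteq> \<infinity>"
    and eq: "\<And>c. c \<in> E \<Longrightarrow> (\<integral>\<^sup>+\<omega>. indicator c \<omega> * \<alpha> \<omega> \<partial>M) = (\<integral>\<^sup>+\<omega>. indicator c \<omega> * \<beta> \<omega> \<partial>M)"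
    and c: "c \<in> sets N"
  shows "(\<integral>\<^sup>+\<omega>. indicator c \<omega> * \<alpha> \<omega> \<partial>M) = (\<integral>\<^sup>+\<omega>. indicator c \<omega> * \<beta> \<omega> \<partial>M)"
proof -
  have sub': "subalgebra (density M g) N" for g :: "'a \<Rightarrow> ennreal"
    using sub by (simp add: subalgebra_def)
  have in_M: "c \<in> sets M" if "c \<in> sets N" for c
    using sub that by (auto simp: subalgebra_def)
  have EN: "c \<in> sets N" if "c \<in> E" for c
    using that gen by auto
  have em: "emeasure (restr_to_subalg (density M g) N) c = (\<integral>\<^sup>+\<omega>. indicator c \<omega> * g \<omega> \<partial>M)"
    if "c \<in> sets N" "g \<in> borel_measurable M" for c g
    using that in_M by (simp add: emeasure_restr_to_subalg[OF sub'] emeasure_density mult.commute)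
  have "restr_to_subalg (density M \<alpha>) N = restr_to_subalg (density M \<beta>) N"
  proof (rule measure_eqI_generator_eq[OF Int])
    show "E \<subseteq> Pow (space M)" using EN in_M sets.sets_into_space by fast
    show "sets (restr_to_subalg (density M \<alpha>) N) = sigma_sets (space M) E"
      "sets (restr_to_subalg (density M \<beta>) N) = sigma_sets (space M) E"
      by (simp_all add: sets_restr_to_subalg[OF sub'] gen)
    show "range (\<lambda>_::nat. space M) \<subseteq> E" "(\<Union>i::nat. space M) = space M" using space by auto
    show "emeasure (restr_to_subalg (density M \<alpha>) N) (space M) \<noteq> \<infinity>"
      using fin nn_integral_cong[of M "\<lambda>\<omega>. indicator (space M) \<omega> * \<alpha> \<omega>" \<alpha>]
      by (simp add: em[OF EN[OF space]])
  qed (use em EN eq in simp)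
  then show ?thesis using em[OF c, of \<alpha>] em[OF c, of \<beta>] by simp
qed

lemma Int_stable_Int:
  assumes "Int_stable A" "Int_stable B"
  shows "Int_stable {a \<inter> b | a b. a \<in> A \<and> b \<in> B}"
proof (rule Int_stableI)
  fix x y assume "x \<in> {a \<inter> b | a b. a \<in> A \<and> b \<in> B}" "y \<in> {a \<inter> b | a b. a \<in> A \<and> b \<in> B}"
  then obtain a b a' b' where *: "x = a \<inter> b" "y = a' \<inter> b'" "a \<in> A" "b \<in> B" "a' \<in> A" "b' \<in> B"
    by blast
  show "x \<inter> y \<in> {a \<inter> b | a b. a \<in> A \<and> b \<in> B}"
  proof (intro CollectI exI conjI)
    show "x \<inter> y = (a \<inter> a') \<inter> (b \<inter> b')" using * by blast
    show "a \<inter> a' \<in> A" by (rule Int_stableD[OF assms(1) *(3,5)])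
    show "b \<inter> b' \<in> B" by (rule Int_stableD[OF assms(2) *(4,6)])
  qed
qed

context prob_space
begin

text \<open>A generator argument needs finite integrals, so it is applied to indicators of \<open>HG\<close>-sets only.
  Moving the conditional expectation from the indicator of \<open>a\<close> to that of \<open>D\<close> then gives the identity
  for every nonnegative \<open>f\<close>, integrable or not.\<close>

lemma nn_cond_exp_of_cond_indep:
  fixes f :: "'a \<Rightarrow> ennreal"
  assumes HG: "subalgebra M HG" and L: "subalgebra HG L" and H: "subalgebra L H"
    and Fo: "subalgebra M Fo" and F: "subalgebra Fo F" "subalgebra F L"
    and HG_gen: "sets HG = sigma_sets (space M) {h \<inter> a | h a. h \<in> sets H \<and> a \<in> \<A>}"
    and Fo_gen: "sets Fo = sigma_sets (space M) {l \<inter> r | l r. l \<in> sets L \<and> r \<in> \<R>}"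
    and A: "Int_stable \<A>" "\<A> \<subseteq> sets M" "space M \<in> \<A>"
    and R: "Int_stable \<R>" "\<R> \<subseteq> sets M" "space M \<in> \<R>"
    and indep: "\<And>a r. a \<in> \<A> \<Longrightarrow> r \<in> \<R> \<Longrightarrow> AE \<omega> in M. real_cond_exp M H (indicator (a \<inter> r)) \<omega>
       = real_cond_exp M H (indicator a) \<omega> * real_cond_exp M H (indicator r) \<omega>"
    and f: "f \<in> borel_measurable HG"
  shows "AE \<omega> in M. nn_cond_exp M Fo f \<omega> = nn_cond_exp M F f \<omega>"
proof -
  have L': "subalgebra M L" and H': "subalgebra M H" and F': "subalgebra M F"
    using HG L H Fo F by (auto simp: subalgebra_def)
  interpret H: sigma_finite_subalgebra M H by (rule subalgebra_sigma_finite[OF H'])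
  interpret L: sigma_finite_subalgebra M L by (rule subalgebra_sigma_finite[OF L'])
  interpret F: sigma_finite_subalgebra M F by (rule subalgebra_sigma_finite[OF F'])
  interpret Fo: sigma_finite_subalgebra M Fo by (rule subalgebra_sigma_finite[OF Fo])
  have sp [simp]: "space H = space M" "space L = space M" "space HG = space M" "space F = space M" "space Fo = space M"
    using H' L' HG F' Fo by (auto simp: subalgebra_def)
  have HM: "c \<in> sets M" if "c \<in> sets H" for c using that H' by (auto simp: subalgebra_def)
  have LM: "c \<in> sets M" if "c \<in> sets L" for c using that L' by (auto simp: subalgebra_def)
  have AM: "c \<in> sets M" if "c \<in> \<A>" for c using that A by auto
  have RM: "c \<in> sets M" if "c \<in> \<R>" for c using that R by auto
  have FoM: "c \<in> sets M" if "c \<in> sets Fo" for c using that Fo by (auto simp: subalgebra_def)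
  have fin_ind: "(\<integral>\<^sup>+\<omega>. indicator a \<omega> \<partial>M) \<noteq> \<infinity>" if "a \<in> sets M" for a
    using that emeasure_finite by simp
  have int_ind [simp]: "integrable M (indicator a :: 'a \<Rightarrow> real)" if "a \<in> sets M" for a
    using that by (simp add: integrable_indicator_iff less_top[symmetric])
  define p where "p r = (\<lambda>\<omega>. ennreal (real_cond_exp M H (indicator r) \<omega>))" for r
  have p_H [measurable]: "p r \<in> borel_measurable H" for r by (simp add: p_def)
  have p_L [measurable]: "p r \<in> borel_measurable L" for r
    using measurable_from_subalg[OF H p_H] .
  have p_M [measurable]: "p r \<in> borel_measurable M" for r
    using measurable_from_subalg[OF H' p_H] .
  \<comment> \<open>Conditional independence on the generators of \<open>HG\<close>: the conditional
    probability of \<open>a\<close> is turned back into its indicator, while \<open>r\<close> keeps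
    its conditional probability given \<open>H\<close>.\<close>
  have step0: "(\<integral>\<^sup>+\<omega>. indicator (h \<inter> a) \<omega> * indicator r \<omega> \<partial>M) = (\<integral>\<^sup>+\<omega>. indicator (h \<inter> a) \<omega> * p r \<omega> \<partial>M)"
    if h: "h \<in> sets H" and a: "a \<in> \<A>" and r: "r \<in> \<R>" for h a r
  proof -
    note [measurable] = h HM[OF h] AM[OF a] RM[OF r]
    let ?E = "\<lambda>b. real_cond_exp M H (indicator b)"
    have pos: "AE \<omega> in M. ?E r \<omega> \<ge> 0" by (rule H.real_cond_exp_pos) auto
    have ih: "integrable M (\<lambda>\<omega>. indicator h \<omega> * indicator b \<omega> :: real)" if "b \<in> sets M" for b
      using int_ind[of "h \<inter> b"] that by (simp add: indicator_inter_arith[symmetric])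
    have e1: "(\<integral>\<omega>. indicator h \<omega> * indicator (a \<inter> r) \<omega> \<partial>M) = (\<integral>\<omega>. indicator h \<omega> * ?E (a \<inter> r) \<omega> \<partial>M)"
      by (rule H.real_cond_exp_intg(2)[symmetric]) (auto intro: ih)
    have i2: "integrable M (\<lambda>\<omega>. (indicator h \<omega> * ?E r \<omega>) * indicator a \<omega>)"
    proof (rule Bochner_Integration.integrable_bound[of M "?E r"])
      show "integrable M (?E r)" by (rule H.real_cond_exp_int(1)) simp
      show "AE \<omega> in M. norm (indicator h \<omega> * ?E r \<omega> * indicator a \<omega>) \<le> norm (?E r \<omega>)"
        by (auto simp: indicator_def)
    qed measurable
    have e2: "(\<integral>\<omega>. indicator h \<omega> * ?E (a \<inter> r) \<omega> \<partial>M) = (\<integral>\<omega>. (indicator h \<omega> * ?E r \<omega>) * ?E a \<omega> \<partial>M)"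
      by (rule integral_cong_AE) (use indep[OF a r] in \<open>auto elim!: eventually_mono\<close>)
    have e3: "\<dots> = (\<integral>\<omega>. (indicator h \<omega> * ?E r \<omega>) * indicator a \<omega> \<partial>M)"
      by (rule H.real_cond_exp_intg(2)[OF i2]) auto
    have "(\<integral>\<^sup>+\<omega>. indicator (h \<inter> a) \<omega> * indicator r \<omega> \<partial>M)
        = (\<integral>\<^sup>+\<omega>. ennreal (indicator h \<omega> * indicator (a \<inter> r) \<omega>) \<partial>M)"
      by (intro nn_integral_cong) (auto simp: indicator_def)
    also have "\<dots> = ennreal (\<integral>\<omega>. indicator h \<omega> * indicator (a \<inter> r) \<omega> \<partial>M)"
      by (rule nn_integral_eq_integral) (auto intro: ih)
    also have "\<dots> = ennreal (\<integral>\<omega>. (indicator h \<omega> * ?E r \<omega>) * indicator a \<omega> \<partial>M)"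
      using e1 e2 e3 by simp
    also have "\<dots> = (\<integral>\<^sup>+\<omega>. ennreal ((indicator h \<omega> * ?E r \<omega>) * indicator a \<omega>) \<partial>M)"
      by (rule nn_integral_eq_integral[symmetric, OF i2]) (use pos in \<open>auto elim!: eventually_mono simp: indicator_def\<close>)
    also have "\<dots> = (\<integral>\<^sup>+\<omega>. indicator (h \<inter> a) \<omega> * p r \<omega> \<partial>M)"
      by (intro nn_integral_cong) (auto simp: indicator_def p_def)
    finally show ?thesis .
  qed
  \<comment> \<open>Extended from the generators, this says that conditioning \<open>r\<close> on
    \<open>HG\<close> gives the same as conditioning it on \<open>H\<close>.\<close>
  have step1: "(\<integral>\<^sup>+\<omega>. \<phi> \<omega> * indicator r \<omega> \<partial>M) = (\<integral>\<^sup>+\<omega>. \<phi> \<omega> * p r \<omega> \<partial>M)"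
    if r: "r \<in> \<R>" and \<phi>: "\<phi> \<in> borel_measurable HG" for r and \<phi> :: "'a \<Rightarrow> ennreal"
  proof (rule nn_integral_mult_eq_of_sets[OF HG _ p_M _ \<phi>])
    show "(indicator r::'a \<Rightarrow> ennreal) \<in> borel_measurable M" using RM[OF r] by simp
    fix c assume c: "c \<in> sets HG"
    show "(\<integral>\<^sup>+\<omega>. indicator c \<omega> * indicator r \<omega> \<partial>M) = (\<integral>\<^sup>+\<omega>. indicator c \<omega> * p r \<omega> \<partial>M)"
    proof (rule nn_integral_indicator_eq_of_generator[OF HG HG_gen _ _ _ p_M fin_ind[OF RM[OF r]] _ c])
      show "Int_stable {h \<inter> a | h a. h \<in> sets H \<and> a \<in> \<A>}"
        by (rule Int_stable_Int[OF sets.Int_stable A(1)])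
      show "space M \<in> {h \<inter> a | h a. h \<in> sets H \<and> a \<in> \<A>}"
        using sets.top[of H] A(3) by auto
    qed (use step0[OF _ _ r] RM[OF r] in auto)
  qed
  \<comment> \<open>The indicator of \<open>r\<close> is exchanged for \<open>p r\<close>, which is
    measurable for \<open>L\<close> because \<open>H\<close> is contained in \<open>L\<close>; then
    \<open>g\<close> can be replaced by its conditional expectation given \<open>L\<close>, and the
    indicator is restored.\<close>
  have step2: "(\<integral>\<^sup>+\<omega>. indicator (l \<inter> r) \<omega> * g \<omega> \<partial>M) = (\<integral>\<^sup>+\<omega>. indicator (l \<inter> r) \<omega> * nn_cond_exp M L g \<omega> \<partial>M)"
    if l: "l \<in> sets L" and r: "r \<in> \<R>" and g: "g \<in> borel_measurable HG" for l r and g :: "'a \<Rightarrow> ennreal"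
  proof -
    have [measurable]: "l \<in> sets HG" using l L by (auto simp: subalgebra_def)
    note [measurable] = l LM[OF l] RM[OF r] g measurable_from_subalg[OF HG g]
    have [measurable]: "nn_cond_exp M L g \<in> borel_measurable HG"
      by (rule measurable_from_subalg[OF L]) measurable
    have "(\<integral>\<^sup>+\<omega>. indicator (l \<inter> r) \<omega> * g \<omega> \<partial>M) = (\<integral>\<^sup>+\<omega>. (indicator l \<omega> * g \<omega>) * indicator r \<omega> \<partial>M)"
      by (intro nn_integral_cong) (auto simp: indicator_def)
    also have "\<dots> = (\<integral>\<^sup>+\<omega>. (indicator l \<omega> * g \<omega>) * p r \<omega> \<partial>M)"
      by (rule step1[OF r]) measurable
    also have "\<dots> = (\<integral>\<^sup>+\<omega>. (indicator l \<omega> * p r \<omega>) * g \<omega> \<partial>M)"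
      by (simp add: ac_simps)
    also have "\<dots> = (\<integral>\<^sup>+\<omega>. (indicator l \<omega> * p r \<omega>) * nn_cond_exp M L g \<omega> \<partial>M)"
      by (rule L.nn_cond_exp_intg[symmetric]) measurable
    also have "\<dots> = (\<integral>\<^sup>+\<omega>. (indicator l \<omega> * nn_cond_exp M L g \<omega>) * p r \<omega> \<partial>M)"
      by (simp add: ac_simps)
    also have "\<dots> = (\<integral>\<^sup>+\<omega>. (indicator l \<omega> * nn_cond_exp M L g \<omega>) * indicator r \<omega> \<partial>M)"
      by (rule step1[OF r, symmetric]) measurable
    also have "\<dots> = (\<integral>\<^sup>+\<omega>. indicator (l \<inter> r) \<omega> * nn_cond_exp M L g \<omega> \<partial>M)"
      by (intro nn_integral_cong) (auto simp: indicator_def)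
    finally show ?thesis .
  qed
  have step3: "(\<integral>\<^sup>+\<omega>. indicator D \<omega> * indicator a \<omega> \<partial>M) = (\<integral>\<^sup>+\<omega>. indicator D \<omega> * nn_cond_exp M L (indicator a) \<omega> \<partial>M)"
    if D: "D \<in> sets Fo" and a: "a \<in> sets HG" for D a
  proof -
    have aM: "a \<in> sets M" using a HG by (auto simp: subalgebra_def)
    show ?thesis
    proof (rule nn_integral_indicator_eq_of_generator[OF Fo Fo_gen _ _ _ _ fin_ind[OF aM] _ D])
      show "Int_stable {l \<inter> r | l r. l \<in> sets L \<and> r \<in> \<R>}"
        by (rule Int_stable_Int[OF sets.Int_stable R(1)])
      show "space M \<in> {l \<inter> r | l r. l \<in> sets L \<and> r \<in> \<R>}"
        using sets.top[of L] R(3) by auto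
      fix c assume "c \<in> {l \<inter> r | l r. l \<in> sets L \<and> r \<in> \<R>}"
      then obtain l r where c: "c = l \<inter> r" "l \<in> sets L" "r \<in> \<R>" by blast
      show "(\<integral>\<^sup>+\<omega>. indicator c \<omega> * indicator a \<omega> \<partial>M)
          = (\<integral>\<^sup>+\<omega>. indicator c \<omega> * nn_cond_exp M L (indicator a) \<omega> \<partial>M)"
        unfolding c(1) by (rule step2[OF c(2,3)]) (use a in simp)
    qed (use aM in simp_all)
  qed
  have step4: "(\<integral>\<^sup>+\<omega>. g \<omega> * indicator D \<omega> \<partial>M) = (\<integral>\<^sup>+\<omega>. nn_cond_exp M L g \<omega> * indicator D \<omega> \<partial>M)"
    if D: "D \<in> sets Fo" and g: "g \<in> borel_measurable HG" for D and g :: "'a \<Rightarrow> ennreal"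
  proof -
    note [measurable] = FoM[OF D] measurable_from_subalg[OF HG g]
    have "(\<integral>\<^sup>+\<omega>. g \<omega> * indicator D \<omega> \<partial>M) = (\<integral>\<^sup>+\<omega>. g \<omega> * nn_cond_exp M L (indicator D) \<omega> \<partial>M)"
    proof (rule nn_integral_mult_eq_of_sets[OF HG _ _ _ g])
      fix a assume a: "a \<in> sets HG"
      have [measurable]: "a \<in> sets M" using a HG by (auto simp: subalgebra_def)
      have "(\<integral>\<^sup>+\<omega>. indicator a \<omega> * indicator D \<omega> \<partial>M) = (\<integral>\<^sup>+\<omega>. nn_cond_exp M L (indicator a) \<omega> * indicator D \<omega> \<partial>M)"
        using step3[OF D a] by (simp add: mult.commute)
      also have "\<dots> = (\<integral>\<^sup>+\<omega>. nn_cond_exp M L (indicator a) \<omega> * nn_cond_exp M L (indicator D) \<omega> \<partial>M)"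
        by (rule L.nn_cond_exp_intg[symmetric]) measurable
      also have "\<dots> = (\<integral>\<^sup>+\<omega>. nn_cond_exp M L (indicator D) \<omega> * nn_cond_exp M L (indicator a) \<omega> \<partial>M)"
        by (simp add: mult.commute)
      also have "\<dots> = (\<integral>\<^sup>+\<omega>. nn_cond_exp M L (indicator D) \<omega> * indicator a \<omega> \<partial>M)"
        by (rule L.nn_cond_exp_intg) measurable
      finally show "(\<integral>\<^sup>+\<omega>. indicator a \<omega> * indicator D \<omega> \<partial>M)
          = (\<integral>\<^sup>+\<omega>. indicator a \<omega> * nn_cond_exp M L (indicator D) \<omega> \<partial>M)"
        by (simp add: mult.commute)
    qed measurable
    also have "\<dots> = (\<integral>\<^sup>+\<omega>. nn_cond_exp M L (indicator D) \<omega> * g \<omega> \<partial>M)"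
      by (simp add: mult.commute)
    also have "\<dots> = (\<integral>\<^sup>+\<omega>. nn_cond_exp M L (indicator D) \<omega> * nn_cond_exp M L g \<omega> \<partial>M)"
      by (rule L.nn_cond_exp_intg[symmetric]) measurable
    also have "\<dots> = (\<integral>\<^sup>+\<omega>. nn_cond_exp M L g \<omega> * nn_cond_exp M L (indicator D) \<omega> \<partial>M)"
      by (simp add: mult.commute)
    also have "\<dots> = (\<integral>\<^sup>+\<omega>. nn_cond_exp M L g \<omega> * indicator D \<omega> \<partial>M)"
      by (rule L.nn_cond_exp_intg) measurable
    finally show ?thesis .
  qed
  have fM: "f \<in> borel_measurable M" by (rule measurable_from_subalg[OF HG f])
  have LF: "nn_cond_exp M L f \<in> borel_measurable F"
    by (rule measurable_from_subalg[OF F(2)]) measurable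
  \<comment> \<open>The conditional expectation given \<open>L\<close> is measurable for
    \<open>F\<close> and \<open>Fo\<close> and has the right integrals over all sets of
    \<open>Fo\<close>, hence also over those of \<open>F\<close>; so it is a version of both
    conditional expectations.\<close>
  have "AE \<omega> in M. nn_cond_exp M L f \<omega> = nn_cond_exp M Fo f \<omega>"
    by (rule Fo.nn_cond_exp_charact[OF step4[OF _ f] fM measurable_from_subalg[OF F(1) LF]])
  moreover have "AE \<omega> in M. nn_cond_exp M L f \<omega> = nn_cond_exp M F f \<omega>"
    by (rule F.nn_cond_exp_charact[OF step4[OF _ f] fM LF]) (use F(1) in \<open>auto simp: subalgebra_def\<close>)
  ultimately show ?thesis by eventually_elim simp
qed

end

section \<open>The sigma-algebras of the covariates and of all regressors\<close>

lemma space_sigma_W [simp]: "space (sigma_W M n K w) = space M"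
  by (simp add: sigma_W_def)

lemma space_sigma_XW [simp]: "space (sigma_XW M n K x w) = space M"
  by (simp add: sigma_XW_def)

lemma sigma_W_component:
  assumes "i \<in> {1..n}" "k < K"
  shows "(\<lambda>\<omega>. w i \<omega> k) \<in> borel_measurable (sigma_W M n K w)"
proof -
  have "(\<lambda>\<omega>. \<lambda>(i, k) \<in> {1..n} \<times> {..<K}. w i \<omega> k)
      \<in> measurable (sigma_W M n K w) (PiM ({1..n} \<times> {..<K}) (\<lambda>_. borel))"
    unfolding sigma_W_def by (rule measurable_vimage_algebra1) (auto simp: space_PiM)
  from measurable_compose[OF this measurable_component_singleton[of "(i, k)"]] show ?thesis
    using assms by simp
qed

lemma sigma_XW_component:
  shows "i \<in> {1..n} \<Longrightarrow> k < K \<Longrightarrow> (\<lambda>\<omega>. w i \<omega> k) \<in> borel_measurable (sigma_XW M n K x w)"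
    and "i \<in> {1..n} \<Longrightarrow> x i \<in> borel_measurable (sigma_XW M n K x w)"
proof -
  have *: "(\<lambda>\<omega>. (\<lambda>i\<in>{1..n}. x i \<omega>, \<lambda>(i, k)\<in>{1..n} \<times> {..<K}. w i \<omega> k))
      \<in> measurable (sigma_XW M n K x w)
        (PiM {1..n} (\<lambda>_. borel) \<Otimes>\<^sub>M PiM ({1..n} \<times> {..<K}) (\<lambda>_. borel))"
    unfolding sigma_XW_def by (rule measurable_vimage_algebra1) (auto simp: space_PiM space_pair_measure)
  show "(\<lambda>\<omega>. w i \<omega> k) \<in> borel_measurable (sigma_XW M n K x w)" if "i \<in> {1..n}" "k < K"
    using measurable_compose[OF measurable_compose[OF * measurable_snd] measurable_component_singleton[of "(i, k)"]] that
    by simp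
  show "x i \<in> borel_measurable (sigma_XW M n K x w)" if "i \<in> {1..n}"
    using measurable_compose[OF measurable_compose[OF * measurable_fst] measurable_component_singleton[of i]] that
    by simp
qed

lemma subalgebra_sigma_W:
  assumes "space N = space M" "\<And>i k. i \<in> {1..n} \<Longrightarrow> k < K \<Longrightarrow> (\<lambda>\<omega>. w i \<omega> k) \<in> borel_measurable N"
  shows "subalgebra N (sigma_W M n K w)"
  unfolding subalgebra_def
proof
  show "sets (sigma_W M n K w) \<subseteq> sets N"
    unfolding sigma_W_def
    by (rule sets_image_in_sets[OF assms(1)], rule measurable_restrict) (use assms(2) in auto)
qed (simp add: assms(1))

lemma subalgebra_sigma_XW:
  assumes "space N = space M" "\<And>i k. i \<in> {1..n} \<Longrightarrow> k < K \<Longrightarrow> (\<lambda>\<omega>. w i \<omega> k) \<in> borel_measurable N"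
    and "\<And>i. i \<in> {1..n} \<Longrightarrow> x i \<in> borel_measurable N"
  shows "subalgebra N (sigma_XW M n K x w)"
  unfolding subalgebra_def
proof
  show "sets (sigma_XW M n K x w) \<subseteq> sets N"
    unfolding sigma_XW_def
    by (rule sets_image_in_sets[OF assms(1)], rule measurable_Pair; rule measurable_restrict) (use assms(2,3) in auto)
qed (simp add: assms(1))

text \<open>\<open>real_cond_exp\<close> is by definition the difference of two
  \<open>nn_cond_exp\<close>, so the equality passes on pointwise, for non-integrable functions as
  well.\<close>

lemma nn_cond_exp_eq_imp_real_cond_exp_eq:
  fixes f :: "'a \<Rightarrow> real"
  assumes "AE \<omega> in M. nn_cond_exp M N (\<lambda>\<omega>. ennreal (f \<omega>)) \<omega> = nn_cond_exp M F (\<lambda>\<omega>. ennreal (f \<omega>)) \<omega>"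
    and "AE \<omega> in M. nn_cond_exp M N (\<lambda>\<omega>. ennreal (- f \<omega>)) \<omega> = nn_cond_exp M F (\<lambda>\<omega>. ennreal (- f \<omega>)) \<omega>"
  shows "AE \<omega> in M. real_cond_exp M N f \<omega> = real_cond_exp M F f \<omega>"
  using assms by eventually_elim (simp add: real_cond_exp_def)

text \<open>An instance of \<open>nn_cond_exp_of_cond_indep\<close>: \<open>H\<close> is generated
  by W, \<open>HG\<close> by W and the data of cluster \<open>g\<close>, \<open>F\<close> by (X, W),
  and \<open>Fo\<close> by the common part \<open>L\<close> of \<open>HG\<close> and
  \<open>F\<close> together with the data of the other clusters. The function \<open>f\<close> is
  arbitrary because products of errors may fail to be integrable.\<close>

lemma (in prob_space) leave_one_out_algebra:
  fixes x :: "nat \<Rightarrow> 'a \<Rightarrow> real^'d" and u :: "nat \<Rightarrow> 'a \<Rightarrow> real"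
    and G :: nat and T :: "nat \<Rightarrow> nat set"
  assumes x_meas: "\<And>i. i \<in> {1..n} \<Longrightarrow> x i \<in> borel_measurable M"
    and u_meas: "\<And>i. i \<in> {1..n} \<Longrightarrow> u i \<in> borel_measurable M"
    and w_meas: "\<And>i k. i \<in> {1..n} \<Longrightarrow> k < K \<Longrightarrow> (\<lambda>\<omega>. w i \<omega> k) \<in> borel_measurable M"
    and T_cover: "(\<Union>g\<in>{1..G}. T g) = {1..n}"
    and T_indep: "cond_indep_vars M (sigma_W M n K w)
        (\<lambda>g. PiM (T g) (\<lambda>_. borel :: (real \<times> (real^'d)) measure))
        (\<lambda>g \<omega>. \<lambda>i\<in>T g. (u i \<omega>, x i \<omega>)) {1..G}"
    and g: "g \<in> {1..G}"
  shows "\<exists>Fo. subalgebra M Fo \<and> subalgebra Fo (sigma_XW M n K x w)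
    \<and> (\<forall>h\<in>{1..G} - {g}. \<forall>i\<in>T h. u i \<in> borel_measurable Fo)
    \<and> (\<forall>f. f \<in> borel_measurable (PiM (T g) (\<lambda>_. borel)) \<longrightarrow>
        (AE \<omega> in M. real_cond_exp M Fo (\<lambda>\<omega>. f (\<lambda>i\<in>T g. u i \<omega>)) \<omega>
          = real_cond_exp M (sigma_XW M n K x w) (\<lambda>\<omega>. f (\<lambda>i\<in>T g. u i \<omega>)) \<omega>))"
proof -
  define H where "H = sigma_W M n K w"
  define F where "F = sigma_XW M n K x w"
  define N where "N h = PiM (T h) (\<lambda>_. borel :: (real \<times> (real^'d)) measure)" for h
  define Z where "Z h = (\<lambda>\<omega>. \<lambda>i\<in>T h. (u i \<omega>, x i \<omega>))" for h
  have T_sub: "i \<in> {1..n}" if "h \<in> {1..G}" "i \<in> T h" for h i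
    using UN_I[where B = T, OF that] by (simp only: T_cover)
  have Z_meas [measurable]: "Z h \<in> measurable M (N h)" if "h \<in> {1..G}" for h
    unfolding Z_def N_def
    by (rule measurable_restrict, rule borel_measurable_Pair)
       (rule u_meas[OF T_sub[OF that]] x_meas[OF T_sub[OF that]], assumption)+
  have Z_space: "Z h \<omega> \<in> space (N h)" for h \<omega>
    by (auto simp: Z_def N_def space_PiM)
  define \<A> where "\<A> = {Z g -` A \<inter> space M | A. A \<in> sets (N g)}"
  \<comment> \<open>Cylinder events in the data of all clusters other than \<open>g\<close>; they
    are intersection-stable because intersections are taken coordinate by coordinate.\<close>
  define rect where "rect A = {\<omega>\<in>space M. \<forall>h\<in>{1..G} - {g}. Z h \<omega> \<in> A h}" for A
  define \<R> where "\<R> = {rect A | A. \<forall>h\<in>{1..G}. A h \<in> sets (N h)}"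
  have H: "subalgebra M H" unfolding H_def by (rule subalgebra_sigma_W) (use w_meas in auto)
  have F: "subalgebra M F" unfolding F_def by (rule subalgebra_sigma_XW) (use w_meas x_meas in auto)
  have HF: "subalgebra F H" unfolding H_def F_def
    by (rule subalgebra_sigma_W[OF _ sigma_XW_component(1)[where w = w]]) simp_all
  have \<A>_M: "\<A> \<subseteq> sets M"
    unfolding \<A>_def using measurable_sets[OF Z_meas[OF g]] by blast
  have \<A>_space: "space M \<in> \<A>"
    unfolding \<A>_def using Z_space by (intro CollectI exI[of _ "space (N g)"]) auto
  have \<A>_Int: "Int_stable \<A>"
  proof (rule Int_stableI)
    fix a b assume "a \<in> \<A>" "b \<in> \<A>"
    then obtain A B where "a = Z g -` A \<inter> space M" "b = Z g -` B \<inter> space M" "A \<in> sets (N g)" "B \<in> sets (N g)"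
      by (auto simp: \<A>_def)
    then show "a \<inter> b \<in> \<A>" unfolding \<A>_def
      by (intro CollectI exI[of _ "A \<inter> B"]) auto
  qed
  have rect_M: "rect A \<in> sets M" if A: "\<forall>h\<in>{1..G}. A h \<in> sets (N h)" for A
  proof -
    have "{\<omega>\<in>space M. Z h \<omega> \<in> A h} \<in> sets M" if "h \<in> {1..G} - {g}" for h
      using measurable_sets[OF Z_meas[of h], of "A h"] A that by (simp add: vimage_def Int_def conj_commute)
    then show ?thesis unfolding rect_def by (intro sets.sets_Collect_finite_All) auto
  qed
  have \<R>_M: "\<R> \<subseteq> sets M" using rect_M by (auto simp: \<R>_def)
  have \<R>_space: "space M \<in> \<R>"
    unfolding \<R>_def using Z_space by (intro CollectI exI[of _ "\<lambda>h. space (N h)"]) (auto simp: rect_def)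
  have \<R>_Int: "Int_stable \<R>"
  proof (rule Int_stableI)
    fix a b assume "a \<in> \<R>" "b \<in> \<R>"
    then obtain A B where "a = rect A" "b = rect B" "\<forall>h\<in>{1..G}. A h \<in> sets (N h)" "\<forall>h\<in>{1..G}. B h \<in> sets (N h)"
      by (auto simp: \<R>_def)
    then show "a \<inter> b \<in> \<R>" unfolding \<R>_def
      by (intro CollectI exI[of _ "\<lambda>h. A h \<inter> B h"]) (auto simp: rect_def)
  qed
  define HG where "HG = sigma (space M) {h \<inter> a | h a. h \<in> sets H \<and> a \<in> \<A>}"
  have HM: "h \<in> sets M" if "h \<in> sets H" for h using that H by (auto simp: subalgebra_def)
  have HG_Pow: "{h \<inter> a | h a. h \<in> sets H \<and> a \<in> \<A>} \<subseteq> sets M"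
    using HM \<A>_M by blast
  then have HG_Pow': "{h \<inter> a | h a. h \<in> sets H \<and> a \<in> \<A>} \<subseteq> Pow (space M)"
    using sets.space_closed by blast
  have HG_sets: "sets HG = sigma_sets (space M) {h \<inter> a | h a. h \<in> sets H \<and> a \<in> \<A>}"
    unfolding HG_def using HG_Pow' by (rule sets_measure_of)
  have HG_space [simp]: "space HG = space M"
    unfolding HG_def using HG_Pow' by (rule space_measure_of)
  have HG: "subalgebra M HG"
    unfolding subalgebra_def HG_sets using sets.sigma_sets_subset[OF HG_Pow] by simp
  have H_space [simp]: "space H = space M" and F_space [simp]: "space F = space M" by (simp_all add: H_def F_def)
  have H_HG: "h \<in> sets HG" if "h \<in> sets H" for h
  proof -
    have "h = h \<inter> space M" using sets.sets_into_space[OF that] by auto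
    then show ?thesis unfolding HG_sets using that \<A>_space by (blast intro: sigma_sets.Basic)
  qed
  have \<A>_HG: "a \<in> sets HG" if "a \<in> \<A>" for a
  proof -
    have "a \<subseteq> space M" using that \<A>_M sets.sets_into_space[of a M] by blast
    then have "a = space H \<inter> a" by auto
    then show ?thesis unfolding HG_sets using that sets.top[of H] by (blast intro: sigma_sets.Basic)
  qed
  have Z_HG: "Z g \<in> measurable HG (N g)"
  proof (rule measurableI)
    fix A assume "A \<in> sets (N g)"
    then have "Z g -` A \<inter> space M \<in> \<A>" unfolding \<A>_def by blast
    then show "Z g -` A \<inter> space HG \<in> sets HG" using \<A>_HG by simp
  qed (rule Z_space)
  have comp: "(\<lambda>\<omega>. (u i \<omega>, x i \<omega>)) \<in> borel_measurable Q" if "Z h \<in> measurable Q (N h)" "i \<in> T h" for h i Q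
    using measurable_compose[OF that(1)[unfolded N_def] measurable_component_singleton[OF that(2)]] that(2)
    by (simp add: Z_def)
  have comp_u: "u i \<in> borel_measurable Q" and comp_x: "x i \<in> borel_measurable Q"
    if "Z h \<in> measurable Q (N h)" "i \<in> T h" for h i Q
  proof -
    have "(\<lambda>\<omega>. (u i \<omega>, x i \<omega>)) \<in> measurable Q (borel \<Otimes>\<^sub>M borel)"
      using comp[OF that] by (simp add: borel_prod)
    from measurable_compose[OF this measurable_fst] measurable_compose[OF this measurable_snd]
    show "u i \<in> borel_measurable Q" "x i \<in> borel_measurable Q" by simp_all
  qed
  \<comment> \<open>\<open>L\<close> has to contain W and the regressors of cluster \<open>g\<close>
    and to lie in both \<open>HG\<close> and \<open>F\<close>. The full intersection achieves this
    without a description by generators.\<close>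
  define L where "L = sigma (space M) (sets HG \<inter> sets F)"
  have L_alg: "sigma_algebra (space M) (sets HG \<inter> sets F)"
    unfolding sigma_algebra_iff2
  proof (intro conjI ballI allI impI)
    show "sets HG \<inter> sets F \<subseteq> Pow (space M)" using sets.space_closed[of HG] by auto
    show "space M - s \<in> sets HG \<inter> sets F" if "s \<in> sets HG \<inter> sets F" for s
      using that sets.compl_sets[of s HG] sets.compl_sets[of s F] by simp
    show "(\<Union>i. A i) \<in> sets HG \<inter> sets F" if "range A \<subseteq> sets HG \<inter> sets F" for A :: "nat \<Rightarrow> 'a set"
      using that by (intro IntI sets.countable_UN) auto
  qed simp
  have L_sets: "sets L = sets HG \<inter> sets F"
    unfolding L_def by (rule sigma_algebra.sets_measure_of_eq[OF L_alg])
  have L_space [simp]: "space L = space M"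
    unfolding L_def by (rule sigma_algebra.space_measure_of_eq[OF L_alg])
  have L: "subalgebra HG L" and LH: "subalgebra L H" and FL: "subalgebra F L"
    using HF H_HG by (auto simp: subalgebra_def L_sets)
  have in_L: "f \<in> borel_measurable L" if "f \<in> borel_measurable HG" "f \<in> borel_measurable F"
    for f :: "'a \<Rightarrow> 'z::topological_space"
    by (rule measurableI)
       (use measurable_sets[OF that(1)] measurable_sets[OF that(2)] in \<open>simp_all add: L_sets\<close>)
  define Fo where "Fo = sigma (space M) {l \<inter> r | l r. l \<in> sets L \<and> r \<in> \<R>}"
  have LM: "l \<in> sets M" if "l \<in> sets L" for l using that F by (auto simp: subalgebra_def L_sets)
  have Fo_Pow: "{l \<inter> r | l r. l \<in> sets L \<and> r \<in> \<R>} \<subseteq> sets M"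
    using LM \<R>_M by blast
  then have Fo_Pow': "{l \<inter> r | l r. l \<in> sets L \<and> r \<in> \<R>} \<subseteq> Pow (space M)"
    using sets.space_closed by blast
  have Fo_sets: "sets Fo = sigma_sets (space M) {l \<inter> r | l r. l \<in> sets L \<and> r \<in> \<R>}"
    unfolding Fo_def using Fo_Pow' by (rule sets_measure_of)
  have Fo_space [simp]: "space Fo = space M"
    unfolding Fo_def using Fo_Pow' by (rule space_measure_of)
  have Fo: "subalgebra M Fo"
    unfolding subalgebra_def Fo_sets using sets.sigma_sets_subset[OF Fo_Pow] by simp
  have L_Fo: "l \<in> sets Fo" if "l \<in> sets L" for l
  proof -
    have "l = l \<inter> space M" using sets.sets_into_space[OF that] by auto
    then show ?thesis unfolding Fo_sets using that \<R>_space by (blast intro: sigma_sets.Basic)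
  qed
  have \<R>_Fo: "r \<in> sets Fo" if "r \<in> \<R>" for r
  proof -
    have "r \<subseteq> space M" using that \<R>_M sets.sets_into_space[of r M] by blast
    then have "r = space L \<inter> r" by auto
    then show ?thesis unfolding Fo_sets using that sets.top[of L] by (blast intro: sigma_sets.Basic)
  qed
  have FoL: "subalgebra Fo L" using L_Fo by (auto simp: subalgebra_def)
  \<comment> \<open>A condition on a single cluster \<open>h\<close> is a rectangle whose other
    sides are whole spaces.\<close>
  have Z_Fo: "Z h \<in> measurable Fo (N h)" if h: "h \<in> {1..G} - {g}" for h
  proof (rule measurableI)
    fix A assume A: "A \<in> sets (N h)"
    have "Z h -` A \<inter> space Fo = rect ((\<lambda>k. space (N k))(h := A))"
      using h Z_space by (auto simp: rect_def)
    moreover have "rect ((\<lambda>k. space (N k))(h := A)) \<in> \<R>"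
      unfolding \<R>_def using A by (intro CollectI exI conjI refl) auto
    ultimately show "Z h -` A \<inter> space Fo \<in> sets Fo" using \<R>_Fo by simp
  qed (simp add: Z_space)
  have FoF: "subalgebra Fo F"
    unfolding F_def
  proof (rule subalgebra_sigma_XW)
    fix i k assume "i \<in> {1..n}" "k < K"
    then have "(\<lambda>\<omega>. w i \<omega> k) \<in> borel_measurable H" unfolding H_def by (rule sigma_W_component[where w = w and i = i and k = k])
    then show "(\<lambda>\<omega>. w i \<omega> k) \<in> borel_measurable Fo"
      by (rule measurable_from_subalg[OF FoL measurable_from_subalg[OF LH]])
  next
    fix i assume i: "i \<in> {1..n}"
    then have "i \<in> (\<Union>g\<in>{1..G}. T g)" by (simp only: T_cover)
    then obtain h where h: "h \<in> {1..G}" "i \<in> T h" by (rule UN_E)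
    show "x i \<in> borel_measurable Fo"
    \<comment> \<open>Regressors of cluster \<open>g\<close> are known through \<open>L\<close>,
      those of the other clusters through the rectangles.\<close>
    proof (cases "h = g")
      case True
      have "x i \<in> borel_measurable HG" using comp_x[OF Z_HG] h True by simp
      moreover have "x i \<in> borel_measurable F" unfolding F_def using i by (rule sigma_XW_component)
      ultimately show ?thesis by (rule measurable_from_subalg[OF FoL in_L])
    next
      case False
      then show ?thesis using comp_x[OF Z_Fo h(2)] h by simp
    qed
  qed simp
  have indep: "AE \<omega> in M. real_cond_exp M H (indicator (a \<inter> r)) \<omega>
       = real_cond_exp M H (indicator a) \<omega> * real_cond_exp M H (indicator r) \<omega>"
    if a: "a \<in> \<A>" and r: "r \<in> \<R>" for a r
  proof -
    obtain A where A: "a = Z g -` A \<inter> space M" "A \<in> sets (N g)" using a by (auto simp: \<A>_def)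
    obtain B where B: "r = rect B" "\<forall>h\<in>{1..G}. B h \<in> sets (N h)" using r by (auto simp: \<R>_def)
    let ?E = "\<lambda>b. real_cond_exp M H (indicator b)"
    have prod: "AE \<omega> in M. ?E (\<Inter>j\<in>{1..G}. Z j -` D j \<inter> space M) \<omega> = (\<Prod>j\<in>{1..G}. ?E (Z j -` D j \<inter> space M) \<omega>)"
      if "D \<in> (\<Pi> j\<in>{1..G}. sets (N j))" for D
    proof -
      have "{1..G} \<noteq> {}" using g by auto
      then show ?thesis using T_indep that unfolding cond_indep_vars_def H_def Z_def N_def by blast
    qed
    have inter: "(\<Inter>j\<in>{1..G}. Z j -` (B(g := D)) j \<inter> space M) = Z g -` D \<inter> space M \<inter> r" for D
    proof -
      have "(\<forall>j\<in>{1..G}. Z j \<omega> \<in> (B(g := D)) j) \<longleftrightarrow> Z g \<omega> \<in> D \<and> (\<forall>j\<in>{1..G} - {g}. Z j \<omega> \<in> B j)" for \<omega>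
      proof
        assume L: "\<forall>j\<in>{1..G}. Z j \<omega> \<in> (B(g := D)) j"
        have "Z j \<omega> \<in> B j" if "j \<in> {1..G} - {g}" for j
          using bspec[OF L, of j] that by simp
        then show "Z g \<omega> \<in> D \<and> (\<forall>j\<in>{1..G} - {g}. Z j \<omega> \<in> B j)"
          using bspec[OF L g] by simp
      qed simp
      moreover have "(\<Inter>j\<in>{1..G}. Z j -` (B(g := D)) j \<inter> space M)
          = {\<omega>\<in>space M. \<forall>j\<in>{1..G}. Z j \<omega> \<in> (B(g := D)) j}"
        using g by blast
      ultimately show ?thesis unfolding B(1) rect_def by blast
    qed
    \<comment> \<open>The product formula is used twice, with \<open>A\<close> and with the whole
      space at position \<open>g\<close>. The second use identifies the product over the other
      clusters with the conditional probability of \<open>r\<close>.\<close>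
    have 1: "(\<Inter>j\<in>{1..G}. Z j -` (B(g := A)) j \<inter> space M) = a \<inter> r"
      unfolding inter A(1) ..
    have 2: "(\<Inter>j\<in>{1..G}. Z j -` (B(g := space (N g))) j \<inter> space M) = r"
      unfolding inter using Z_space \<open>r \<in> \<R>\<close> \<R>_M sets.sets_into_space[of r M] by blast
    have 3: "(\<Prod>j\<in>{1..G}. ?E (Z j -` (B(g := D)) j \<inter> space M) \<omega>)
        = ?E (Z g -` D \<inter> space M) \<omega> * (\<Prod>j\<in>{1..G} - {g}. ?E (Z j -` B j \<inter> space M) \<omega>)" for D \<omega>
      using g by (subst prod.remove[of _ g]) (auto intro!: prod.cong)
    have 4: "AE \<omega> in M. ?E (Z g -` space (N g) \<inter> space M) \<omega> = 1"
    proof -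
      interpret H: sigma_finite_subalgebra M H by (rule subalgebra_sigma_finite[OF H])
      have "Z g -` space (N g) \<inter> space M = space M" using Z_space by auto
      moreover have "AE \<omega> in M. ?E (space M) \<omega> = indicator (space M) \<omega>"
        using sets.top[of H] by (intro H.real_cond_exp_F_meas) (auto simp: emeasure_space_1)
      ultimately show ?thesis by simp
    qed
    have "B(g := A) \<in> (\<Pi> j\<in>{1..G}. sets (N j))" "B(g := space (N g)) \<in> (\<Pi> j\<in>{1..G}. sets (N j))"
      using A B by (auto simp: Pi_iff)
    note p = this[THEN prod, unfolded 1 2 3]
    show ?thesis using p 4 unfolding A(1) by eventually_elim simp
  qed
  note main = nn_cond_exp_of_cond_indep[OF HG L LH Fo FoF FL HG_sets Fo_sets \<A>_Int \<A>_M \<A>_space \<R>_Int \<R>_M \<R>_space indep]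
  show ?thesis
  proof (intro exI[of _ Fo] conjI ballI allI impI)
    show "subalgebra M Fo" by (rule Fo)
    show "subalgebra Fo (sigma_XW M n K x w)" using FoF by (simp add: F_def)
    show "u i \<in> borel_measurable Fo" if "h \<in> {1..G} - {g}" "i \<in> T h" for h i
      using comp_u[OF Z_Fo that(2)] that by simp
    fix f :: "(nat \<Rightarrow> real) \<Rightarrow> real" assume f: "f \<in> borel_measurable (PiM (T g) (\<lambda>_. borel))"
    have "(\<lambda>\<omega>. \<lambda>i\<in>T g. u i \<omega>) \<in> measurable HG (PiM (T g) (\<lambda>_. borel))"
      by (rule measurable_restrict) (rule comp_u[OF Z_HG])
    then have [measurable]: "(\<lambda>\<omega>. f (\<lambda>i\<in>T g. u i \<omega>)) \<in> borel_measurable HG"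
      using f by (rule measurable_compose)
    show "AE \<omega> in M. real_cond_exp M Fo (\<lambda>\<omega>. f (\<lambda>i\<in>T g. u i \<omega>)) \<omega>
          = real_cond_exp M (sigma_XW M n K x w) (\<lambda>\<omega>. f (\<lambda>i\<in>T g. u i \<omega>)) \<omega>"
      unfolding F_def[symmetric]
      by (rule nn_cond_exp_eq_imp_real_cond_exp_eq; rule main) measurable
  qed
qed

text \<open>Two kinds of test function suffice: a coordinate of the error vector of the cluster, and
  the product of two coordinates.\<close>

lemma (in prob_space) clustered_errors_of_cond_indep:
  fixes x :: "nat \<Rightarrow> 'a \<Rightarrow> real^'d" and u :: "nat \<Rightarrow> 'a \<Rightarrow> real"
    and G :: nat and T :: "nat \<Rightarrow> nat set"
  assumes x_meas: "\<And>i. i \<in> {1..n} \<Longrightarrow> x i \<in> borel_measurable M"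
    and u_meas: "\<And>i. i \<in> {1..n} \<Longrightarrow> u i \<in> borel_measurable M"
    and w_meas: "\<And>i k. i \<in> {1..n} \<Longrightarrow> k < K \<Longrightarrow> (\<lambda>\<omega>. w i \<omega> k) \<in> borel_measurable M"
    and T_cover: "(\<Union>g\<in>{1..G}. T g) = {1..n}"
    and T_indep: "cond_indep_vars M (sigma_W M n K w)
        (\<lambda>g. PiM (T g) (\<lambda>_. borel :: (real \<times> (real^'d)) measure))
        (\<lambda>g \<omega>. \<lambda>i\<in>T g. (u i \<omega>, x i \<omega>)) {1..G}"
    and u_mean: "\<And>i. i \<in> {1..n} \<Longrightarrow> AE \<omega> in M. real_cond_exp M (sigma_XW M n K x w) (u i) \<omega> = 0"
    and cl: "\<And>i. i \<in> {1..n} \<Longrightarrow> cl i \<in> {1..G} \<and> i \<in> T (cl i)"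
  shows "\<exists>Fo. clustered_errors M (sigma_XW M n K x w) Fo {1..n} cl u"
proof -
  have "\<forall>g\<in>{1..G}. \<exists>Fo. subalgebra M Fo \<and> subalgebra Fo (sigma_XW M n K x w)
    \<and> (\<forall>h\<in>{1..G} - {g}. \<forall>i\<in>T h. u i \<in> borel_measurable Fo)
    \<and> (\<forall>f. f \<in> borel_measurable (PiM (T g) (\<lambda>_. borel)) \<longrightarrow>
        (AE \<omega> in M. real_cond_exp M Fo (\<lambda>\<omega>. f (\<lambda>i\<in>T g. u i \<omega>)) \<omega>
          = real_cond_exp M (sigma_XW M n K x w) (\<lambda>\<omega>. f (\<lambda>i\<in>T g. u i \<omega>)) \<omega>))"
    by (rule ballI, rule leave_one_out_algebra[where x = x and u = u and w = w and K = K and n = n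
          and G = G and T = T, OF x_meas u_meas w_meas T_cover T_indep])
  from bchoice[OF this] obtain Fo where Fo: "\<forall>g\<in>{1..G}. subalgebra M (Fo g) \<and> subalgebra (Fo g) (sigma_XW M n K x w)
    \<and> (\<forall>h\<in>{1..G} - {g}. \<forall>i\<in>T h. u i \<in> borel_measurable (Fo g))
    \<and> (\<forall>f. f \<in> borel_measurable (PiM (T g) (\<lambda>_. borel)) \<longrightarrow>
        (AE \<omega> in M. real_cond_exp M (Fo g) (\<lambda>\<omega>. f (\<lambda>i\<in>T g. u i \<omega>)) \<omega>
          = real_cond_exp M (sigma_XW M n K x w) (\<lambda>\<omega>. f (\<lambda>i\<in>T g. u i \<omega>)) \<omega>))"
    by (rule exE)
  have "clustered_errors M (sigma_XW M n K x w) Fo {1..n} cl u"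
  proof
    show "subalgebra M (sigma_XW M n K x w)"
      by (rule subalgebra_sigma_XW) (use w_meas x_meas in auto)
  next
    fix i assume i: "i \<in> {1..n}"
    note c = conjunct1[OF cl[OF i]] conjunct2[OF cl[OF i]]
    note Fo' = bspec[OF Fo c(1)]
    show "subalgebra M (Fo (cl i))" using Fo' by (rule conjunct1)
    show "subalgebra (Fo (cl i)) (sigma_XW M n K x w)" using conjunct2[OF Fo'] by (rule conjunct1)
    note u_other = conjunct1[OF conjunct2[OF conjunct2[OF Fo']]]
      and ce = conjunct2[OF conjunct2[OF conjunct2[OF Fo']], rule_format]
    show "u i \<in> borel_measurable M" using u_meas i .
    show "AE \<omega> in M. real_cond_exp M (sigma_XW M n K x w) (u i) \<omega> = 0" using u_mean i .
    show "u j \<in> borel_measurable (Fo (cl i))" if "j \<in> {1..n}" "cl j \<noteq> cl i" for j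
    proof -
      have "cl j \<in> {1..G} - {cl i}" using cl[OF that(1)] that(2) by simp
      from bspec[OF bspec[OF u_other this] conjunct2[OF cl[OF that(1)]]] show ?thesis .
    qed
    show "AE \<omega> in M. real_cond_exp M (Fo (cl i)) (u i) \<omega> = real_cond_exp M (sigma_XW M n K x w) (u i) \<omega>"
      using ce[OF measurable_component_singleton[OF c(2)]] c(2) by simp
    show "AE \<omega> in M. real_cond_exp M (Fo (cl i)) (\<lambda>\<omega>. u i \<omega> * u j \<omega>) \<omega>
        = real_cond_exp M (sigma_XW M n K x w) (\<lambda>\<omega>. u i \<omega> * u j \<omega>) \<omega>"
      if "j \<in> {1..n}" "cl j = cl i" for j
    proof -
      have j: "j \<in> T (cl i)" using cl[OF that(1)] that(2) by simp
      have "(\<lambda>z. z i * z j) \<in> borel_measurable (PiM (T (cl i)) (\<lambda>_. borel :: real measure))"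
        using measurable_component_singleton[OF c(2)] measurable_component_singleton[OF j]
        by (rule borel_measurable_times)
      from ce[OF this] show ?thesis using c(2) j by simp
    qed
  qed simp
  then show ?thesis by blast
qed

section \<open>The residual-maker matrix\<close>

text \<open>An orthogonal projection, given by its entries. Only indices in \<open>I\<close> count,
  since \<open>resid_mat\<close> is a function on all natural numbers.\<close>

definition projection_on :: "'i set \<Rightarrow> ('i \<Rightarrow> 'i \<Rightarrow> real) \<Rightarrow> bool" where
  "projection_on I m \<longleftrightarrow> finite I \<and> (\<forall>i\<in>I. \<forall>j\<in>I. m i j = m j i)
     \<and> (\<forall>i\<in>I. \<forall>k\<in>I. (\<Sum>j\<in>I. m i j * m j k) = m i k)"

text \<open>For y = M z, symmetry and idempotence give |y|^2 = z'y; expanding |z - y|^2 \<ge> 0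
  finishes.\<close>

lemma projection_on_contraction:
  assumes "projection_on I m"
  shows "(\<Sum>i\<in>I. (\<Sum>j\<in>I. m i j * z j)\<^sup>2) \<le> (\<Sum>i\<in>I. (z i)\<^sup>2)"
proof -
  have fin: "finite I" and sym: "\<And>i j. i \<in> I \<Longrightarrow> j \<in> I \<Longrightarrow> m i j = m j i"
    and idem: "\<And>i k. i \<in> I \<Longrightarrow> k \<in> I \<Longrightarrow> (\<Sum>j\<in>I. m i j * m j k) = m i k"
    using assms by (auto simp: projection_on_def)
  define y where "y i = (\<Sum>j\<in>I. m i j * z j)" for i
  have "(\<Sum>i\<in>I. (y i)\<^sup>2) = (\<Sum>i\<in>I. \<Sum>j\<in>I. \<Sum>k\<in>I. m i j * z j * (m i k * z k))"
    by (simp add: y_def power2_eq_square sum_product)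
  also have "\<dots> = (\<Sum>j\<in>I. \<Sum>k\<in>I. \<Sum>i\<in>I. m i j * z j * (m i k * z k))"
    by (subst sum.swap) (intro sum.cong refl sum.swap)
  also have "\<dots> = (\<Sum>j\<in>I. \<Sum>k\<in>I. z j * z k * (\<Sum>i\<in>I. m j i * m i k))"
    by (intro sum.cong refl) (simp add: sum_distrib_left sym mult_ac cong: sum.cong)
  also have "\<dots> = (\<Sum>j\<in>I. z j * y j)"
    by (simp add: idem y_def sum_distrib_left mult_ac)
  finally have yz: "(\<Sum>i\<in>I. (y i)\<^sup>2) = (\<Sum>j\<in>I. z j * y j)" .
  have "0 \<le> (\<Sum>i\<in>I. (z i - y i)\<^sup>2)" by (intro sum_nonneg) simp
  also have "\<dots> = (\<Sum>i\<in>I. (z i)\<^sup>2) - 2 * (\<Sum>j\<in>I. z j * y j) + (\<Sum>i\<in>I. (y i)\<^sup>2)"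
    by (simp add: power2_diff sum.distrib sum_subtractf sum_distrib_left mult_ac)
  finally show ?thesis using yz by (simp add: y_def)
qed

text \<open>By symmetry a row of the projection is the image of a unit vector.\<close>

lemma projection_on_row_le:
  assumes "projection_on I m" "i \<in> I"
  shows "(\<Sum>k\<in>I. (m i k)\<^sup>2) \<le> 1"
proof -
  have fin: "finite I" using assms by (simp add: projection_on_def)
  have "(\<Sum>k\<in>I. (m i k)\<^sup>2) = (\<Sum>k\<in>I. (\<Sum>j\<in>I. m k j * (if j = i then 1 else 0))\<^sup>2)"
    using assms fin by (intro sum.cong refl) (simp add: projection_on_def if_distrib cong: if_cong)
  also have "\<dots> \<le> (\<Sum>j\<in>I. (if j = i then 1 else 0)\<^sup>2)"
    by (rule projection_on_contraction[OF assms(1)])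
  also have "\<dots> = (\<Sum>j\<in>I. if j = i then 1 else 0)" by (intro sum.cong refl) simp
  also have "\<dots> = 1" using assms(2) fin by simp
  finally show ?thesis .
qed

text \<open>In terms of Frobenius norms of M A M and A: the contraction is applied once on each
  side.\<close>

lemma projection_on_sandwich:
  assumes m: "projection_on I m"
  shows "(\<Sum>k\<in>I. \<Sum>l\<in>I. (\<Sum>i\<in>I. \<Sum>j\<in>I. m i k * a i j * m j l)\<^sup>2) \<le> (\<Sum>i\<in>I. \<Sum>j\<in>I. (a i j)\<^sup>2)"
proof -
  have sym: "\<And>i j. i \<in> I \<Longrightarrow> j \<in> I \<Longrightarrow> m i j = m j i"
    using m by (auto simp: projection_on_def)
  define c where "c k j = (\<Sum>i\<in>I. m k i * a i j)" for k j
  have eq: "(\<Sum>i\<in>I. \<Sum>j\<in>I. m i k * a i j * m j l) = (\<Sum>j\<in>I. m l j * c k j)"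
    if "k \<in> I" "l \<in> I" for k l
  proof -
    have "(\<Sum>i\<in>I. \<Sum>j\<in>I. m i k * a i j * m j l) = (\<Sum>j\<in>I. \<Sum>i\<in>I. m i k * a i j * m j l)"
      by (rule sum.swap)
    also have "\<dots> = (\<Sum>j\<in>I. m l j * c k j)"
      using that sym[of _ k] sym[of _ l] by (simp add: c_def sum_distrib_left mult_ac cong: sum.cong)
    finally show ?thesis .
  qed
  have "(\<Sum>k\<in>I. \<Sum>l\<in>I. (\<Sum>i\<in>I. \<Sum>j\<in>I. m i k * a i j * m j l)\<^sup>2) = (\<Sum>k\<in>I. \<Sum>l\<in>I. (\<Sum>j\<in>I. m l j * c k j)\<^sup>2)"
    by (simp add: eq)
  also have "\<dots> \<le> (\<Sum>k\<in>I. \<Sum>j\<in>I. (c k j)\<^sup>2)"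
    by (intro sum_mono projection_on_contraction[OF m])
  also have "\<dots> = (\<Sum>j\<in>I. \<Sum>k\<in>I. (\<Sum>i\<in>I. m k i * a i j)\<^sup>2)"
    unfolding c_def by (rule sum.swap)
  also have "\<dots> \<le> (\<Sum>j\<in>I. \<Sum>i\<in>I. (a i j)\<^sup>2)"
    by (intro sum_mono projection_on_contraction[OF m])
  also have "\<dots> = (\<Sum>i\<in>I. \<Sum>j\<in>I. (a i j)\<^sup>2)" by (rule sum.swap)
  finally show ?thesis .
qed

section \<open>The Gram matrix, its inverse and the residual maker\<close>

lemma gram_carrier [simp]: "gram n K w \<omega> \<in> carrier_mat K K"
  by (simp add: gram_def)

lemma mat_inv_eq:
  fixes A :: "real mat"
  assumes A: "A \<in> carrier_mat n n" and B: "B \<in> carrier_mat n n" "A * B = 1\<^sub>m n" "B * A = 1\<^sub>m n"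
  shows "mat_inv A = B"
proof (cases "mat_inverse A")
  case None
  have "A \<in> Units (ring_mat TYPE(real) n ())"
    using A B by (auto simp: Units_def ring_mat_def)
  then show ?thesis using mat_inverse(1)[OF A None, where b="()"] by simp
next
  case (Some C)
  have C: "C * A = 1\<^sub>m n" "C \<in> carrier_mat n n" using mat_inverse(2)[OF A Some] by auto
  have "C = C * (A * B)" using C B by simp
  also have "\<dots> = (C * A) * B" by (rule assoc_mult_mat[symmetric, OF C(2) A B(1)])
  also have "\<dots> = B" using C B by simp
  finally show ?thesis using Some by (simp add: mat_inv_def)
qed

text \<open>The adjugate formula writes the entries as rational functions of the entries of
  \<open>A\<close>, which gives measurability; singular matrices are covered by the default value
  zero.\<close>

lemma mat_inv_adj_mat:
  fixes A :: "real mat"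
  assumes A: "A \<in> carrier_mat n n"
  shows "mat_inv A = (if det A = 0 then 0\<^sub>m n n else (1 / det A) \<cdot>\<^sub>m adj_mat A)"
proof (cases "det A = 0")
  case True
  have "mat_inverse A = None"
  proof (rule ccontr)
    assume "mat_inverse A \<noteq> None"
    then obtain C where "mat_inverse A = Some C" by blast
    then have C: "A * C = 1\<^sub>m n" "C \<in> carrier_mat n n" using mat_inverse(2)[OF A] by auto
    then have "det A * det C = 1" using det_mult[OF A C(2)] by simp
    then show False using True by simp
  qed
  then show ?thesis using True A by (simp add: mat_inv_def)
next
  case False
  note adj = adj_mat[OF A]
  have "A * ((1 / det A) \<cdot>\<^sub>m adj_mat A) = 1\<^sub>m n" "((1 / det A) \<cdot>\<^sub>m adj_mat A) * A = 1\<^sub>m n"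
    using A adj False by (auto simp: mult_smult_distrib[OF A adj(1)] mult_smult_assoc_mat[OF adj(1) A])
  then show ?thesis using False adj by (simp add: mat_inv_eq[OF A])
qed

text \<open>A singular Gram matrix has eigenvalue 0. The eigenvalues are roots of the characteristic
  polynomial, so there are finitely many and \<open>Min\<close> is at most each of them.\<close>

lemma det_gram_nonzero:
  assumes K: "K \<ge> 1" and pos: "lambda_min_mat (gram n K w \<omega>) > 0"
  shows "det (gram n K w \<omega>) \<noteq> 0"
proof
  assume "det (gram n K w \<omega>) = 0"
  from det_0_iff_vec_prod_zero[OF gram_carrier, THEN iffD1, OF this]
  obtain v where v: "v \<in> carrier_vec K \<and> v \<noteq> 0\<^sub>v K \<and> gram n K w \<omega> *\<^sub>v v = 0\<^sub>v K"
    by (rule exE)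
  have dim: "dim_row (gram n K w \<omega>) = K" by (simp add: gram_def)
  have "0\<^sub>v K = 0 \<cdot>\<^sub>v v" using v by (intro eq_vecI) auto
  then have "eigenvector (gram n K w \<omega>) v 0"
    unfolding eigenvector_def dim using v by simp
  then have ev: "eigenvalue (gram n K w \<omega>) 0"
    unfolding eigenvalue_def by (rule exI)
  have "char_poly (gram n K w \<omega>) \<noteq> 0"
    using degree_monic_char_poly[OF gram_carrier[of n K w \<omega>]] by auto
  then have "finite {l. eigenvalue (gram n K w \<omega>) l}"
    unfolding eigenvalue_root_char_poly[OF gram_carrier] by (rule poly_roots_finite)
  then have "lambda_min_mat (gram n K w \<omega>) \<le> 0"
    unfolding lambda_min_mat_def using ev by (intro Min_le) auto
  then show False using pos by simp
qed

lemma mat_inv_gram: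
  assumes det: "det (gram n K w \<omega>) \<noteq> 0"
  defines "B \<equiv> mat_inv (gram n K w \<omega>)"
  shows mat_inv_gram_left: "k < K \<Longrightarrow> m < K \<Longrightarrow>
      (\<Sum>l<K. B $$ (k, l) * (\<Sum>i=1..n. w i \<omega> l * w i \<omega> m)) = (if k = m then 1 else 0)"
    and mat_inv_gram_sym: "k < K \<Longrightarrow> m < K \<Longrightarrow> B $$ (k, m) = B $$ (m, k)"
proof -
  let ?A = "gram n K w \<omega>"
  note A = gram_carrier[of n K w \<omega>]
  note adj = adj_mat[OF A]
  have Bdef: "B = (1 / det ?A) \<cdot>\<^sub>m adj_mat ?A" using det by (simp add: B_def mat_inv_adj_mat[OF A])
  have B: "B \<in> carrier_mat K K" using adj by (simp add: Bdef)
  have AB: "?A * B = 1\<^sub>m K" and BA: "B * ?A = 1\<^sub>m K"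
    using det adj unfolding Bdef by (auto simp: mult_smult_distrib[OF A adj(1)] mult_smult_assoc_mat[OF adj(1) A])
  have entry: "(B * ?A) $$ (k, m) = (\<Sum>l<K. B $$ (k, l) * (\<Sum>i=1..n. w i \<omega> l * w i \<omega> m))" if "k < K" "m < K" for k m
    using that B by (simp add: scalar_prod_def gram_def atLeast0LessThan)
  show "(\<Sum>l<K. B $$ (k, l) * (\<Sum>i=1..n. w i \<omega> l * w i \<omega> m)) = (if k = m then 1 else 0)" if "k < K" "m < K"
    using entry[OF that] that unfolding BA by simp
  have At: "transpose_mat ?A = ?A" by (rule eq_matI) (auto simp: gram_def mult.commute)
  \<comment> \<open>The transposed inverse is a left inverse of the symmetric Gram matrix and
    therefore equals \<open>B\<close>.\<close>
  have "transpose_mat B * ?A = transpose_mat (?A * B)"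
    using transpose_mult[OF A B] At by simp
  then have tB: "transpose_mat B * ?A = 1\<^sub>m K" by (simp add: AB)
  have tBc: "transpose_mat B \<in> carrier_mat K K" using B by simp
  have "transpose_mat B = transpose_mat B * (?A * B)" using AB tBc by simp
  also have "\<dots> = (transpose_mat B * ?A) * B" by (rule assoc_mult_mat[symmetric, OF tBc A B])
  also have "\<dots> = B" using tB B by simp
  finally have "transpose_mat B $$ (k, m) = B $$ (k, m)" for k m by simp
  then show "B $$ (k, m) = B $$ (m, k)" if "k < K" "m < K"
    using that B by (metis index_transpose_mat(1) carrier_matD)
qed

lemma resid_mat_sym:
  assumes "det (gram n K w \<omega>) \<noteq> 0"
  shows "resid_mat n K w i j \<omega> = resid_mat n K w j i \<omega>"
proof -
  have "(\<Sum>k<K. \<Sum>l<K. w i \<omega> k * mat_inv (gram n K w \<omega>) $$ (k, l) * w j \<omega> l)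
      = (\<Sum>l<K. \<Sum>k<K. w i \<omega> k * mat_inv (gram n K w \<omega>) $$ (k, l) * w j \<omega> l)"
    by (rule sum.swap)
  also have "\<dots> = (\<Sum>l<K. \<Sum>k<K. w j \<omega> l * mat_inv (gram n K w \<omega>) $$ (l, k) * w i \<omega> k)"
    by (intro sum.cong refl) (simp add: mat_inv_gram_sym[OF assms] mult_ac)
  finally show ?thesis by (simp add: resid_mat_def eq_commute)
qed

text \<open>Rests on the inverse cancelling the Gram sum. It serves three purposes: idempotence of
  M, removal of the covariates from the model, and removal of the population regression on w from
  x.\<close>

lemma resid_mat_annihilates:
  assumes det: "det (gram n K w \<omega>) \<noteq> 0" and i: "i \<in> {1..n}" and m: "m < K"
  shows "(\<Sum>j=1..n. resid_mat n K w i j \<omega> * w j \<omega> m) = 0"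
proof -
  let ?B = "\<lambda>k l. mat_inv (gram n K w \<omega>) $$ (k, l)"
  have "(\<Sum>j=1..n. (\<Sum>k<K. \<Sum>l<K. w i \<omega> k * ?B k l * w j \<omega> l) * w j \<omega> m)
      = (\<Sum>j=1..n. \<Sum>k<K. \<Sum>l<K. w i \<omega> k * (?B k l * (w j \<omega> l * w j \<omega> m)))"
    unfolding sum_distrib_right by (simp only: mult.assoc)
  also have "\<dots> = (\<Sum>k<K. \<Sum>l<K. \<Sum>j=1..n. w i \<omega> k * (?B k l * (w j \<omega> l * w j \<omega> m)))"
    by (subst sum.swap) (intro sum.cong refl sum.swap)
  also have "\<dots> = (\<Sum>k<K. w i \<omega> k * (\<Sum>l<K. ?B k l * (\<Sum>j=1..n. w j \<omega> l * w j \<omega> m)))"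
    by (simp add: sum_distrib_left)
  also have "\<dots> = (\<Sum>k<K. w i \<omega> k * (if k = m then 1 else 0))"
    using mat_inv_gram_left[OF det _ m] by (intro sum.cong refl) simp
  also have "\<dots> = w i \<omega> m" using m by (simp add: if_distrib cong: if_cong)
  finally have "(\<Sum>j=1..n. (\<Sum>k<K. \<Sum>l<K. w i \<omega> k * ?B k l * w j \<omega> l) * w j \<omega> m) = w i \<omega> m" .
  moreover have "(\<Sum>j=1..n. (if i = j then 1 else 0) * w j \<omega> m) = w i \<omega> m"
    using i by (simp add: if_distrib[of "\<lambda>x. x * _"] cong: if_cong)
  ultimately show ?thesis
    unfolding resid_mat_def left_diff_distrib sum_subtractf by simp
qed

text \<open>M is the identity minus a matrix whose columns are combinations of the covariates, and M
  annihilates these.\<close>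

lemma projection_on_resid_mat:
  assumes det: "det (gram n K w \<omega>) \<noteq> 0"
  shows "projection_on {1..n} (\<lambda>i j. resid_mat n K w i j \<omega>)"
  unfolding projection_on_def
proof (intro conjI ballI)
  fix i j assume "i \<in> {1..n}" "j \<in> {1..n}"
  show "resid_mat n K w i j \<omega> = resid_mat n K w j i \<omega>" by (rule resid_mat_sym[OF det])
next
  fix i m assume i: "i \<in> {1..n}" "m \<in> {1..n}"
  let ?B = "\<lambda>k l. mat_inv (gram n K w \<omega>) $$ (k, l)"
  let ?M = "\<lambda>i j. resid_mat n K w i j \<omega>"
  have "(\<Sum>j=1..n. ?M i j * (\<Sum>k<K. \<Sum>l<K. w j \<omega> k * ?B k l * w m \<omega> l))
      = (\<Sum>j=1..n. \<Sum>k<K. \<Sum>l<K. (?M i j * w j \<omega> k) * (?B k l * w m \<omega> l))"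
    unfolding sum_distrib_left by (simp only: mult.assoc)
  also have "\<dots> = (\<Sum>k<K. \<Sum>l<K. \<Sum>j=1..n. (?M i j * w j \<omega> k) * (?B k l * w m \<omega> l))"
    by (subst sum.swap) (intro sum.cong refl sum.swap)
  also have "\<dots> = (\<Sum>k<K. \<Sum>l<K. (\<Sum>j=1..n. ?M i j * w j \<omega> k) * (?B k l * w m \<omega> l))"
    by (simp add: sum_distrib_right)
  also have "\<dots> = 0"
    using resid_mat_annihilates[OF det i(1)] by (intro sum.neutral ballI) simp
  finally have z: "(\<Sum>j=1..n. ?M i j * (\<Sum>k<K. \<Sum>l<K. w j \<omega> k * ?B k l * w m \<omega> l)) = 0" .
  have "(\<Sum>j=1..n. ?M i j * ?M j m)
     = (\<Sum>j=1..n. ?M i j * (if j = m then 1 else 0)) - (\<Sum>j=1..n. ?M i j * (\<Sum>k<K. \<Sum>l<K. w j \<omega> k * ?B k l * w m \<omega> l))"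
    by (subst (2) resid_mat_def) (simp add: right_diff_distrib sum_subtractf)
  also have "(\<Sum>j=1..n. ?M i j * (if j = m then 1 else 0)) = ?M i m"
    using i by (simp add: if_distrib cong: if_cong)
  finally show "(\<Sum>j=1..n. ?M i j * ?M j m) = ?M i m" using z by simp
qed simp

section \<open>Measurability of the matrix quantities\<close>

lemma det_measurable:
  assumes dim: "\<And>\<omega>. \<omega> \<in> space N \<Longrightarrow> A \<omega> \<in> carrier_mat n n"
    and meas: "\<And>i j. i < n \<Longrightarrow> j < n \<Longrightarrow> (\<lambda>\<omega>. A \<omega> $$ (i, j)) \<in> borel_measurable N"
  shows "(\<lambda>\<omega>. det (A \<omega>) :: real) \<in> borel_measurable N"
proof -
  have "(\<lambda>\<omega>. \<Sum>p\<in>{p. p permutes {0..<n}}. signof p * (\<Prod>i = 0..<n. A \<omega> $$ (i, p i))) \<in> borel_measurable N"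
  proof (intro borel_measurable_sum borel_measurable_times borel_measurable_prod)
    fix p i assume "p \<in> {p. p permutes {0..<n}}" "i \<in> {0..<n}"
    then have "i < n" "p i < n" using permutes_in_image[of p "{0..<n}" i] by auto
    then show "(\<lambda>\<omega>. A \<omega> $$ (i, p i)) \<in> borel_measurable N" by (rule meas)
  qed simp
  then show ?thesis by (rule measurable_cong[THEN iffD1, rotated]) (simp add: det_def'[OF dim])
qed

lemma gram_entry_measurable:
  assumes "\<And>i k. i \<in> {1..n} \<Longrightarrow> k < K \<Longrightarrow> (\<lambda>\<omega>. w i \<omega> k) \<in> borel_measurable N" "k < K" "l < K"
  shows "(\<lambda>\<omega>. gram n K w \<omega> $$ (k, l)) \<in> borel_measurable N"
  using assms unfolding gram_def by (simp add: borel_measurable_sum borel_measurable_times)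

lemma det_gram_measurable:
  assumes "\<And>i k. i \<in> {1..n} \<Longrightarrow> k < K \<Longrightarrow> (\<lambda>\<omega>. w i \<omega> k) \<in> borel_measurable N"
  shows "(\<lambda>\<omega>. det (gram n K w \<omega>)) \<in> borel_measurable N"
  by (rule det_measurable[OF gram_carrier]) (rule gram_entry_measurable[OF assms])

lemma mat_inv_measurable:
  assumes dim: "\<And>\<omega>. A \<omega> \<in> carrier_mat n n"
    and meas: "\<And>i j. i < n \<Longrightarrow> j < n \<Longrightarrow> (\<lambda>\<omega>. A \<omega> $$ (i, j)) \<in> borel_measurable N"
    and ij: "i < n" "j < n"
  shows "(\<lambda>\<omega>. mat_inv (A \<omega>) $$ (i, j)) \<in> borel_measurable N"
proof -
  have detM: "(\<lambda>\<omega>. det (A \<omega>)) \<in> borel_measurable N" by (rule det_measurable[OF dim meas])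
  have dimA: "dim_row (A \<omega>) = n" "dim_col (A \<omega>) = n" for \<omega> using dim[of \<omega>] by auto
  have del: "mat_delete (A \<omega>) j i \<in> carrier_mat (n - 1) (n - 1)" for \<omega> using mat_delete_carrier[OF dim] .
  have cof: "(\<lambda>\<omega>. det (mat_delete (A \<omega>) j i)) \<in> borel_measurable N"
  proof (rule det_measurable[OF del])
    fix k l assume kl: "k < n - 1" "l < n - 1"
    have eq: "mat_delete (A \<omega>) j i $$ (k, l)
        = A \<omega> $$ (if k < j then k else Suc k, if l < i then l else Suc l)" for \<omega>
      using kl by (simp add: mat_delete_def dimA)
    show "(\<lambda>\<omega>. mat_delete (A \<omega>) j i $$ (k, l)) \<in> borel_measurable N"
      unfolding eq by (rule meas) (use kl in auto)
  qed
  have "(\<lambda>\<omega>. if det (A \<omega>) = 0 then 0 else (1 / det (A \<omega>)) * ((-1) ^ (j + i) * det (mat_delete (A \<omega>) j i))) \<in> borel_measurable N"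
    using detM cof by measurable
  also have "(\<lambda>\<omega>. if det (A \<omega>) = 0 then 0 else (1 / det (A \<omega>)) * ((-1) ^ (j + i) * det (mat_delete (A \<omega>) j i)))
      = (\<lambda>\<omega>. mat_inv (A \<omega>) $$ (i, j))"
    using ij by (auto simp: mat_inv_adj_mat[OF dim] adj_mat_def cofactor_def dimA fun_eq_iff)
  finally show ?thesis .
qed

lemma resid_mat_measurable:
  assumes w: "\<And>i k. i \<in> {1..n} \<Longrightarrow> k < K \<Longrightarrow> (\<lambda>\<omega>. w i \<omega> k) \<in> borel_measurable N"
    and ij: "i \<in> {1..n}" "j \<in> {1..n}"
  shows "resid_mat n K w i j \<in> borel_measurable N"
proof -
  have "(\<lambda>\<omega>. mat_inv (gram n K w \<omega>) $$ (k, l)) \<in> borel_measurable N" if "k < K" "l < K" for k l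
    by (rule mat_inv_measurable[OF gram_carrier gram_entry_measurable[OF w] that])
  then show ?thesis
    unfolding resid_mat_def[abs_def] using w ij
    by (intro borel_measurable_diff borel_measurable_sum borel_measurable_times borel_measurable_const) auto
qed

lemma v_hat_measurable:
  fixes x :: "nat \<Rightarrow> 'a \<Rightarrow> real^'d"
  assumes w: "\<And>i k. i \<in> {1..n} \<Longrightarrow> k < K \<Longrightarrow> (\<lambda>\<omega>. w i \<omega> k) \<in> borel_measurable N"
    and x: "\<And>i. i \<in> {1..n} \<Longrightarrow> x i \<in> borel_measurable N"
    and i: "i \<in> {1..n}"
  shows "v_hat n K w x i \<in> borel_measurable N"
  unfolding v_hat_def[abs_def]
  using resid_mat_measurable[OF w i] x by (intro borel_measurable_sum borel_measurable_scaleR) auto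

lemma vec_nth_measurable:
  fixes f :: "'a \<Rightarrow> real^'d"
  assumes "f \<in> borel_measurable N"
  shows "(\<lambda>\<omega>. vec_nth (f \<omega>) a) \<in> borel_measurable N"
  using assms by (rule measurable_compose) (intro borel_measurable_continuous_onI continuous_intros)

lemma vec_measurable:
  fixes f :: "'a \<Rightarrow> real^'d"
  assumes "\<And>a. (\<lambda>\<omega>. vec_nth (f \<omega>) a) \<in> borel_measurable N"
  shows "f \<in> borel_measurable N"
proof (rule borel_measurable_euclidean_space[THEN iffD2], rule ballI)
  fix b :: "real^'d" assume "b \<in> Basis"
  then obtain a where "b = axis a 1" by (auto simp: Basis_vec_def)
  then show "(\<lambda>\<omega>. f \<omega> \<bullet> b) \<in> borel_measurable N" using assms by (simp add: inner_axis)
qed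

lemma matrix_entry_measurable:
  fixes f :: "'a \<Rightarrow> real^'d^'e"
  assumes "f \<in> borel_measurable N"
  shows "(\<lambda>\<omega>. vec_nth (vec_nth (f \<omega>) a) b) \<in> borel_measurable N"
  using assms by (rule measurable_compose) (intro borel_measurable_continuous_onI continuous_intros)

lemma matrix_measurable:
  fixes f :: "'a \<Rightarrow> real^'d^'e"
  assumes "\<And>a b. (\<lambda>\<omega>. vec_nth (vec_nth (f \<omega>) a) b) \<in> borel_measurable N"
  shows "f \<in> borel_measurable N"
proof (rule borel_measurable_euclidean_space[THEN iffD2], rule ballI)
  fix b :: "real^'d^'e" assume "b \<in> Basis"
  then obtain a c where "b = axis a (axis c 1)" by (auto simp: Basis_vec_def)
  then show "(\<lambda>\<omega>. f \<omega> \<bullet> b) \<in> borel_measurable N" using assms by (simp add: inner_axis)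
qed

lemma matrix_inv_mult:
  assumes "invertible A"
  shows "A ** matrix_inv A = Finite_Cartesian_Product.mat 1 \<and> matrix_inv A ** A = Finite_Cartesian_Product.mat 1"
  using assms unfolding matrix_inv_def invertible_def by (rule someI_ex)

text \<open>Cramer's rule gives a measurable expression for nonsingular \<open>A\<close>. Singular
  matrices cannot be set aside, since the slope estimator is defined on the whole sample
  space.\<close>

lemma matrix_inv_mult_measurable:
  fixes A :: "'a \<Rightarrow> real^'d^'d" and b :: "'a \<Rightarrow> real^'d"
  assumes A: "A \<in> borel_measurable N" and b: "b \<in> borel_measurable N"
  shows "(\<lambda>\<omega>. matrix_inv (A \<omega>) *v b \<omega>) \<in> borel_measurable N"
proof -
  \<comment> \<open>\<open>matrix_inv\<close> is a choice operator; for a singular matrix no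
    candidate exists, so its value is this fixed matrix, independent of \<omega>.\<close>
  define C where "C = (SOME A' :: real^'d^'d. False)"
  define R where "R \<omega> = (if Determinants.det (A \<omega>) = 0 then C *v b \<omega>
     else (\<chi> k. Determinants.det (\<chi> i j. if j = k then vec_nth (b \<omega>) i else vec_nth (vec_nth (A \<omega>) i) j) / Determinants.det (A \<omega>)))" for \<omega>
  note Am [measurable] = matrix_entry_measurable[OF A] and bm [measurable] = vec_nth_measurable[OF b]
  have dA [measurable]: "(\<lambda>\<omega>. Determinants.det (A \<omega>)) \<in> borel_measurable N"
    unfolding Determinants.det_def by measurable
  have R: "R \<in> borel_measurable N"
  proof (rule vec_measurable)
    fix k
    have "(\<lambda>\<omega>. if Determinants.det (A \<omega>) = 0 then (\<Sum>j\<in>UNIV. vec_nth (vec_nth C k) j * vec_nth (b \<omega>) j)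
        else Determinants.det (\<chi> i j. if j = k then vec_nth (b \<omega>) i else vec_nth (vec_nth (A \<omega>) i) j) / Determinants.det (A \<omega>))
        \<in> borel_measurable N"
      unfolding Determinants.det_def[of "\<chi> i j. _ i j"] vec_lambda_beta by measurable
    then show "(\<lambda>\<omega>. vec_nth (R \<omega>) k) \<in> borel_measurable N"
      by (rule measurable_cong[THEN iffD1, rotated]) (simp add: R_def matrix_vector_mult_def)
  qed
  moreover have "matrix_inv (A \<omega>) *v b \<omega> = R \<omega>" for \<omega>
  proof (cases "Determinants.det (A \<omega>) = 0")
    case True
    then have "\<not> invertible (A \<omega>)" by (simp add: invertible_det_nz)
    then have "(\<lambda>A'. A \<omega> ** A' = Finite_Cartesian_Product.mat 1 \<and> A' ** A \<omega> = Finite_Cartesian_Product.mat 1) = (\<lambda>_. False)"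
      by (auto simp: invertible_def)
    then have "matrix_inv (A \<omega>) = C" unfolding matrix_inv_def C_def by simp
    then show ?thesis using True by (simp add: R_def)
  next
    case False
    then have inv: "invertible (A \<omega>)" by (simp add: invertible_det_nz)
    have "A \<omega> *v (matrix_inv (A \<omega>) *v b \<omega>) = b \<omega>"
      using matrix_inv_mult[OF inv] by (simp add: matrix_vector_mul_assoc)
    then show ?thesis using cramer[OF False] False by (simp add: R_def)
  qed
  ultimately show ?thesis by simp
qed

text \<open>The norm of this matrix type is the Frobenius norm; Cauchy-Schwarz is applied row by
  row.\<close>

lemma norm_matrix_vector_mult_le:
  fixes A :: "real^'n^'m"
  shows "norm (A *v x) \<le> norm A * norm x"
proof -
  have "norm (A *v x) = L2_set (\<lambda>i. \<bar>vec_nth A i \<bullet> x\<bar>) UNIV"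
    by (simp add: norm_vec_def matrix_vector_mul_component)
  also have "\<dots> \<le> L2_set (\<lambda>i. norm (vec_nth A i) * norm x) UNIV"
    by (intro L2_set_mono) (auto simp: Cauchy_Schwarz_ineq2)
  also have "\<dots> = norm A * norm x"
    by (simp add: norm_vec_def[of A] L2_set_left_distrib)
  finally show ?thesis .
qed

section \<open>Cluster sums and the least squares error\<close>

text \<open>The label \<open>cl\<close> turns sums inside clusters into sums over all index pairs
  with the condition \<open>cl i = cl j\<close>, the form to which the projection and Cauchy-Schwarz
  bounds apply.\<close>

locale cluster_partition =
  fixes I :: "nat set" and G :: nat and T :: "nat \<Rightarrow> nat set" and cl :: "nat \<Rightarrow> nat"
  assumes fin: "finite I"
    and cover: "(\<Union>g\<in>{1..G}. T g) = I"
    and disjoint: "disjoint_family_on T {1..G}"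
    and cl: "\<And>i. i \<in> I \<Longrightarrow> cl i \<in> {1..G} \<and> i \<in> T (cl i)"
begin

lemma T_eq:
  assumes g: "g \<in> {1..G}"
  shows "T g = {i\<in>I. cl i = g}"
proof (rule Set.set_eqI, rule iffI)
  fix i assume i: "i \<in> T g"
  have iI: "i \<in> I" unfolding cover[symmetric] using g i by (rule UN_I)
  have "cl i = g"
  proof (rule ccontr)
    assume "cl i \<noteq> g"
    then have "T (cl i) \<inter> T g = {}" using disjoint g cl[OF iI] by (auto simp: disjoint_family_on_def)
    then show False using i cl[OF iI] by blast
  qed
  then show "i \<in> {i\<in>I. cl i = g}" using iI by simp
next
  fix i assume "i \<in> {i\<in>I. cl i = g}"
  then show "i \<in> T g" using cl[of i] by auto
qed

lemma sum_clusters: "(\<Sum>g=1..G. \<Sum>i\<in>T g. f i) = (\<Sum>i\<in>I. f i)"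
proof -
  have "(\<Sum>g=1..G. \<Sum>i\<in>T g. f i) = (\<Sum>g=1..G. \<Sum>i\<in>{i\<in>I. cl i = g}. f i)"
    by (intro sum.cong refl) (simp add: T_eq)
  also have "\<dots> = (\<Sum>i\<in>I. f i)"
    using fin cl by (intro sum.group) auto
  finally show ?thesis .
qed

lemma sum_cluster_pairs:
  "(\<Sum>g=1..G. \<Sum>i\<in>T g. \<Sum>j\<in>T g. f i j) = (\<Sum>i\<in>I. \<Sum>j\<in>I. if cl i = cl j then f i j else 0)"
proof -
  have "(\<Sum>g=1..G. \<Sum>i\<in>T g. \<Sum>j\<in>T g. f i j) = (\<Sum>g=1..G. \<Sum>i\<in>T g. \<Sum>j\<in>I. if cl i = cl j then f i j else 0)"
  proof (rule sum.cong[OF refl], rule sum.cong[OF refl])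
    fix g i assume g: "g \<in> {1..G}" and i: "i \<in> T g"
    have "cl i = g" using i unfolding T_eq[OF g] by simp
    then have "T g = {j\<in>I. cl i = cl j}" unfolding T_eq[OF g] by auto
    then show "(\<Sum>j\<in>T g. f i j) = (\<Sum>j\<in>I. if cl i = cl j then f i j else 0)"
      using sum.inter_filter[OF fin, of "f i" "\<lambda>j. cl i = cl j"] by simp
  qed
  also have "\<dots> = (\<Sum>i\<in>I. \<Sum>j\<in>I. if cl i = cl j then f i j else 0)"
    by (rule sum_clusters)
  finally show ?thesis .
qed

lemma sum_cluster_pairs_le:
  assumes c: "\<And>i. i \<in> I \<Longrightarrow> card {j\<in>I. cl j = cl i} \<le> c"
    and f: "\<And>i. i \<in> I \<Longrightarrow> (f i :: real) \<ge> 0"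
  shows "(\<Sum>i\<in>I. \<Sum>j\<in>I. if cl i = cl j then f i else 0) \<le> real c * (\<Sum>i\<in>I. f i)"
    and "(\<Sum>i\<in>I. \<Sum>j\<in>I. if cl i = cl j then f j else 0) \<le> real c * (\<Sum>i\<in>I. f i)"
proof -
  show 1: "(\<Sum>i\<in>I. \<Sum>j\<in>I. if cl i = cl j then f i else 0) \<le> real c * (\<Sum>i\<in>I. f i)"
    unfolding sum_distrib_left
  proof (rule sum_mono)
    fix i assume i: "i \<in> I"
    have "(\<Sum>j\<in>I. if cl i = cl j then f i else 0) = real (card {j\<in>I. cl j = cl i}) * f i"
      using fin by (simp add: sum.inter_filter[symmetric] eq_commute)
    also have "\<dots> \<le> real c * f i" using c[OF i] f[OF i] by (intro mult_right_mono) auto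
    finally show "(\<Sum>j\<in>I. if cl i = cl j then f i else 0) \<le> real c * f i" .
  qed
  have "(\<Sum>i\<in>I. \<Sum>j\<in>I. if cl i = cl j then f j else 0) = (\<Sum>i\<in>I. \<Sum>j\<in>I. if cl i = cl j then f i else 0)"
    by (subst sum.swap) (intro sum.cong refl if_cong, auto)
  then show "(\<Sum>i\<in>I. \<Sum>j\<in>I. if cl i = cl j then f j else 0) \<le> real c * (\<Sum>i\<in>I. f i)"
    using 1 by simp
qed

text \<open>Cauchy-Schwarz over the pairs inside clusters, with \<open>p\<close> in one factor and
  \<open>q\<close> times \<sigma> in the other; each index starts or ends at most \<open>c\<close>
  such pairs. With conditional covariances for \<sigma> this bounds the bilinear form of the
  conditional variance of the score.\<close>

lemma cluster_bilinear_le: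
  assumes c: "\<And>i. i \<in> I \<Longrightarrow> card {j\<in>I. cl j = cl i} \<le> c"
    and \<sigma>: "\<And>i j. i \<in> I \<Longrightarrow> j \<in> I \<Longrightarrow> \<bar>\<sigma> i j\<bar> \<le> \<kappa>"
  shows "(\<Sum>i\<in>I. \<Sum>j\<in>I. if cl i = cl j then p i * q j * \<sigma> i j else 0)\<^sup>2
    \<le> (\<kappa> * real c)\<^sup>2 * ((\<Sum>i\<in>I. (p i)\<^sup>2) * (\<Sum>i\<in>I. (q i)\<^sup>2))"
proof (cases "I = {}")
  case False
  then have \<kappa>: "\<kappa> \<ge> 0" using \<sigma> by (meson abs_ge_zero all_not_in_conv order_trans)
  define a where "a z = (if cl (fst z) = cl (snd z) then p (fst z) else 0)" for z
  define b where "b z = (if cl (fst z) = cl (snd z) then q (snd z) * \<sigma> (fst z) (snd z) else 0)" for z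
  have "(\<Sum>i\<in>I. \<Sum>j\<in>I. if cl i = cl j then p i * q j * \<sigma> i j else 0) = (\<Sum>z\<in>I\<times>I. a z * b z)"
    by (simp add: sum.cartesian_product a_def b_def split_def if_distrib mult.assoc cong: if_cong)
  then have "(\<Sum>i\<in>I. \<Sum>j\<in>I. if cl i = cl j then p i * q j * \<sigma> i j else 0)\<^sup>2
      \<le> (\<Sum>z\<in>I\<times>I. (a z)\<^sup>2) * (\<Sum>z\<in>I\<times>I. (b z)\<^sup>2)"
    using Cauchy_Schwarz_ineq_sum[of a b "I \<times> I"] by simp
  also have "\<dots> \<le> (real c * (\<Sum>i\<in>I. (p i)\<^sup>2)) * (\<kappa>\<^sup>2 * (real c * (\<Sum>i\<in>I. (q i)\<^sup>2)))"
  proof (rule mult_mono)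
    have "(\<Sum>z\<in>I\<times>I. (a z)\<^sup>2) = (\<Sum>i\<in>I. \<Sum>j\<in>I. if cl i = cl j then (p i)\<^sup>2 else 0)"
      by (simp add: sum.cartesian_product a_def split_def) (intro sum.cong refl, simp)
    then show "(\<Sum>z\<in>I\<times>I. (a z)\<^sup>2) \<le> real c * (\<Sum>i\<in>I. (p i)\<^sup>2)"
      using sum_cluster_pairs_le(1)[OF c, of "\<lambda>i. (p i)\<^sup>2"] by simp
    have "(\<Sum>z\<in>I\<times>I. (b z)\<^sup>2) \<le> (\<Sum>z\<in>I\<times>I. \<kappa>\<^sup>2 * (if cl (fst z) = cl (snd z) then (q (snd z))\<^sup>2 else 0))"
    proof (rule sum_mono)
      fix z assume z: "z \<in> I \<times> I"
      then have "\<bar>\<sigma> (fst z) (snd z)\<bar>\<^sup>2 \<le> \<kappa>\<^sup>2" using \<sigma>[of "fst z" "snd z"] by (intro power_mono) auto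
      from mult_left_mono[OF this, of "(q (snd z))\<^sup>2"]
      show "(b z)\<^sup>2 \<le> \<kappa>\<^sup>2 * (if cl (fst z) = cl (snd z) then (q (snd z))\<^sup>2 else 0)"
        by (simp add: b_def power_mult_distrib mult.commute)
    qed
    also have "\<dots> = \<kappa>\<^sup>2 * (\<Sum>i\<in>I. \<Sum>j\<in>I. if cl i = cl j then (q j)\<^sup>2 else 0)"
      by (simp add: sum.cartesian_product split_def sum_distrib_left)
    also have "\<dots> \<le> \<kappa>\<^sup>2 * (real c * (\<Sum>i\<in>I. (q i)\<^sup>2))"
      using sum_cluster_pairs_le(2)[OF c, of "\<lambda>i. (q i)\<^sup>2"] by (intro mult_left_mono) auto
    finally show "(\<Sum>z\<in>I\<times>I. (b z)\<^sup>2) \<le> \<kappa>\<^sup>2 * (real c * (\<Sum>i\<in>I. (q i)\<^sup>2))" .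
  qed (auto intro!: sum_nonneg mult_nonneg_nonneg)
  also have "\<dots> = (\<kappa> * real c)\<^sup>2 * ((\<Sum>i\<in>I. (p i)\<^sup>2) * (\<Sum>i\<in>I. (q i)\<^sup>2))"
    by (simp add: power_mult_distrib power2_eq_square mult_ac)
  finally show ?thesis .
qed simp

end

section \<open>Outer products and the design matrix\<close>

lemma norm_outer: "norm (outer a b) = norm a * norm b"
proof -
  have "norm (outer a b) = L2_set (\<lambda>i. norm (vec_nth a i *\<^sub>R b)) UNIV"
    unfolding norm_vec_def[of "outer a b"]
    by (intro L2_set_cong refl arg_cong[of _ _ norm]) (simp add: outer_def Finite_Cartesian_Product.vec_eq_iff)
  also have "\<dots> = L2_set (\<lambda>i. norm (vec_nth a i) * norm b) UNIV" by simp
  also have "\<dots> = norm a * norm b" by (simp add: L2_set_left_distrib norm_vec_def[of a])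
  finally show ?thesis .
qed

lemma outer_mult_vec: "outer v v *v a = (v \<bullet> a) *\<^sub>R v"
  by (simp add: Finite_Cartesian_Product.vec_eq_iff outer_def matrix_vector_mult_def inner_vec_def sum_distrib_left mult_ac)

lemma sum_matrix_vector_mult: "(\<Sum>i\<in>I. A i) *v x = (\<Sum>i\<in>I. A i *v (x :: real^'n))"
  by (induction I rule: infinite_finite_induct) (simp_all add: matrix_vector_mult_add_rdistrib)

lemma norm_matrix_le_sum_entries:
  fixes A :: "real^'n^'m"
  shows "norm A \<le> (\<Sum>a\<in>UNIV. \<Sum>b\<in>UNIV. \<bar>vec_nth (vec_nth A a) b\<bar>)"
proof -
  have "norm A \<le> (\<Sum>a\<in>UNIV. norm (vec_nth A a))"
    unfolding norm_vec_def[of A] by (intro L2_set_le_sum) auto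
  also have "\<dots> \<le> (\<Sum>a\<in>UNIV. \<Sum>b\<in>UNIV. \<bar>vec_nth (vec_nth A a) b\<bar>)"
    by (intro sum_mono norm_le_l1_cart)
  finally show ?thesis .
qed

text \<open>The design matrix inherits a lower bound from the conditional variance of the score:
  for \<open>b = inverse S *v a\<close> one has \<open>|a|^2 = a' S b\<close>, which \<open>bil\<close> bounds by the quadratic
  forms of the design in \<open>a\<close> and \<open>b\<close>.\<close>

lemma design_lower_bound:
  fixes S :: "real^'d^'d" and v :: "'i \<Rightarrow> real^'d"
  assumes inv: "invertible S" and C2: "norm (matrix_inv S) \<le> C2"
    and fin: "finite I" and n: "0 < n" and tr: "(\<Sum>i\<in>I. (norm (v i))\<^sup>2) \<le> C1 * n"
    and bil: "\<And>p q. (n * (p \<bullet> (S *v q)))\<^sup>2 \<le> K2 * ((\<Sum>i\<in>I. (p \<bullet> v i)\<^sup>2) * (\<Sum>i\<in>I. (q \<bullet> v i)\<^sup>2))"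
    and K2: "K2 \<ge> 0"
  shows "n * (norm a)\<^sup>2 \<le> K2 * C1 * C2\<^sup>2 * (\<Sum>i\<in>I. (a \<bullet> v i)\<^sup>2)"
proof (cases "a = 0")
  case False
  define b where "b = matrix_inv S *v a"
  have C20: "C2 \<ge> 0" using C2 norm_ge_zero order_trans by blast
  have Sb: "S *v b = a"
    using matrix_inv_mult[OF inv] by (simp add: b_def matrix_vector_mul_assoc)
  have nb: "norm b \<le> C2 * norm a"
    using norm_matrix_vector_mult_le[of "matrix_inv S" a] mult_right_mono[OF C2, of "norm a"]
    by (simp add: b_def)
  have "(\<Sum>i\<in>I. (b \<bullet> v i)\<^sup>2) \<le> (\<Sum>i\<in>I. (norm b)\<^sup>2 * (norm (v i))\<^sup>2)"
  proof (rule sum_mono)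
    fix i
    have "\<bar>b \<bullet> v i\<bar>\<^sup>2 \<le> (norm b * norm (v i))\<^sup>2" by (intro power_mono Cauchy_Schwarz_ineq2) simp
    then show "(b \<bullet> v i)\<^sup>2 \<le> (norm b)\<^sup>2 * (norm (v i))\<^sup>2" by (simp add: power_mult_distrib)
  qed
  also have "\<dots> = (norm b)\<^sup>2 * (\<Sum>i\<in>I. (norm (v i))\<^sup>2)" by (simp add: sum_distrib_left)
  also have "\<dots> \<le> (C2 * norm a)\<^sup>2 * (C1 * n)"
    using nb tr by (intro mult_mono power_mono) (auto intro!: sum_nonneg)
  finally have bb: "(\<Sum>i\<in>I. (b \<bullet> v i)\<^sup>2) \<le> (C2 * norm a)\<^sup>2 * (C1 * n)" .
  have "(n * (norm a)\<^sup>2)\<^sup>2 = (n * (a \<bullet> (S *v b)))\<^sup>2" by (simp add: Sb power2_norm_eq_inner)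
  also have "\<dots> \<le> K2 * ((\<Sum>i\<in>I. (a \<bullet> v i)\<^sup>2) * (\<Sum>i\<in>I. (b \<bullet> v i)\<^sup>2))" by (rule bil)
  also have "\<dots> \<le> K2 * ((\<Sum>i\<in>I. (a \<bullet> v i)\<^sup>2) * ((C2 * norm a)\<^sup>2 * (C1 * n)))"
    using bb K2 by (intro mult_left_mono) (auto intro!: sum_nonneg)
  also have "\<dots> = (n * (norm a)\<^sup>2) * (K2 * C1 * C2\<^sup>2 * (\<Sum>i\<in>I. (a \<bullet> v i)\<^sup>2))"
    by (simp add: power_mult_distrib mult_ac)
  finally have "(n * (norm a)\<^sup>2) * (n * (norm a)\<^sup>2) \<le> (n * (norm a)\<^sup>2) * (K2 * C1 * C2\<^sup>2 * (\<Sum>i\<in>I. (a \<bullet> v i)\<^sup>2))"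
    by (simp only: power2_eq_square)
  moreover have "0 < n * (norm a)\<^sup>2" using n False by simp
  ultimately show ?thesis by (rule mult_left_le_imp_le)
qed simp

text \<open>The quadratic form of the matrix in \<open>a\<close> is the sum of the squares of
  \<open>a \<bullet> v i\<close>, so the lower bound leaves only zero in the kernel.\<close>

lemma invertible_sum_outer:
  fixes v :: "'i \<Rightarrow> real^'d"
  assumes lb: "\<And>a. n * (norm a)\<^sup>2 \<le> \<rho> * (\<Sum>i\<in>I. (a \<bullet> v i)\<^sup>2)" and n: "n > 0"
  shows "invertible (\<Sum>i\<in>I. outer (v i) (v i))"
  unfolding invertible_left_inverse matrix_left_invertible_ker
proof (intro allI impI)
  fix a assume "(\<Sum>i\<in>I. outer (v i) (v i)) *v a = 0"
  then have "0 = a \<bullet> (\<Sum>i\<in>I. (v i \<bullet> a) *\<^sub>R v i)"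
    by (simp add: sum_matrix_vector_mult outer_mult_vec)
  also have "\<dots> = (\<Sum>i\<in>I. (a \<bullet> v i)\<^sup>2)"
    by (simp add: inner_sum_right power2_eq_square inner_commute)
  finally have "n * (norm a)\<^sup>2 \<le> 0" using lb[of a] by simp
  then show "a = 0" using n by (simp add: mult_le_0_iff)
qed

section \<open>The error of the least squares slope\<close>

text \<open>The normal equations. In the cross products of the outcome with v the covariates vanish
  and x may be replaced by v, because M is a symmetric projection that annihilates w; only \<delta>
  and the errors remain. Invertibility turns \<open>beta_hat\<close> into a solution of these
  equations.\<close>

lemma beta_hat_error:
  fixes x :: "nat \<Rightarrow> 'a \<Rightarrow> real^'d"
  assumes det: "det (gram n K w \<omega>) \<noteq> 0"
    and y: "\<And>i. i \<in> {1..n} \<Longrightarrow> y i \<omega> = inner \<beta> (x i \<omega>) + (\<Sum>k<K. \<gamma> k * w i \<omega> k) + u i \<omega>"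
    and inv: "invertible (\<Sum>i=1..n. outer (v_hat n K w x i \<omega>) (v_hat n K w x i \<omega>))"
  defines "\<delta> \<equiv> beta_hat n K w x y \<omega> - \<beta>"
  shows score_eq: "(\<Sum>i=1..n. (v_hat n K w x i \<omega> \<bullet> \<delta>) *\<^sub>R v_hat n K w x i \<omega>) = (\<Sum>i=1..n. u i \<omega> *\<^sub>R v_hat n K w x i \<omega>)"
    and u_hat_eq: "i \<in> {1..n} \<Longrightarrow>
      u_hat n K w x y i \<omega> = (\<Sum>j=1..n. resid_mat n K w i j \<omega> * u j \<omega>) - \<delta> \<bullet> v_hat n K w x i \<omega>"
proof -
  let ?v = "\<lambda>i. v_hat n K w x i \<omega>" and ?M = "\<lambda>i j. resid_mat n K w i j \<omega>"
  have P: "projection_on {1..n} ?M" by (rule projection_on_resid_mat[OF det])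
  have idem: "(\<Sum>j=1..n. ?M i j * ?M j k) = ?M i k" if "i \<in> {1..n}" "k \<in> {1..n}" for i k
    using P that unfolding projection_on_def by blast
  \<comment> \<open>Partialling out a second time changes nothing, by idempotence of M.\<close>
  have Mv: "(\<Sum>i=1..n. ?M j i *\<^sub>R ?v i) = ?v j" if j: "j \<in> {1..n}" for j
  proof -
    have "(\<Sum>i=1..n. ?M j i *\<^sub>R ?v i) = (\<Sum>i=1..n. \<Sum>k=1..n. (?M j i * ?M i k) *\<^sub>R x k \<omega>)"
      by (simp add: v_hat_def scaleR_sum_right)
    also have "\<dots> = (\<Sum>k=1..n. (\<Sum>i=1..n. ?M j i * ?M i k) *\<^sub>R x k \<omega>)"
      by (subst sum.swap) (simp add: scaleR_sum_left)
    also have "\<dots> = ?v j" using idem[OF j] by (simp add: v_hat_def)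
    finally show ?thesis .
  qed
  have wv: "(\<Sum>i=1..n. w i \<omega> k *\<^sub>R ?v i) = 0" if k: "k < K" for k
  proof -
    have "(\<Sum>i=1..n. w i \<omega> k *\<^sub>R ?v i) = (\<Sum>i=1..n. \<Sum>j=1..n. (?M j i * w i \<omega> k) *\<^sub>R x j \<omega>)"
      unfolding v_hat_def scaleR_sum_right scaleR_scaleR
      by (intro sum.cong refl) (simp only: resid_mat_sym[OF det, of _ _] mult.commute)
    also have "\<dots> = (\<Sum>j=1..n. (\<Sum>i=1..n. ?M j i * w i \<omega> k) *\<^sub>R x j \<omega>)"
      by (subst sum.swap) (simp add: scaleR_sum_left)
    also have "\<dots> = 0" using resid_mat_annihilates[OF det _ k] by (intro sum.neutral ballI) simp
    finally show ?thesis .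
  qed
  have v_inner: "?v i \<bullet> \<beta> = (\<Sum>j=1..n. (\<beta> \<bullet> x j \<omega>) * ?M i j)" for i
    unfolding v_hat_def inner_sum_left by (simp add: inner_commute mult.commute)
  \<comment> \<open>Symmetry moves M from x to v, where it acts as the identity.\<close>
  have xv: "(\<Sum>i=1..n. (\<beta> \<bullet> x i \<omega>) *\<^sub>R ?v i) = (\<Sum>i=1..n. (?v i \<bullet> \<beta>) *\<^sub>R ?v i)"
  proof -
    have "(\<Sum>i=1..n. (?v i \<bullet> \<beta>) *\<^sub>R ?v i) = (\<Sum>i=1..n. \<Sum>j=1..n. ((\<beta> \<bullet> x j \<omega>) * ?M i j) *\<^sub>R ?v i)"
      by (simp only: v_inner scaleR_sum_left)
    also have "\<dots> = (\<Sum>j=1..n. \<Sum>i=1..n. (\<beta> \<bullet> x j \<omega>) *\<^sub>R (?M j i *\<^sub>R ?v i))"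
      by (subst sum.swap) (intro sum.cong refl, simp add: resid_mat_sym[OF det])
    also have "\<dots> = (\<Sum>j=1..n. (\<beta> \<bullet> x j \<omega>) *\<^sub>R ?v j)"
      by (intro sum.cong refl) (simp only: scaleR_sum_right[symmetric] Mv)
    finally show ?thesis by simp
  qed
  let ?\<Gamma> = "\<Sum>i=1..n. outer (?v i) (?v i)"
  have "(\<Sum>i=1..n. y i \<omega> *\<^sub>R ?v i) = (\<Sum>i=1..n. (\<beta> \<bullet> x i \<omega>) *\<^sub>R ?v i)
     + (\<Sum>i=1..n. (\<Sum>k<K. \<gamma> k * w i \<omega> k) *\<^sub>R ?v i) + (\<Sum>i=1..n. u i \<omega> *\<^sub>R ?v i)"
    using y by (simp add: scaleR_add_left sum.distrib)
  also have "(\<Sum>i=1..n. (\<Sum>k<K. \<gamma> k * w i \<omega> k) *\<^sub>R ?v i) = (\<Sum>k<K. \<gamma> k *\<^sub>R (\<Sum>i=1..n. w i \<omega> k *\<^sub>R ?v i))"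
    unfolding scaleR_sum_left scaleR_sum_right scaleR_scaleR by (rule sum.swap)
  also have "\<dots> = 0" using wv by (intro sum.neutral ballI) simp
  finally have s: "(\<Sum>i=1..n. y i \<omega> *\<^sub>R ?v i) = ?\<Gamma> *v \<beta> + (\<Sum>i=1..n. u i \<omega> *\<^sub>R ?v i)"
    using xv by (simp add: sum_matrix_vector_mult outer_mult_vec)
  have "?\<Gamma> *v beta_hat n K w x y \<omega> = (\<Sum>i=1..n. y i \<omega> *\<^sub>R ?v i)"
    unfolding beta_hat_def using matrix_inv_mult[OF inv] by (simp add: matrix_vector_mul_assoc)
  then have "?\<Gamma> *v \<delta> = (\<Sum>i=1..n. u i \<omega> *\<^sub>R ?v i)"
    unfolding \<delta>_def using s by (simp add: matrix_vector_mult_diff_distrib)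
  then show "(\<Sum>i=1..n. (?v i \<bullet> \<delta>) *\<^sub>R ?v i) = (\<Sum>i=1..n. u i \<omega> *\<^sub>R ?v i)"
    by (simp add: sum_matrix_vector_mult outer_mult_vec)
  show "u_hat n K w x y i \<omega> = (\<Sum>j=1..n. ?M i j * u j \<omega>) - \<delta> \<bullet> ?v i" if i: "i \<in> {1..n}"
  proof -
    have "u_hat n K w x y i \<omega> = (\<Sum>j=1..n. ?M i j * ((\<Sum>k<K. \<gamma> k * w j \<omega> k) + (u j \<omega> - \<delta> \<bullet> x j \<omega>)))"
      unfolding u_hat_def using y by (intro sum.cong refl) (simp add: \<delta>_def inner_diff_left)
    also have "\<dots> = (\<Sum>j=1..n. ?M i j * (\<Sum>k<K. \<gamma> k * w j \<omega> k)) + (\<Sum>j=1..n. ?M i j * u j \<omega>)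
        - (\<Sum>j=1..n. ?M i j * (\<delta> \<bullet> x j \<omega>))"
      by (simp add: distrib_left right_diff_distrib sum.distrib sum_subtractf)
    also have "(\<Sum>j=1..n. ?M i j * (\<Sum>k<K. \<gamma> k * w j \<omega> k)) = (\<Sum>k<K. \<gamma> k * (\<Sum>j=1..n. ?M i j * w j \<omega> k))"
      unfolding sum_distrib_left by (subst sum.swap) (simp add: mult_ac)
    also have "\<dots> = 0" using resid_mat_annihilates[OF det i] by (intro sum.neutral ballI) simp
    also have "(\<Sum>j=1..n. ?M i j * (\<delta> \<bullet> x j \<omega>)) = \<delta> \<bullet> ?v i"
      by (simp add: v_hat_def inner_sum_right)
    finally show ?thesis by simp
  qed
qed

text \<open>The inner product of the normal equations with \<delta> is the quadratic form on the
  right of \<open>lb\<close>; Cauchy-Schwarz and division by the norm of \<delta> finish.\<close>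

lemma norm_error_le:
  fixes v :: "'i \<Rightarrow> real^'d"
  assumes lb: "n * (norm \<delta>)\<^sup>2 \<le> \<rho> * (\<Sum>i\<in>I. (\<delta> \<bullet> v i)\<^sup>2)" and \<rho>: "\<rho> \<ge> 0"
    and score: "(\<Sum>i\<in>I. (v i \<bullet> \<delta>) *\<^sub>R v i) = s"
  shows "n * norm \<delta> \<le> \<rho> * norm s"
proof (cases "\<delta> = 0")
  case False
  have "(\<Sum>i\<in>I. (\<delta> \<bullet> v i)\<^sup>2) = \<delta> \<bullet> s"
    by (simp add: score[symmetric] inner_sum_right power2_eq_square inner_commute)
  also have "\<dots> \<le> norm \<delta> * norm s" by (rule norm_cauchy_schwarz)
  finally have "norm \<delta> * (n * norm \<delta>) \<le> norm \<delta> * (\<rho> * norm s)"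
    using lb mult_left_mono[of "(\<Sum>i\<in>I. (\<delta> \<bullet> v i)\<^sup>2)" "norm \<delta> * norm s" \<rho>] \<rho>
    by (simp add: power2_eq_square mult_ac)
  then show ?thesis using False by simp
qed (use \<rho> in simp)

section \<open>Replacement of the residuals and the weights of the quadratic form\<close>

context cluster_partition
begin

text \<open>The error \<open>e\<close> is uniformly small but \<open>\<upsilon>\<close> has no
  uniform bound. In the cross terms \<open>\<upsilon> i\<close> is therefore kept together with the
  norm of \<open>v i\<close>, and only the sum of the squares of these products enters.\<close>

lemma clustered_outer_perturbation:
  fixes v :: "nat \<Rightarrow> real^'d" and e \<upsilon> :: "nat \<Rightarrow> real"
  assumes c: "\<And>i. i \<in> I \<Longrightarrow> card {j\<in>I. cl j = cl i} \<le> c"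
    and e: "\<And>i. i \<in> I \<Longrightarrow> \<bar>e i\<bar> \<le> q" and q: "q \<ge> 0" and n: "n > 0"
    and C1: "(\<Sum>i\<in>I. (norm (v i))\<^sup>2) \<le> C1 * n"
    and R: "(\<Sum>i\<in>I. (norm (v i) * \<upsilon> i)\<^sup>2) \<le> R * n"
  shows "norm ((1 / n) *\<^sub>R (\<Sum>g=1..G. \<Sum>i\<in>T g. \<Sum>j\<in>T g. ((\<upsilon> i - e i) * (\<upsilon> j - e j)) *\<^sub>R outer (v i) (v j))
     - (1 / n) *\<^sub>R (\<Sum>g=1..G. \<Sum>i\<in>T g. \<Sum>j\<in>T g. (\<upsilon> i * \<upsilon> j) *\<^sub>R outer (v i) (v j)))
    \<le> real c * (q * (R + C1) + q\<^sup>2 * C1)"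
proof -
  \<comment> \<open>Collects the terms with index \<open>i\<close> once every product is bounded by
    half a sum of two squares; \<open>h i + h j\<close> then dominates the summand for the pair (i,
    j).\<close>
  define h where "h i = q / 2 * ((norm (v i) * \<upsilon> i)\<^sup>2 + (norm (v i))\<^sup>2) + q\<^sup>2 / 2 * (norm (v i))\<^sup>2" for i
  define z where "z i j = (\<upsilon> i - e i) * (\<upsilon> j - e j) - \<upsilon> i * \<upsilon> j" for i j
  have z: "\<bar>z i j\<bar> * (norm (v i) * norm (v j)) \<le> h i + h j" if ij: "i \<in> I" "j \<in> I" for i j
  proof -
    let ?r = "norm (v i)" and ?s = "norm (v j)"
    have "\<bar>z i j\<bar> \<le> \<bar>\<upsilon> i\<bar> * \<bar>e j\<bar> + \<bar>e i\<bar> * \<bar>\<upsilon> j\<bar> + \<bar>e i\<bar> * \<bar>e j\<bar>"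
      unfolding z_def by (simp add: algebra_simps flip: abs_mult)
    also have "\<dots> \<le> \<bar>\<upsilon> i\<bar> * q + q * \<bar>\<upsilon> j\<bar> + q * q"
      using e ij q by (intro add_mono mult_mono) auto
    finally have "\<bar>z i j\<bar> * (?r * ?s) \<le> (\<bar>\<upsilon> i\<bar> * q + q * \<bar>\<upsilon> j\<bar> + q * q) * (?r * ?s)"
      by (intro mult_right_mono) auto
    also have "\<dots> = q * ((?r * \<bar>\<upsilon> i\<bar>) * ?s) + q * ((?s * \<bar>\<upsilon> j\<bar>) * ?r) + q\<^sup>2 * (?r * ?s)"
      by (simp add: algebra_simps power2_eq_square)
    also have "\<dots> \<le> q * (((?r * \<upsilon> i)\<^sup>2 + ?s\<^sup>2) / 2) + q * (((?s * \<upsilon> j)\<^sup>2 + ?r\<^sup>2) / 2) + q\<^sup>2 * ((?r\<^sup>2 + ?s\<^sup>2) / 2)"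
    proof (intro add_mono mult_left_mono)
      show "?r * \<bar>\<upsilon> i\<bar> * ?s \<le> ((?r * \<upsilon> i)\<^sup>2 + ?s\<^sup>2) / 2"
        using sum_squares_bound[of "?r * \<bar>\<upsilon> i\<bar>" ?s] by (simp add: power_mult_distrib)
      show "?s * \<bar>\<upsilon> j\<bar> * ?r \<le> ((?s * \<upsilon> j)\<^sup>2 + ?r\<^sup>2) / 2"
        using sum_squares_bound[of "?s * \<bar>\<upsilon> j\<bar>" ?r] by (simp add: power_mult_distrib)
      show "?r * ?s \<le> (?r\<^sup>2 + ?s\<^sup>2) / 2" using sum_squares_bound[of ?r ?s] by simp
    qed (use q in auto)
    also have "\<dots> = h i + h j" by (simp add: h_def field_simps)
    finally show ?thesis .
  qed
  have h0: "h i \<ge> 0" for i unfolding h_def using q by (intro add_nonneg_nonneg mult_nonneg_nonneg) auto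
  have "norm ((1 / n) *\<^sub>R (\<Sum>g=1..G. \<Sum>i\<in>T g. \<Sum>j\<in>T g. ((\<upsilon> i - e i) * (\<upsilon> j - e j)) *\<^sub>R outer (v i) (v j))
     - (1 / n) *\<^sub>R (\<Sum>g=1..G. \<Sum>i\<in>T g. \<Sum>j\<in>T g. (\<upsilon> i * \<upsilon> j) *\<^sub>R outer (v i) (v j)))
     = norm ((1 / n) *\<^sub>R (\<Sum>g=1..G. \<Sum>i\<in>T g. \<Sum>j\<in>T g. z i j *\<^sub>R outer (v i) (v j)))"
    by (simp add: z_def scaleR_diff_left sum_subtractf scaleR_diff_right)
  also have "\<dots> = (1 / n) * norm (\<Sum>i\<in>I. \<Sum>j\<in>I. if cl i = cl j then z i j *\<^sub>R outer (v i) (v j) else 0)"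
    unfolding sum_cluster_pairs using n by simp
  also have "\<dots> \<le> (1 / n) * (\<Sum>i\<in>I. \<Sum>j\<in>I. if cl i = cl j then h i + h j else 0)"
  proof (rule mult_left_mono)
    show "norm (\<Sum>i\<in>I. \<Sum>j\<in>I. if cl i = cl j then z i j *\<^sub>R outer (v i) (v j) else 0)
        \<le> (\<Sum>i\<in>I. \<Sum>j\<in>I. if cl i = cl j then h i + h j else 0)"
      by (rule sum_norm_le, rule sum_norm_le) (simp add: norm_outer z)
  qed (use n in simp)
  also have "(\<Sum>i\<in>I. \<Sum>j\<in>I. if cl i = cl j then h i + h j else 0)
      = (\<Sum>i\<in>I. \<Sum>j\<in>I. if cl i = cl j then h i else 0) + (\<Sum>i\<in>I. \<Sum>j\<in>I. if cl i = cl j then h j else 0)"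
    by (simp add: sum.distrib[symmetric]) (intro sum.cong refl, simp)
  also have "(1 / n) * \<dots> \<le> (1 / n) * (2 * (real c * (\<Sum>i\<in>I. h i)))"
    using sum_cluster_pairs_le[OF c, of h] h0 n by (intro mult_left_mono) auto
  also have "(\<Sum>i\<in>I. h i) = q / 2 * ((\<Sum>i\<in>I. (norm (v i) * \<upsilon> i)\<^sup>2) + (\<Sum>i\<in>I. (norm (v i))\<^sup>2)) + q\<^sup>2 / 2 * (\<Sum>i\<in>I. (norm (v i))\<^sup>2)"
    by (simp only: h_def sum.distrib sum_distrib_left[symmetric])
  also have "(1 / n) * (2 * (real c * (q / 2 * ((\<Sum>i\<in>I. (norm (v i) * \<upsilon> i)\<^sup>2) + (\<Sum>i\<in>I. (norm (v i))\<^sup>2)) + q\<^sup>2 / 2 * (\<Sum>i\<in>I. (norm (v i))\<^sup>2))))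
      \<le> (1 / n) * (2 * (real c * (q / 2 * (R * n + C1 * n) + q\<^sup>2 / 2 * (C1 * n))))"
    using R C1 q n by (intro mult_left_mono add_mono) auto
  also have "\<dots> = real c * (q * (R + C1) + q\<^sup>2 * C1)"
    using n by (simp add: field_simps)
  finally show ?thesis .
qed

text \<open>Entry (k, l) of M A M / n for the block diagonal A. The blocks are expressed by a
  condition on \<open>cl\<close>, so that \<open>projection_on_sandwich\<close> applies to sums over
  all of \<open>I\<close>.\<close>

definition sandwich :: "(nat \<Rightarrow> nat \<Rightarrow> real) \<Rightarrow> real \<Rightarrow> (nat \<Rightarrow> real^'d) \<Rightarrow> 'd \<Rightarrow> 'd \<Rightarrow> nat \<Rightarrow> nat \<Rightarrow> real" where
  "sandwich m n v a b k l = (\<Sum>i\<in>I. \<Sum>j\<in>I. m i k * (if cl i = cl j then vec_nth (v i) a * vec_nth (v j) b / n else 0) * m j l)"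

lemma sandwich_sum:
  "(\<Sum>i\<in>I. \<Sum>j\<in>I. if cl i = cl j then (\<Sum>k\<in>I. \<Sum>l\<in>I. m i k * m j l * f k l) * (vec_nth (v i) a * vec_nth (v j) b) / n else 0)
    = (\<Sum>k\<in>I. \<Sum>l\<in>I. sandwich m n v a b k l * f k l)"
proof -
  define A where "A i j = (if cl i = cl j then vec_nth (v i) a * vec_nth (v j) b / n else 0)" for i j
  have "(\<Sum>i\<in>I. \<Sum>j\<in>I. if cl i = cl j then (\<Sum>k\<in>I. \<Sum>l\<in>I. m i k * m j l * f k l) * (vec_nth (v i) a * vec_nth (v j) b) / n else 0)
     = (\<Sum>i\<in>I. \<Sum>j\<in>I. \<Sum>k\<in>I. \<Sum>l\<in>I. m i k * A i j * m j l * f k l)"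
    by (rule sum.cong[OF refl], rule sum.cong[OF refl])
       (simp add: A_def sum_distrib_left sum_divide_distrib mult_ac)
  also have "\<dots> = (\<Sum>i\<in>I. \<Sum>k\<in>I. \<Sum>j\<in>I. \<Sum>l\<in>I. m i k * A i j * m j l * f k l)"
    by (rule sum.cong[OF refl], rule sum.swap)
  also have "\<dots> = (\<Sum>k\<in>I. \<Sum>i\<in>I. \<Sum>l\<in>I. \<Sum>j\<in>I. m i k * A i j * m j l * f k l)"
    by (subst sum.swap) (rule sum.cong[OF refl], rule sum.cong[OF refl], rule sum.swap)
  also have "\<dots> = (\<Sum>k\<in>I. \<Sum>l\<in>I. \<Sum>i\<in>I. \<Sum>j\<in>I. m i k * A i j * m j l * f k l)"
    by (rule sum.cong[OF refl], rule sum.swap)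
  also have "\<dots> = (\<Sum>k\<in>I. \<Sum>l\<in>I. sandwich m n v a b k l * f k l)"
    by (simp only: sandwich_def A_def sum_distrib_right)
  finally show ?thesis .
qed

text \<open>After the contraction only the block entries remain. In the square of such an entry the
  factor with \<open>j\<close> is bounded by the maximum \<open>q * n\<close>, the factor with
  \<open>i\<close> is kept and summed, and the block size contributes \<open>c\<close>.\<close>

lemma sum_sandwich_square_le:
  assumes m: "projection_on I m" and n: "n > 0"
    and c: "\<And>i. i \<in> I \<Longrightarrow> card {j\<in>I. cl j = cl i} \<le> c"
    and C1: "(\<Sum>i\<in>I. (norm (v i))\<^sup>2) \<le> C1 * n"
    and q: "\<And>i. i \<in> I \<Longrightarrow> (norm (v i))\<^sup>2 \<le> q * n" and q0: "q \<ge> 0"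
  shows "(\<Sum>k\<in>I. \<Sum>l\<in>I. (sandwich m n v a b k l)\<^sup>2) \<le> real c * q * C1"
proof -
  have comp: "(vec_nth (v i) a)\<^sup>2 \<le> (norm (v i))\<^sup>2" for i a
    using component_le_norm_cart[of "v i" a] by (simp add: abs_le_square_iff[symmetric])
  have "(\<Sum>k\<in>I. \<Sum>l\<in>I. (sandwich m n v a b k l)\<^sup>2)
      \<le> (\<Sum>i\<in>I. \<Sum>j\<in>I. (if cl i = cl j then vec_nth (v i) a * vec_nth (v j) b / n else 0)\<^sup>2)"
    unfolding sandwich_def by (rule projection_on_sandwich[OF m])
  also have "\<dots> \<le> (\<Sum>i\<in>I. \<Sum>j\<in>I. if cl i = cl j then q / n * (norm (v i))\<^sup>2 else 0)"
  proof (intro sum_mono)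
    fix i j assume ij: "i \<in> I" "j \<in> I"
    have "(vec_nth (v i) a * vec_nth (v j) b / n)\<^sup>2 = (vec_nth (v i) a)\<^sup>2 * (vec_nth (v j) b)\<^sup>2 / n\<^sup>2"
      by (simp add: power_mult_distrib power_divide)
    also have "\<dots> \<le> (norm (v i))\<^sup>2 * (q * n) / n\<^sup>2"
      using comp[of i a] order_trans[OF comp[of j b] q[OF ij(2)]]
      by (intro divide_right_mono mult_mono) auto
    also have "\<dots> = q / n * (norm (v i))\<^sup>2" using n by (simp add: power2_eq_square)
    finally show "(if cl i = cl j then vec_nth (v i) a * vec_nth (v j) b / n else 0)\<^sup>2
       \<le> (if cl i = cl j then q / n * (norm (v i))\<^sup>2 else 0)" by simp
  qed
  also have "\<dots> \<le> real c * (\<Sum>i\<in>I. q / n * (norm (v i))\<^sup>2)"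
    using q0 n by (intro sum_cluster_pairs_le(1)[OF c]) auto
  also have "\<dots> = real c * (q / n) * (\<Sum>i\<in>I. (norm (v i))\<^sup>2)" by (simp add: sum_distrib_left mult_ac)
  also have "\<dots> \<le> real c * (q / n) * (C1 * n)" using C1 q0 n by (intro mult_left_mono) auto
  also have "\<dots> = real c * q * C1" using n by simp
  finally show ?thesis .
qed

text \<open>In the target the indices cross: \<open>m i1 j2\<close> stands beside
  \<open>m j1 i2\<close>. Symmetry of \<open>s\<close> undoes this, and since \<open>s\<close>
  vanishes between different clusters the sum over clusters extends to all pairs.\<close>

lemma clustered_entry_diff:
  fixes v :: "nat \<Rightarrow> real^'d"
  assumes s0: "\<And>i j. i \<in> I \<Longrightarrow> j \<in> I \<Longrightarrow> cl i \<noteq> cl j \<Longrightarrow> s i j = 0"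
    and s_sym: "\<And>i j. s i j = s j i"
  shows "vec_nth (vec_nth ((1 / n) *\<^sub>R (\<Sum>g=1..G. \<Sum>i\<in>T g. \<Sum>j\<in>T g.
        ((\<Sum>k\<in>I. m i k * u k) * (\<Sum>l\<in>I. m j l * u l)) *\<^sub>R outer (v i) (v j))
     - (1 / n) *\<^sub>R (\<Sum>g1=1..G. \<Sum>g2=1..G. \<Sum>i1\<in>T g1. \<Sum>j1\<in>T g1. \<Sum>i2\<in>T g2. \<Sum>j2\<in>T g2.
          (m i1 j2 * m j1 i2 * s i2 j2) *\<^sub>R outer (v i1) (v j1))) a) b
    = (\<Sum>k\<in>I. \<Sum>l\<in>I. sandwich m n v a b k l * (u k * u l - s k l))"
proof -
  have 1: "vec_nth (vec_nth ((1 / n) *\<^sub>R (\<Sum>g=1..G. \<Sum>i\<in>T g. \<Sum>j\<in>T g.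
        ((\<Sum>k\<in>I. m i k * u k) * (\<Sum>l\<in>I. m j l * u l)) *\<^sub>R outer (v i) (v j))) a) b
      = (\<Sum>k\<in>I. \<Sum>l\<in>I. sandwich m n v a b k l * (u k * u l))"
  proof -
    have "vec_nth (vec_nth ((1 / n) *\<^sub>R (\<Sum>g=1..G. \<Sum>i\<in>T g. \<Sum>j\<in>T g.
        ((\<Sum>k\<in>I. m i k * u k) * (\<Sum>l\<in>I. m j l * u l)) *\<^sub>R outer (v i) (v j))) a) b
      = (\<Sum>i\<in>I. \<Sum>j\<in>I. if cl i = cl j then (\<Sum>k\<in>I. \<Sum>l\<in>I. m i k * m j l * (u k * u l)) * (vec_nth (v i) a * vec_nth (v j) b) / n else 0)"
      unfolding sum_cluster_pairs
      by (simp add: sum_component if_distrib[of "\<lambda>x. vec_nth x _"] sum_divide_distrib if_distrib[of "\<lambda>x. x / _"]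
          outer_def sum_product mult_ac cong: if_cong)
    then show ?thesis by (simp only: sandwich_sum)
  qed
  have 2: "vec_nth (vec_nth ((1 / n) *\<^sub>R (\<Sum>g1=1..G. \<Sum>g2=1..G. \<Sum>i1\<in>T g1. \<Sum>j1\<in>T g1. \<Sum>i2\<in>T g2. \<Sum>j2\<in>T g2.
          (m i1 j2 * m j1 i2 * s i2 j2) *\<^sub>R outer (v i1) (v j1))) a) b
      = (\<Sum>k\<in>I. \<Sum>l\<in>I. sandwich m n v a b k l * s k l)"
  proof -
    have "(\<Sum>g1=1..G. \<Sum>g2=1..G. \<Sum>i1\<in>T g1. \<Sum>j1\<in>T g1. \<Sum>i2\<in>T g2. \<Sum>j2\<in>T g2.
          (m i1 j2 * m j1 i2 * s i2 j2) *\<^sub>R outer (v i1) (v j1))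
        = (\<Sum>g1=1..G. \<Sum>i1\<in>T g1. \<Sum>j1\<in>T g1. \<Sum>g2=1..G. \<Sum>i2\<in>T g2. \<Sum>j2\<in>T g2.
          (m i1 j2 * m j1 i2 * s i2 j2) *\<^sub>R outer (v i1) (v j1))"
      by (rule sum.cong[OF refl], subst sum.swap, rule sum.cong[OF refl], rule sum.swap)
    also have "\<dots> = (\<Sum>g1=1..G. \<Sum>i1\<in>T g1. \<Sum>j1\<in>T g1.
        (\<Sum>k\<in>I. \<Sum>l\<in>I. m i1 k * m j1 l * s k l) *\<^sub>R outer (v i1) (v j1))"
    proof (rule sum.cong[OF refl], rule sum.cong[OF refl], rule sum.cong[OF refl])
      fix i1 j1
      have "(\<Sum>g2=1..G. \<Sum>i2\<in>T g2. \<Sum>j2\<in>T g2. (m i1 j2 * m j1 i2 * s i2 j2) *\<^sub>R outer (v i1) (v j1))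
        = (\<Sum>l\<in>I. \<Sum>k\<in>I. (m i1 k * m j1 l * s l k) *\<^sub>R outer (v i1) (v j1))"
        unfolding sum_cluster_pairs using s0 by (intro sum.cong refl) simp
      also have "\<dots> = (\<Sum>k\<in>I. \<Sum>l\<in>I. m i1 k * m j1 l * s k l) *\<^sub>R outer (v i1) (v j1)"
        unfolding scaleR_sum_left by (subst sum.swap) (simp only: s_sym)
      finally show "(\<Sum>g2=1..G. \<Sum>i2\<in>T g2. \<Sum>j2\<in>T g2. (m i1 j2 * m j1 i2 * s i2 j2) *\<^sub>R outer (v i1) (v j1))
        = (\<Sum>k\<in>I. \<Sum>l\<in>I. m i1 k * m j1 l * s k l) *\<^sub>R outer (v i1) (v j1)" .
    qed
    finally have eq: "(\<Sum>g1=1..G. \<Sum>g2=1..G. \<Sum>i1\<in>T g1. \<Sum>j1\<in>T g1. \<Sum>i2\<in>T g2. \<Sum>j2\<in>T g2.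
          (m i1 j2 * m j1 i2 * s i2 j2) *\<^sub>R outer (v i1) (v j1)) = \<dots>" .
    have "vec_nth (vec_nth ((1 / n) *\<^sub>R (\<Sum>g1=1..G. \<Sum>i1\<in>T g1. \<Sum>j1\<in>T g1.
        (\<Sum>k\<in>I. \<Sum>l\<in>I. m i1 k * m j1 l * s k l) *\<^sub>R outer (v i1) (v j1))) a) b
      = (\<Sum>i\<in>I. \<Sum>j\<in>I. if cl i = cl j then (\<Sum>k\<in>I. \<Sum>l\<in>I. m i k * m j l * s k l) * (vec_nth (v i) a * vec_nth (v j) b) / n else 0)"
      unfolding sum_cluster_pairs
      by (simp add: sum_component if_distrib[of "\<lambda>x. vec_nth x _"] sum_divide_distrib if_distrib[of "\<lambda>x. x / _"]
          outer_def cong: if_cong)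
    then show ?thesis unfolding eq by (simp only: sandwich_sum)
  qed
  show ?thesis
    by (simp only: vector_minus_component 1 2 right_diff_distrib sum_subtractf)
qed

end

section \<open>Tail bounds for a fixed sample size\<close>

text \<open>Markov's inequality from a bound in \<open>ennreal\<close>, so that integrability of
  \<open>f\<close> is not presupposed; negative values of \<open>f\<close> become 0 and cannot reach
  the positive level \<open>t\<close>.\<close>

lemma (in prob_space) prob_ge_le_nn_integral:
  assumes [measurable]: "f \<in> borel_measurable M" and "t > 0" "K \<ge> 0"
    and int: "(\<integral>\<^sup>+\<omega>. ennreal (f \<omega>) \<partial>M) \<le> ennreal K"
  shows "prob {\<omega>\<in>space M. t \<le> f \<omega>} \<le> K / t"
proof -
  have "emeasure M ({\<omega>\<in>space M. 1 \<le> ennreal (1 / t) * ennreal (f \<omega>)} \<inter> space M)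
      \<le> ennreal (1 / t) * (\<integral>\<^sup>+\<omega>. ennreal (f \<omega>) * indicator (space M) \<omega> \<partial>M)"
    using nn_integral_Markov_inequality[of "\<lambda>\<omega>. ennreal (f \<omega>)" "space M" M "ennreal (1 / t)"]
    by simp
  also have "(\<integral>\<^sup>+\<omega>. ennreal (f \<omega>) * indicator (space M) \<omega> \<partial>M) = (\<integral>\<^sup>+\<omega>. ennreal (f \<omega>) \<partial>M)"
    by (rule nn_integral_cong) simp
  also have "ennreal (1 / t) * (\<integral>\<^sup>+\<omega>. ennreal (f \<omega>) \<partial>M) \<le> ennreal (1 / t) * ennreal K"
    by (intro mult_left_mono int) simp
  also have "\<dots> = ennreal (K / t)" using \<open>t > 0\<close> \<open>K \<ge> 0\<close> by (simp add: ennreal_mult[symmetric])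
  finally have 1: "emeasure M ({\<omega>\<in>space M. 1 \<le> ennreal (1 / t) * ennreal (f \<omega>)} \<inter> space M) \<le> ennreal (K / t)" .
  have "{\<omega>\<in>space M. 1 \<le> ennreal (1 / t) * ennreal (f \<omega>)} \<inter> space M = {\<omega>\<in>space M. t \<le> f \<omega>}"
  proof -
    have "1 \<le> ennreal (1 / t) * ennreal (f \<omega>) \<longleftrightarrow> t \<le> f \<omega>" for \<omega>
    proof (cases "f \<omega> \<ge> 0")
      case True
      then have "ennreal (1 / t) * ennreal (f \<omega>) = ennreal (f \<omega> / t)"
        using \<open>t > 0\<close> by (simp add: ennreal_mult[symmetric])
      then show ?thesis using \<open>t > 0\<close> True
        by (simp add: ennreal_1[symmetric] field_simps del: ennreal_1)
    qed (use \<open>t > 0\<close> in \<open>simp add: ennreal_neg\<close>)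
    then show ?thesis by auto
  qed
  then have "emeasure M {\<omega>\<in>space M. t \<le> f \<omega>} \<le> ennreal (K / t)" using 1 by simp
  then show ?thesis using \<open>t > 0\<close> \<open>K \<ge> 0\<close> by (simp add: emeasure_eq_measure)
qed

lemma (in prob_space) prob_ge_le_integral:
  assumes "integrable M f" "t > 0" "(\<integral>\<omega>. f \<omega> \<partial>M) \<le> K" "\<And>\<omega>. f \<omega> \<ge> (0::real)"
  shows "prob {\<omega>\<in>space M. t \<le> f \<omega>} \<le> K / t"
proof (rule prob_ge_le_nn_integral)
  have "0 \<le> (\<integral>\<omega>. f \<omega> \<partial>M)" using assms(4) by (rule Bochner_Integration.integral_nonneg)
  then show "K \<ge> 0" using assms(3) by simp
  show "(\<integral>\<^sup>+\<omega>. ennreal (f \<omega>) \<partial>M) \<le> ennreal K"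
    using assms by (subst nn_integral_eq_integral) (auto intro: ennreal_leI)
qed (use assms in auto)

text \<open>Terms with index outside \<open>I\<close> are set to zero, which makes the whole family
  integrable.\<close>

lemma (in sigma_finite_subalgebra) real_cond_exp_sum_on:
  fixes f :: "'i \<Rightarrow> 'a \<Rightarrow> real"
  assumes "\<And>i. i \<in> I \<Longrightarrow> integrable M (f i)"
  shows "AE \<omega> in M. real_cond_exp M F (\<lambda>\<omega>. \<Sum>i\<in>I. f i \<omega>) \<omega> = (\<Sum>i\<in>I. real_cond_exp M F (f i) \<omega>)"
proof -
  have "AE \<omega> in M. real_cond_exp M F (\<lambda>\<omega>. \<Sum>i\<in>I. if i \<in> I then f i \<omega> else 0) \<omega>
      = (\<Sum>i\<in>I. real_cond_exp M F (\<lambda>\<omega>. if i \<in> I then f i \<omega> else 0) \<omega>)"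
  proof (rule real_cond_exp_sum)
    show "integrable M (\<lambda>\<omega>. if i \<in> I then f i \<omega> else 0)" for i
      by (cases "i \<in> I") (simp_all add: assms)
  qed
  then show ?thesis by (simp cong: sum.cong)
qed

section \<open>Conditional means of linear and quadratic forms\<close>

context clustered_moments
begin

lemma weight_u_integrable:
  assumes b: "weight b" and i: "i \<in> I"
  shows "integrable M (\<lambda>\<omega>. b \<omega> * u i \<omega>)"
proof (rule integrable_of_square[OF weighted_second_moment(1)[OF assms]])
  show "(\<lambda>\<omega>. b \<omega> * u i \<omega>) \<in> borel_measurable M"
    using weight_M[OF b] u_meas[OF i] by measurable
qed

lemma cond_exp_linear_form:
  assumes b: "\<And>i. i \<in> I \<Longrightarrow> weight (b i)"
  shows "AE \<omega> in M. real_cond_exp M F (\<lambda>\<omega>. \<Sum>i\<in>I. b i \<omega> * u i \<omega>) \<omega> = 0"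
proof -
  have "AE \<omega> in M. real_cond_exp M F (\<lambda>\<omega>. b i \<omega> * u i \<omega>) \<omega> = 0" if i: "i \<in> I" for i
  proof -
    have "AE \<omega> in M. real_cond_exp M F (\<lambda>\<omega>. b i \<omega> * u i \<omega>) \<omega> = b i \<omega> * real_cond_exp M F (u i) \<omega>"
      by (rule F.real_cond_exp_mult[OF weight_F[OF b[OF i]] u_meas[OF i] weight_u_integrable[OF b[OF i] i]])
    then show ?thesis using mean0[OF i] by eventually_elim simp
  qed
  then have "AE \<omega> in M. \<forall>i\<in>I. real_cond_exp M F (\<lambda>\<omega>. b i \<omega> * u i \<omega>) \<omega> = 0"
    using fin_I by (intro AE_finite_allI) auto
  moreover have "AE \<omega> in M. real_cond_exp M F (\<lambda>\<omega>. \<Sum>i\<in>I. b i \<omega> * u i \<omega>) \<omega>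
      = (\<Sum>i\<in>I. real_cond_exp M F (\<lambda>\<omega>. b i \<omega> * u i \<omega>) \<omega>)"
    by (rule F.real_cond_exp_sum_on) (rule weight_u_integrable[OF b])
  ultimately show ?thesis by eventually_elim simp
qed

lemma cond_exp_quadratic_form:
  assumes b: "\<And>i j. i \<in> I \<Longrightarrow> j \<in> I \<Longrightarrow> weight (b i j)"
  shows "AE \<omega> in M. real_cond_exp M F (\<lambda>\<omega>. \<Sum>i\<in>I. \<Sum>j\<in>I. b i j \<omega> * (u i \<omega> * u j \<omega>)) \<omega>
    = (\<Sum>i\<in>I. \<Sum>j\<in>I. b i j \<omega> * cprod i j \<omega>)"
proof -
  define f where "f z \<omega> = b (fst z) (snd z) \<omega> * (u (fst z) \<omega> * u (snd z) \<omega>)" for z \<omega>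
  have int: "integrable M (f z)" if "z \<in> I \<times> I" for z
    using weight_uu_integrable[OF b, of "fst z" "snd z" "fst z" "snd z"] that by (auto simp: f_def[abs_def])
  have "AE \<omega> in M. real_cond_exp M F (f z) \<omega> = b (fst z) (snd z) \<omega> * cprod (fst z) (snd z) \<omega>"
    if z: "z \<in> I \<times> I" for z
    unfolding f_def[abs_def] cprod_def
  proof (rule F.real_cond_exp_mult)
    show "b (fst z) (snd z) \<in> borel_measurable F" using z by (intro weight_F b) auto
    show "(\<lambda>\<omega>. u (fst z) \<omega> * u (snd z) \<omega>) \<in> borel_measurable M"
      using z by (intro borel_measurable_times u_meas) auto
    show "integrable M (\<lambda>\<omega>. b (fst z) (snd z) \<omega> * (u (fst z) \<omega> * u (snd z) \<omega>))"
      using int[OF z] by (simp add: f_def[abs_def])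
  qed
  then have "AE \<omega> in M. \<forall>z\<in>I \<times> I. real_cond_exp M F (f z) \<omega> = b (fst z) (snd z) \<omega> * cprod (fst z) (snd z) \<omega>"
    using fin_I by (intro AE_finite_allI) auto
  moreover have "AE \<omega> in M. real_cond_exp M F (\<lambda>\<omega>. \<Sum>z\<in>I \<times> I. f z \<omega>) \<omega> = (\<Sum>z\<in>I \<times> I. real_cond_exp M F (f z) \<omega>)"
    by (rule F.real_cond_exp_sum_on[OF int])
  ultimately have "AE \<omega> in M. real_cond_exp M F (\<lambda>\<omega>. \<Sum>z\<in>I \<times> I. f z \<omega>) \<omega>
      = (\<Sum>z\<in>I \<times> I. b (fst z) (snd z) \<omega> * cprod (fst z) (snd z) \<omega>)"
    by eventually_elim (auto intro!: sum.cong)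
  then show ?thesis by (simp add: f_def sum.cartesian_product split_def)
qed

end

text \<open>Neither \<open>f\<close> nor \<open>g\<close> is assumed integrable. On the part of
  \<open>B\<close> where \<open>g\<close> and the conditional mean of \<open>f\<close> are at most
  \<open>N\<close> in absolute value, \<open>f\<close>, \<open>g\<close> and \<open>f - g\<close>
  all are; these parts exhaust \<open>B\<close> as \<open>N\<close> grows. The rule is used for x
  and its population regression on w.\<close>

lemma (in prob_space) real_cond_exp_diff_local:
  assumes sub: "subalgebra M F" and f [measurable]: "f \<in> borel_measurable M"
    and g [measurable]: "g \<in> borel_measurable F" and B [measurable]: "B \<in> sets F"
    and int: "integrable M (\<lambda>\<omega>. indicator B \<omega> * (f \<omega> - real_cond_exp M F f \<omega>))"
  shows "AE \<omega> in M. \<omega> \<in> B \<longrightarrow> real_cond_exp M F (\<lambda>\<omega>. f \<omega> - g \<omega>) \<omega> = real_cond_exp M F f \<omega> - g \<omega>"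
proof -
  interpret F: sigma_finite_subalgebra M F by (rule subalgebra_sigma_finite[OF sub])
  define m where "m = real_cond_exp M F f"
  have [measurable]: "m \<in> borel_measurable F" by (simp add: m_def)
  have [measurable]: "m \<in> borel_measurable M" "g \<in> borel_measurable M" "B \<in> sets M"
    using measurable_from_subalg[OF sub g] sub B by (auto simp: subalgebra_def m_def)
  have spF: "space F = space M" using sub by (simp add: subalgebra_def)
  define ind where "ind N \<omega> = (indicator {\<omega>\<in>space F. \<omega> \<in> B \<and> \<bar>m \<omega>\<bar> \<le> real N \<and> \<bar>g \<omega>\<bar> \<le> real N} \<omega> :: real)" for N :: nat and \<omega>
  have ind_F [measurable]: "ind N \<in> borel_measurable F" for N
    unfolding ind_def[abs_def] by measurable
  have ind_M [measurable]: "ind N \<in> borel_measurable M" for N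
    using measurable_from_subalg[OF sub ind_F] .
  have main: "AE \<omega> in M. ind N \<omega> * real_cond_exp M F (\<lambda>\<omega>. f \<omega> - g \<omega>) \<omega> = ind N \<omega> * (m \<omega> - g \<omega>)" for N
  proof -
    have i1: "integrable M (\<lambda>\<omega>. ind N \<omega> * (f \<omega> - m \<omega>))"
    proof (rule Bochner_Integration.integrable_bound[OF int])
      show "AE \<omega> in M. norm (ind N \<omega> * (f \<omega> - m \<omega>)) \<le> norm (indicator B \<omega> * (f \<omega> - real_cond_exp M F f \<omega>))"
        by (simp add: ind_def m_def indicator_def)
    qed measurable
    have i2: "integrable M (\<lambda>\<omega>. ind N \<omega> * m \<omega>)"
    proof (rule integrable_const_bound[where B = "real N"])
      show "AE \<omega> in M. norm (ind N \<omega> * m \<omega>) \<le> real N" by (simp add: ind_def indicator_def)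
    qed measurable
    have i3: "integrable M (\<lambda>\<omega>. ind N \<omega> * g \<omega>)"
    proof (rule integrable_const_bound[where B = "real N"])
      show "AE \<omega> in M. norm (ind N \<omega> * g \<omega>) \<le> real N" by (simp add: ind_def indicator_def)
    qed measurable
    \<comment> \<open>\<open>f\<close> is the sum of its deviation from the conditional mean,
      integrable on \<open>B\<close>, and of that mean, bounded after truncation.\<close>
    have i4: "integrable M (\<lambda>\<omega>. ind N \<omega> * f \<omega>)"
      using Bochner_Integration.integrable_add[OF i1 i2] by (simp add: right_diff_distrib)
    have i5: "integrable M (\<lambda>\<omega>. ind N \<omega> * (f \<omega> - g \<omega>))"
      using Bochner_Integration.integrable_diff[OF i4 i3] by (simp add: right_diff_distrib)
    have "AE \<omega> in M. real_cond_exp M F (\<lambda>\<omega>. ind N \<omega> * (f \<omega> - g \<omega>)) \<omega> = ind N \<omega> * real_cond_exp M F (\<lambda>\<omega>. f \<omega> - g \<omega>) \<omega>"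
      by (rule F.real_cond_exp_mult[OF ind_F _ i5]) measurable
    moreover have "AE \<omega> in M. real_cond_exp M F (\<lambda>\<omega>. ind N \<omega> * f \<omega>) \<omega> = ind N \<omega> * m \<omega>"
      unfolding m_def by (rule F.real_cond_exp_mult[OF ind_F f i4])
    moreover have "AE \<omega> in M. real_cond_exp M F (\<lambda>\<omega>. ind N \<omega> * g \<omega>) \<omega> = ind N \<omega> * g \<omega>"
      by (rule F.real_cond_exp_F_meas[OF i3]) measurable
    moreover have "AE \<omega> in M. real_cond_exp M F (\<lambda>\<omega>. ind N \<omega> * f \<omega> - ind N \<omega> * g \<omega>) \<omega>
       = real_cond_exp M F (\<lambda>\<omega>. ind N \<omega> * f \<omega>) \<omega> - real_cond_exp M F (\<lambda>\<omega>. ind N \<omega> * g \<omega>) \<omega>"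
      by (rule F.real_cond_exp_diff[OF i4 i3])
    ultimately show ?thesis
      by eventually_elim (simp add: right_diff_distrib)
  qed
  have "AE \<omega> in M. \<forall>N. ind N \<omega> * real_cond_exp M F (\<lambda>\<omega>. f \<omega> - g \<omega>) \<omega> = ind N \<omega> * (m \<omega> - g \<omega>)"
    unfolding AE_all_countable using main by blast
  then show ?thesis using AE_space
  proof eventually_elim
    case (elim \<omega>)
    show ?case
    proof
      assume B: "\<omega> \<in> B"
      obtain N :: nat where "max \<bar>m \<omega>\<bar> \<bar>g \<omega>\<bar> \<le> real N" using real_arch_simple by blast
      then have "ind N \<omega> = 1" using B elim(2) by (simp add: ind_def spF)
      then show "real_cond_exp M F (\<lambda>\<omega>. f \<omega> - g \<omega>) \<omega> = real_cond_exp M F f \<omega> - g \<omega>"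
        using elim(1)[rule_format, of N] by (simp add: m_def)
    qed
  qed
qed

section \<open>The mean square of the partialled-out regressors\<close>

lemma norm_square_eq_sum: "(norm (v :: real^'d))\<^sup>2 = (\<Sum>a\<in>UNIV. (vec_nth v a)\<^sup>2)"
  unfolding power2_norm_eq_inner inner_vec_def by (simp add: power2_eq_square)

lemma projection_on_contraction_vec:
  fixes z :: "'i \<Rightarrow> real^'d"
  assumes "projection_on I m"
  shows "(\<Sum>i\<in>I. (norm (\<Sum>j\<in>I. m i j *\<^sub>R z j))\<^sup>2) \<le> (\<Sum>i\<in>I. (norm (z i))\<^sup>2)"
proof -
  have "(\<Sum>i\<in>I. (norm (\<Sum>j\<in>I. m i j *\<^sub>R z j))\<^sup>2) = (\<Sum>a\<in>UNIV. \<Sum>i\<in>I. (\<Sum>j\<in>I. m i j * vec_nth (z j) a)\<^sup>2)"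
    unfolding norm_square_eq_sum by (subst sum.swap) (simp add: sum_component)
  also have "\<dots> \<le> (\<Sum>a\<in>UNIV. \<Sum>i\<in>I. (vec_nth (z i) a)\<^sup>2)"
    by (intro sum_mono projection_on_contraction[OF assms])
  also have "\<dots> = (\<Sum>i\<in>I. (norm (z i))\<^sup>2)"
    unfolding norm_square_eq_sum by (rule sum.swap)
  finally show ?thesis .
qed

text \<open>M annihilates the part of x that is linear in the covariates and contracts the rest;
  \<open>z\<close> and \<open>z'\<close> will be the conditional error V and the projection error
  Q.\<close>

lemma sum_v_hat_square_le:
  fixes x :: "nat \<Rightarrow> 'a \<Rightarrow> real^'d"
  assumes det: "det (gram n K w \<omega>) \<noteq> 0"
    and x: "\<And>j. j \<in> {1..n} \<Longrightarrow> x j \<omega> = z j + z' j + (\<Sum>k<K. \<Sum>l<K. (B k l * w j \<omega> l) *\<^sub>R c k)"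
  shows "(\<Sum>i=1..n. (norm (v_hat n K w x i \<omega>))\<^sup>2)
    \<le> 2 * (\<Sum>i=1..n. (norm (z i))\<^sup>2) + 2 * (\<Sum>i=1..n. (norm (z' i))\<^sup>2)"
proof -
  let ?M = "\<lambda>i j. resid_mat n K w i j \<omega>"
  have v: "v_hat n K w x i \<omega> = (\<Sum>j=1..n. ?M i j *\<^sub>R (z j + z' j))" if i: "i \<in> {1..n}" for i
  proof -
    have "(\<Sum>j=1..n. ?M i j *\<^sub>R (\<Sum>k<K. \<Sum>l<K. (B k l * w j \<omega> l) *\<^sub>R c k))
        = (\<Sum>j=1..n. \<Sum>k<K. \<Sum>l<K. (B k l * (?M i j * w j \<omega> l)) *\<^sub>R c k)"
      by (simp add: scaleR_sum_right mult_ac)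
    also have "\<dots> = (\<Sum>k<K. \<Sum>l<K. \<Sum>j=1..n. (B k l * (?M i j * w j \<omega> l)) *\<^sub>R c k)"
      by (subst sum.swap) (rule sum.cong[OF refl], rule sum.swap)
    also have "\<dots> = (\<Sum>k<K. \<Sum>l<K. (B k l * (\<Sum>j=1..n. ?M i j * w j \<omega> l)) *\<^sub>R c k)"
      by (simp only: sum_distrib_left scaleR_sum_left)
    also have "\<dots> = 0"
      using resid_mat_annihilates[OF det i] by (intro sum.neutral ballI) simp
    finally have 0: "(\<Sum>j=1..n. ?M i j *\<^sub>R (\<Sum>k<K. \<Sum>l<K. (B k l * w j \<omega> l) *\<^sub>R c k)) = 0" .
    have "v_hat n K w x i \<omega> = (\<Sum>j=1..n. ?M i j *\<^sub>R (z j + z' j) + ?M i j *\<^sub>R (\<Sum>k<K. \<Sum>l<K. (B k l * w j \<omega> l) *\<^sub>R c k))"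
      unfolding v_hat_def using x by (intro sum.cong refl) (simp only: scaleR_add_right)
    then show ?thesis using 0 by (simp only: sum.distrib) simp
  qed
  have "(\<Sum>i=1..n. (norm (v_hat n K w x i \<omega>))\<^sup>2) = (\<Sum>i=1..n. (norm (\<Sum>j=1..n. ?M i j *\<^sub>R (z j + z' j)))\<^sup>2)"
    using v by (intro sum.cong refl) simp
  also have "\<dots> \<le> (\<Sum>i=1..n. (norm (z i + z' i))\<^sup>2)"
    by (rule projection_on_contraction_vec[OF projection_on_resid_mat[OF det]])
  also have "\<dots> \<le> (\<Sum>i=1..n. 2 * (norm (z i))\<^sup>2 + 2 * (norm (z' i))\<^sup>2)"
  proof (rule sum_mono)
    fix i
    have "(norm (z i + z' i))\<^sup>2 \<le> (norm (z i) + norm (z' i))\<^sup>2"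
      by (intro power_mono norm_triangle_ineq) simp
    also have "\<dots> \<le> 2 * (norm (z i))\<^sup>2 + 2 * (norm (z' i))\<^sup>2"
      using zero_le_power2[of "norm (z i) - norm (z' i)"] unfolding power2_diff power2_sum by linarith
    finally show "(norm (z i + z' i))\<^sup>2 \<le> 2 * (norm (z i))\<^sup>2 + 2 * (norm (z' i))\<^sup>2" .
  qed
  also have "\<dots> = 2 * (\<Sum>i=1..n. (norm (z i))\<^sup>2) + 2 * (\<Sum>i=1..n. (norm (z' i))\<^sup>2)"
    by (simp only: sum.distrib sum_distrib_left)
  finally show ?thesis .
qed

lemma cond_exp_vec_measurable:
  fixes f :: "'a \<Rightarrow> real^'d"
  shows "cond_exp_vec M F f \<in> borel_measurable F" "cond_exp_vec M F f \<in> borel_measurable M"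
  by (rule vec_measurable, simp add: cond_exp_vec_def)+

lemma (in prob_space) mean_square_projection_error:
  fixes x :: "nat \<Rightarrow> 'a \<Rightarrow> real^'d"
  assumes n: "n > 0" and c0: "c0 \<ge> 0" and chi: "chi_n M n K w x \<le> ennreal c0"
  shows "(\<integral>\<^sup>+\<omega>. ennreal ((\<Sum>i=1..n. (norm (Q_proj M n K w x i \<omega>))\<^sup>2) / real n) \<partial>M) \<le> ennreal c0"
proof -
  let ?Q = "Q_proj M n K w x"
  have [measurable]: "?Q i \<in> borel_measurable M" for i
    unfolding Q_proj_def by (rule cond_exp_vec_measurable)
  have inv: "ennreal (1 / real n) = inverse (of_nat n)"
    using n by (simp add: ennreal_of_nat_eq_real_of_nat inverse_ennreal inverse_eq_divide)
  have "(\<integral>\<^sup>+\<omega>. ennreal ((\<Sum>i=1..n. (norm (?Q i \<omega>))\<^sup>2) / real n) \<partial>M)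
      = (\<integral>\<^sup>+\<omega>. ennreal (1 / real n) * (\<Sum>i=1..n. ennreal ((norm (?Q i \<omega>))\<^sup>2)) \<partial>M)"
    by (intro nn_integral_cong) (simp add: sum_nonneg ennreal_mult[symmetric] sum_ennreal)
  also have "\<dots> = ennreal (1 / real n) * (\<integral>\<^sup>+\<omega>. (\<Sum>i=1..n. ennreal ((norm (?Q i \<omega>))\<^sup>2)) \<partial>M)"
    by (rule nn_integral_cmult) measurable
  also have "(\<integral>\<^sup>+\<omega>. (\<Sum>i=1..n. ennreal ((norm (?Q i \<omega>))\<^sup>2)) \<partial>M) = (\<Sum>i=1..n. \<integral>\<^sup>+\<omega>. ennreal ((norm (?Q i \<omega>))\<^sup>2) \<partial>M)"
    by (rule nn_integral_sum) measurable
  also have "ennreal (1 / real n) * \<dots> = chi_n M n K w x"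
    by (simp add: chi_n_def inv divide_ennreal_def mult.commute)
  finally show ?thesis using chi by simp
qed

text \<open>x is V + Q plus a part linear in w. Truncated to the event where its conditional fourth
  moments are bounded, the mean square of V has expectation at most 1 + \<open>C\<close>; that of Q
  has expectation at most \<open>c0\<close>. If the sum exceeds 4 t n, one of the two is at least
  \<open>t\<close>. The decomposition holds only almost surely, hence a measurable set
  \<open>D\<close> and an inclusion up to a null set.\<close>

lemma (in prob_space) sum_v_hat_square_tail:
  fixes x :: "nat \<Rightarrow> 'a \<Rightarrow> real^'d"
  assumes x_meas: "\<And>i. i \<in> {1..n} \<Longrightarrow> x i \<in> borel_measurable M"
    and w_meas: "\<And>i k. i \<in> {1..n} \<Longrightarrow> k < K \<Longrightarrow> (\<lambda>\<omega>. w i \<omega> k) \<in> borel_measurable M"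
    and n: "n > 0" and C: "C \<ge> 0" and c0: "c0 \<ge> 0" and t: "t > 0"
    and chi: "chi_n M n K w x \<le> ennreal c0"
  shows "\<exists>D\<in>sets M. prob D \<le> (1 + C + c0) / t \<and> (AE \<omega> in M. \<omega> \<in> {\<omega>\<in>space M. det (gram n K w \<omega>) \<noteq> 0
      \<and> (\<forall>i\<in>{1..n}. nn_cond_exp M (sigma_W M n K w) (\<lambda>\<omega>'. ennreal ((norm (V_err M n K w x i \<omega>')) ^ 4)) \<omega> \<le> ennreal C)
      \<and> 4 * t * real n < (\<Sum>i=1..n. (norm (v_hat n K w x i \<omega>))\<^sup>2)} \<longrightarrow> \<omega> \<in> D)"
    (is "\<exists>D\<in>_. _ \<and> (AE \<omega> in M. \<omega> \<in> ?E \<longrightarrow> _)")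
proof -
  define H where "H = sigma_W M n K w"
  let ?V = "V_err M n K w x" and ?Q = "Q_proj M n K w x"
  have H: "subalgebra M H" unfolding H_def
    by (rule subalgebra_sigma_W) (use w_meas in auto)
  interpret H: sigma_finite_subalgebra M H by (rule subalgebra_sigma_finite[OF H])
  have spH: "space H = space M" by (simp add: H_def)
  have V_meas: "?V i \<in> borel_measurable M" if "i \<in> {1..n}" for i
    unfolding V_err_def[abs_def]
    by (rule borel_measurable_diff[OF x_meas[OF that] cond_exp_vec_measurable(2)])
  have Q_meas [measurable]: "?Q i \<in> borel_measurable M" for i
    unfolding Q_proj_def by (rule cond_exp_vec_measurable)
  let ?N = "\<lambda>i. nn_cond_exp M H (\<lambda>\<omega>'. ennreal ((norm (?V i \<omega>')) ^ 4))"
  \<comment> \<open>Determined by W, so that its indicator can be moved through the conditional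
    expectation given W.\<close>
  define B where "B = {\<omega>\<in>space H. \<forall>i\<in>{1..n}. ?N i \<omega> \<le> ennreal C}"
  have B_H: "B \<in> sets H" unfolding B_def by measurable
  then have B_M: "B \<in> sets M" using H by (auto simp: subalgebra_def)
  note [measurable] = B_H B_M
  have fourth: "(\<integral>\<^sup>+\<omega>. indicator B \<omega> * ennreal ((norm (?V i \<omega>)) ^ 4) \<partial>M) \<le> ennreal C" if i: "i \<in> {1..n}" for i
  proof -
    note [measurable] = V_meas[OF i]
    have "(\<integral>\<^sup>+\<omega>. indicator B \<omega> * ennreal ((norm (?V i \<omega>)) ^ 4) \<partial>M) = (\<integral>\<^sup>+\<omega>. indicator B \<omega> * ?N i \<omega> \<partial>M)"
      by (rule H.nn_cond_exp_intg[symmetric]) measurable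
    also have "\<dots> \<le> (\<integral>\<^sup>+\<omega>. ennreal C \<partial>M)"
      using i by (intro nn_integral_mono) (auto simp: indicator_def B_def)
    finally show ?thesis by (simp add: emeasure_space_1)
  qed
  define f1 where "f1 \<omega> = indicator B \<omega> * ((\<Sum>i=1..n. (norm (?V i \<omega>))\<^sup>2) / real n)" for \<omega>
  have f1_meas [measurable]: "f1 \<in> borel_measurable M"
  proof -
    have "(\<lambda>\<omega>. \<Sum>i=1..n. (norm (?V i \<omega>))\<^sup>2) \<in> borel_measurable M"
      using V_meas by (intro borel_measurable_sum borel_measurable_power borel_measurable_norm) auto
    then show ?thesis unfolding f1_def[abs_def] by measurable
  qed
  have f1: "(\<integral>\<^sup>+\<omega>. ennreal (f1 \<omega>) \<partial>M) \<le> ennreal (1 + C)"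
  proof -
    have "(\<integral>\<^sup>+\<omega>. ennreal (f1 \<omega>) \<partial>M)
        \<le> (\<integral>\<^sup>+\<omega>. 1 + ennreal (1 / real n) * (\<Sum>i=1..n. indicator B \<omega> * ennreal ((norm (?V i \<omega>)) ^ 4)) \<partial>M)"
    proof (rule nn_integral_mono)
      fix \<omega>
      show "ennreal (f1 \<omega>) \<le> 1 + ennreal (1 / real n) * (\<Sum>i=1..n. indicator B \<omega> * ennreal ((norm (?V i \<omega>)) ^ 4))"
      proof (cases "\<omega> \<in> B")
        case True
        have "(\<Sum>i=1..n. (norm (?V i \<omega>))\<^sup>2) \<le> (\<Sum>i=1..n. 1 + (norm (?V i \<omega>)) ^ 4)"
          by (intro sum_mono square_le_one_plus_fourth)
        then have "f1 \<omega> \<le> 1 + 1 / real n * (\<Sum>i=1..n. (norm (?V i \<omega>)) ^ 4)"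
          using True n by (simp add: f1_def sum.distrib field_simps)
        then have "ennreal (f1 \<omega>) \<le> ennreal (1 + 1 / real n * (\<Sum>i=1..n. (norm (?V i \<omega>)) ^ 4))"
          by (rule ennreal_leI)
        also have "\<dots> = 1 + ennreal (1 / real n * (\<Sum>i=1..n. (norm (?V i \<omega>)) ^ 4))"
          using n by (subst ennreal_plus) (auto intro!: sum_nonneg divide_nonneg_nonneg)
        also have "\<dots> = 1 + ennreal (1 / real n) * (\<Sum>i=1..n. ennreal ((norm (?V i \<omega>)) ^ 4))"
          by (subst ennreal_mult) (auto intro!: sum_nonneg simp: sum_ennreal)
        finally show ?thesis using True by simp
      qed (simp add: f1_def)
    qed
    also have "\<dots> = 1 + ennreal (1 / real n) * (\<integral>\<^sup>+\<omega>. (\<Sum>i=1..n. indicator B \<omega> * ennreal ((norm (?V i \<omega>)) ^ 4)) \<partial>M)"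
    proof -
      have m: "(\<lambda>\<omega>. \<Sum>i=1..n. indicator B \<omega> * ennreal ((norm (?V i \<omega>)) ^ 4)) \<in> borel_measurable M"
      proof (rule borel_measurable_sum)
        fix i assume "i \<in> {1..n}"
        note [measurable] = V_meas[OF this]
        show "(\<lambda>\<omega>. indicator B \<omega> * ennreal ((norm (?V i \<omega>)) ^ 4)) \<in> borel_measurable M" by measurable
      qed
      then show ?thesis
        by (subst nn_integral_add) (auto simp: nn_integral_cmult emeasure_space_1)
    qed
    also have "(\<integral>\<^sup>+\<omega>. (\<Sum>i=1..n. indicator B \<omega> * ennreal ((norm (?V i \<omega>)) ^ 4)) \<partial>M)
        = (\<Sum>i=1..n. \<integral>\<^sup>+\<omega>. indicator B \<omega> * ennreal ((norm (?V i \<omega>)) ^ 4) \<partial>M)"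
    proof (rule nn_integral_sum)
      fix i assume "i \<in> {1..n}"
      note [measurable] = V_meas[OF this]
      show "(\<lambda>\<omega>. indicator B \<omega> * ennreal ((norm (?V i \<omega>)) ^ 4)) \<in> borel_measurable M" by measurable
    qed
    also have "\<dots> \<le> (\<Sum>i=1..n. ennreal C)" by (intro sum_mono fourth)
    also have "\<dots> = ennreal (real n * C)" using C by (simp add: ennreal_of_nat_eq_real_of_nat ennreal_mult)
    also have "1 + ennreal (1 / real n) * ennreal (real n * C) = ennreal (1 + C)"
      using n C by (simp add: ennreal_mult[symmetric])
    finally show ?thesis by (simp add: mult_left_mono add_left_mono)
  qed
  define f2 where "f2 \<omega> = (\<Sum>i=1..n. (norm (?Q i \<omega>))\<^sup>2) / real n" for \<omega>
  have f2_meas [measurable]: "f2 \<in> borel_measurable M" unfolding f2_def[abs_def] by measurable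
  have f2: "(\<integral>\<^sup>+\<omega>. ennreal (f2 \<omega>) \<partial>M) \<le> ennreal c0"
    unfolding f2_def by (rule mean_square_projection_error[OF n c0 chi])
  define B' where "B' k l = mat_inv (mean_gram M n K w) $$ (k, l)" for k l
  define cf where "cf k = (\<Sum>j=1..n. \<integral>\<omega>'. w j \<omega>' k *\<^sub>R x j \<omega>' \<partial>M)" for k
  \<comment> \<open>The population regression of x on w, so that \<open>v_pop\<close> is x minus
    \<open>lin\<close>.\<close>
  define lin where "lin i \<omega> = (\<Sum>k<K. \<Sum>l<K. (B' k l * w i \<omega> l) *\<^sub>R cf k)" for i \<omega>
  have lin_H: "(\<lambda>\<omega>. vec_nth (lin i \<omega>) a) \<in> borel_measurable H" if i: "i \<in> {1..n}" for i a
  proof -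
    have "(\<lambda>\<omega>. \<Sum>k<K. \<Sum>l<K. (B' k l * w i \<omega> l) * vec_nth (cf k) a) \<in> borel_measurable H"
      unfolding H_def
      by (intro borel_measurable_sum borel_measurable_times borel_measurable_const
          sigma_W_component[where w = w and i = i]) (use i in auto)
    then show ?thesis by (simp add: lin_def sum_component)
  qed
  \<comment> \<open>The conditional mean of \<open>v_pop\<close> should be that of x minus
    \<open>lin\<close>. As x need not be integrable, this uses the local rule on \<open>B\<close>,
    where the deviation V is integrable by its fourth moment.\<close>
  have decomp: "AE \<omega> in M. \<omega> \<in> B \<longrightarrow> x i \<omega> = ?V i \<omega> + ?Q i \<omega> + lin i \<omega>" if i: "i \<in> {1..n}" for i
  proof -
    have "AE \<omega> in M. \<omega> \<in> B \<longrightarrow> real_cond_exp M H (\<lambda>\<omega>. vec_nth (x i \<omega>) a - vec_nth (lin i \<omega>) a) \<omega>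
        = real_cond_exp M H (\<lambda>\<omega>. vec_nth (x i \<omega>) a) \<omega> - vec_nth (lin i \<omega>) a" for a
    proof (rule real_cond_exp_diff_local[OF H vec_nth_measurable[OF x_meas[OF i]] lin_H[OF i] B_H])
      note [measurable] = vec_nth_measurable[OF x_meas[OF i], of a] V_meas[OF i]
      let ?g = "\<lambda>\<omega>. indicator B \<omega> * (vec_nth (x i \<omega>) a - real_cond_exp M H (\<lambda>\<omega>. vec_nth (x i \<omega>) a) \<omega>)"
      show "integrable M ?g"
      proof (rule integrableI_bounded)
        have "(\<integral>\<^sup>+\<omega>. ennreal (norm (?g \<omega>)) \<partial>M)
            \<le> (\<integral>\<^sup>+\<omega>. 2 + indicator B \<omega> * ennreal ((norm (?V i \<omega>)) ^ 4) \<partial>M)"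
        proof (rule nn_integral_mono)
          fix \<omega>
          show "ennreal (norm (?g \<omega>)) \<le> 2 + indicator B \<omega> * ennreal ((norm (?V i \<omega>)) ^ 4)"
          proof (cases "\<omega> \<in> B")
            case True
            have "norm (?g \<omega>) = \<bar>vec_nth (?V i \<omega>) a\<bar>"
              using True by (simp add: V_err_def cond_exp_vec_def H_def)
            also have "\<dots> \<le> norm (?V i \<omega>)" by (rule component_le_norm_cart)
            also have "\<dots> \<le> 2 + (norm (?V i \<omega>)) ^ 4" using abs_mult_le_fourth[of "norm (?V i \<omega>)" 1] by simp
            finally have "ennreal (norm (?g \<omega>)) \<le> ennreal (2 + (norm (?V i \<omega>)) ^ 4)" by (rule ennreal_leI)
            then show ?thesis using True by simp
          qed simp
        qed
        also have "\<dots> = 2 + (\<integral>\<^sup>+\<omega>. indicator B \<omega> * ennreal ((norm (?V i \<omega>)) ^ 4) \<partial>M)"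
          by (subst nn_integral_add) (auto simp: emeasure_space_1)
        also have "\<dots> \<le> 2 + ennreal C" by (intro add_left_mono fourth[OF i])
        also have "\<dots> < \<infinity>" by simp
        finally show "(\<integral>\<^sup>+\<omega>. ennreal (norm (?g \<omega>)) \<partial>M) < \<infinity>" .
      qed measurable
    qed
    then have "AE \<omega> in M. \<forall>a\<in>UNIV. \<omega> \<in> B \<longrightarrow> real_cond_exp M H (\<lambda>\<omega>. vec_nth (x i \<omega>) a - vec_nth (lin i \<omega>) a) \<omega>
        = real_cond_exp M H (\<lambda>\<omega>. vec_nth (x i \<omega>) a) \<omega> - vec_nth (lin i \<omega>) a"
      by (intro AE_finite_allI) auto
    then show ?thesis
    proof eventually_elim
      case (elim \<omega>)
      show ?case
      proof
        assume B: "\<omega> \<in> B"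
        have "v_pop M n K w x i = (\<lambda>\<omega>. x i \<omega> - lin i \<omega>)"
          by (simp add: v_pop_def[abs_def] lin_def B'_def cf_def)
        then have "vec_nth (?Q i \<omega>) a = real_cond_exp M H (\<lambda>\<omega>. vec_nth (x i \<omega>) a) \<omega> - vec_nth (lin i \<omega>) a" for a
          using elim B by (simp add: Q_proj_def cond_exp_vec_def H_def[symmetric])
        then show "x i \<omega> = ?V i \<omega> + ?Q i \<omega> + lin i \<omega>"
          by (simp add: Finite_Cartesian_Product.vec_eq_iff V_err_def cond_exp_vec_def H_def[symmetric])
      qed
    qed
  qed
  have E: "AE \<omega> in M. \<omega> \<in> ?E \<longrightarrow> \<omega> \<in> {\<omega>\<in>space M. t \<le> f1 \<omega>} \<union> {\<omega>\<in>space M. t \<le> f2 \<omega>}"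
  proof -
    have "AE \<omega> in M. \<forall>i\<in>{1..n}. \<omega> \<in> B \<longrightarrow> x i \<omega> = ?V i \<omega> + ?Q i \<omega> + lin i \<omega>"
      using decomp by (intro AE_finite_allI) auto
    then show ?thesis
    proof eventually_elim
      case (elim \<omega>)
      show ?case
      proof
        assume \<omega>: "\<omega> \<in> ?E"
        then have B: "\<omega> \<in> B" by (simp add: B_def spH H_def)
        have "4 * t * real n < (\<Sum>i=1..n. (norm (v_hat n K w x i \<omega>))\<^sup>2)" using \<omega> by simp
        also have "\<dots> \<le> 2 * (\<Sum>i=1..n. (norm (?V i \<omega>))\<^sup>2) + 2 * (\<Sum>i=1..n. (norm (?Q i \<omega>))\<^sup>2)"
        proof (rule sum_v_hat_square_le)
          show "det (gram n K w \<omega>) \<noteq> 0" using \<omega> by simp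
          show "x j \<omega> = ?V j \<omega> + ?Q j \<omega> + (\<Sum>k<K. \<Sum>l<K. (B' k l * w j \<omega> l) *\<^sub>R cf k)" if "j \<in> {1..n}" for j
            using elim B that by (simp add: lin_def)
        qed
        also have "\<dots> = 2 * real n * f1 \<omega> + 2 * real n * f2 \<omega>"
          using B n by (simp add: f1_def f2_def)
        finally have "real n * (4 * t) < real n * (2 * f1 \<omega> + 2 * f2 \<omega>)"
          by (simp add: algebra_simps)
        then have "4 * t < 2 * f1 \<omega> + 2 * f2 \<omega>" using n by (simp only: mult_less_cancel_left_pos of_nat_0_less_iff)
        then show "\<omega> \<in> {\<omega>\<in>space M. t \<le> f1 \<omega>} \<union> {\<omega>\<in>space M. t \<le> f2 \<omega>}"
          using \<omega> by auto
      qed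
    qed
  qed
  have "prob ({\<omega>\<in>space M. t \<le> f1 \<omega>} \<union> {\<omega>\<in>space M. t \<le> f2 \<omega>})
      \<le> prob {\<omega>\<in>space M. t \<le> f1 \<omega>} + prob {\<omega>\<in>space M. t \<le> f2 \<omega>}"
    by (rule measure_Un_le) measurable
  also have "\<dots> \<le> (1 + C) / t + c0 / t"
    using C by (intro add_mono prob_ge_le_nn_integral f1 f2 t c0) auto
  also have "\<dots> = (1 + C + c0) / t" by (simp add: add_divide_distrib)
  finally have "prob ({\<omega>\<in>space M. t \<le> f1 \<omega>} \<union> {\<omega>\<in>space M. t \<le> f2 \<omega>}) \<le> (1 + C + c0) / t" .
  then show ?thesis
    by (intro bexI[of _ "{\<omega>\<in>space M. t \<le> f1 \<omega>} \<union> {\<omega>\<in>space M. t \<le> f2 \<omega>}"] conjI E) measurable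
qed

section \<open>The conditional variance of the score\<close>

context clustered_moments
begin

lemma weight_indicator:
  assumes g: "g \<in> borel_measurable F" and y: "\<And>\<omega>. \<omega> \<in> A \<Longrightarrow> (g \<omega>)\<^sup>2 \<le> y"
  shows "weight (\<lambda>\<omega>. indicator A \<omega> * g \<omega>)"
  unfolding weight_def
proof (intro conjI)
  show "(\<lambda>\<omega>. indicator A \<omega> * g \<omega>) \<in> borel_measurable F"
    using A g by (intro borel_measurable_times borel_measurable_indicator)
  show "\<forall>\<omega>\<in>space M - A. indicator A \<omega> * g \<omega> = 0" by simp
  show "\<exists>\<beta>. \<forall>\<omega>\<in>space M. \<bar>indicator A \<omega> * g \<omega>\<bar> \<le> \<beta>"
  proof (intro exI ballI)
    fix \<omega>
    show "\<bar>indicator A \<omega> * g \<omega>\<bar> \<le> \<bar>1 + y\<bar>"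
    proof (cases "\<omega> \<in> A")
      case True
      have "2 * \<bar>g \<omega>\<bar> \<le> 1 + (g \<omega>)\<^sup>2" using sum_squares_bound[of 1 "\<bar>g \<omega>\<bar>"] by simp
      then show ?thesis using True y[OF True] abs_ge_zero[of "g \<omega>"] by simp
    qed simp
  qed
qed

lemma weight_times:
  assumes b: "weight b" and b': "weight b'"
  shows "weight (\<lambda>\<omega>. b \<omega> * b' \<omega>)"
proof -
  obtain \<beta> where \<beta>: "\<forall>\<omega>\<in>space M. \<bar>b \<omega>\<bar> \<le> \<beta>" using b by (auto simp: weight_def)
  obtain \<beta>' where \<beta>': "\<forall>\<omega>\<in>space M. \<bar>b' \<omega>\<bar> \<le> \<beta>'" using b' by (auto simp: weight_def)
  have 1: "(\<lambda>\<omega>. b \<omega> * b' \<omega>) \<in> borel_measurable F"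
    by (rule borel_measurable_times[OF weight_F[OF b] weight_F[OF b']])
  have 2: "\<bar>b \<omega> * b' \<omega>\<bar> \<le> \<beta> * \<beta>'" if "\<omega> \<in> space M" for \<omega>
    unfolding abs_mult using \<beta> \<beta>' that abs_ge_zero[of "b \<omega>"]
    by (intro mult_mono) (auto intro: order_trans[OF abs_ge_zero])
  have 3: "b \<omega> * b' \<omega> = 0" if "\<omega> \<in> space M - A" for \<omega>
    using b that by (simp add: weight_def)
  show ?thesis unfolding weight_def
    by (intro conjI ballI exI[of _ "\<beta> * \<beta>'"] 1 2 3)
qed

text \<open>On \<open>A\<close> the conditional mean of the score is zero, so its conditional
  variance is a conditional second moment, which expands into the \<open>cprod\<close>. The score
  itself may fail to be integrable; the identities are proved after multiplication by the indicator
  of \<open>A\<close>, which is then pulled out.\<close>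

lemma cond_var_score:
  fixes S :: "'a \<Rightarrow> real^'d"
  assumes b: "\<And>a i. i \<in> I \<Longrightarrow> weight (b a i)" and S: "S \<in> borel_measurable M"
    and S_eq: "\<And>a \<omega>. indicator A \<omega> * vec_nth (S \<omega>) a = (\<Sum>i\<in>I. b a i \<omega> * u i \<omega>)"
  shows "AE \<omega> in M. \<omega> \<in> A \<longrightarrow> (\<forall>a c. vec_nth (vec_nth (cond_var M F S \<omega>) a) c
      = (\<Sum>i\<in>I. \<Sum>j\<in>I. b a i \<omega> * b c j \<omega> * cprod i j \<omega>))"
proof -
  have A_F [measurable]: "A \<in> sets F" by (rule A)
  have A_M [measurable]: "A \<in> sets M" using A F_sub by (auto simp: subalgebra_def)
  have ind_F: "(indicator A :: 'a \<Rightarrow> real) \<in> borel_measurable F" by measurable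
  note Sa [measurable] = vec_nth_measurable[OF S]
  define m where "m a = real_cond_exp M F (\<lambda>\<omega>. vec_nth (S \<omega>) a)" for a
  have [measurable]: "m a \<in> borel_measurable M" for a by (simp add: m_def)
  have m0: "AE \<omega> in M. \<omega> \<in> A \<longrightarrow> m a \<omega> = 0" for a
  proof -
    have int: "integrable M (\<lambda>\<omega>. indicator A \<omega> * vec_nth (S \<omega>) a)"
      unfolding S_eq by (rule Bochner_Integration.integrable_sum) (rule weight_u_integrable[OF b])
    have "AE \<omega> in M. real_cond_exp M F (\<lambda>\<omega>. indicator A \<omega> * vec_nth (S \<omega>) a) \<omega> = indicator A \<omega> * m a \<omega>"
      unfolding m_def by (rule F.real_cond_exp_mult[OF ind_F Sa int])
    moreover have "AE \<omega> in M. real_cond_exp M F (\<lambda>\<omega>. indicator A \<omega> * vec_nth (S \<omega>) a) \<omega> = 0"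
      unfolding S_eq by (rule cond_exp_linear_form[OF b])
    ultimately show ?thesis by eventually_elim auto
  qed
  have main: "AE \<omega> in M. \<omega> \<in> A \<longrightarrow> vec_nth (vec_nth (cond_var M F S \<omega>) a) c
      = (\<Sum>i\<in>I. \<Sum>j\<in>I. b a i \<omega> * b c j \<omega> * cprod i j \<omega>)" for a c
  proof -
    define h where "h \<omega> = (vec_nth (S \<omega>) a - m a \<omega>) * (vec_nth (S \<omega>) c - m c \<omega>)" for \<omega>
    have [measurable]: "h \<in> borel_measurable M" unfolding h_def[abs_def] by measurable
    have cv: "vec_nth (vec_nth (cond_var M F S \<omega>) a) c = real_cond_exp M F h \<omega>" for \<omega>
      by (simp add: cond_var_def cond_exp_mat_def outer_def cond_exp_vec_def h_def[abs_def] m_def)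
    define f where "f \<omega> = (\<Sum>i\<in>I. \<Sum>j\<in>I. b a i \<omega> * b c j \<omega> * (u i \<omega> * u j \<omega>))" for \<omega>
    have w: "weight (\<lambda>\<omega>. b a i \<omega> * b c j \<omega>)" if "i \<in> I" "j \<in> I" for i j
      using that by (intro weight_times b)
    have f_int: "integrable M f"
      unfolding f_def[abs_def] by (intro Bochner_Integration.integrable_sum weight_uu_integrable w)
    have f_eq: "f \<omega> = indicator A \<omega> * (vec_nth (S \<omega>) a * vec_nth (S \<omega>) c)" for \<omega>
    proof -
      have "f \<omega> = (\<Sum>i\<in>I. b a i \<omega> * u i \<omega>) * (\<Sum>j\<in>I. b c j \<omega> * u j \<omega>)"
        by (simp add: f_def sum_product mult_ac)
      also have "\<dots> = indicator A \<omega> * (vec_nth (S \<omega>) a * vec_nth (S \<omega>) c)"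
        unfolding S_eq[symmetric] by (simp add: indicator_def)
      finally show ?thesis .
    qed
    have hf: "AE \<omega> in M. indicator A \<omega> * h \<omega> = f \<omega>"
      using m0[of a] m0[of c] by eventually_elim (auto simp: f_eq h_def indicator_def)
    have hint: "integrable M (\<lambda>\<omega>. indicator A \<omega> * h \<omega>)"
    proof (rule integrable_cong_AE_imp[OF f_int])
      show "AE \<omega> in M. f \<omega> = indicator A \<omega> * h \<omega>" using hf by eventually_elim simp
    qed measurable
    have "AE \<omega> in M. real_cond_exp M F (\<lambda>\<omega>. indicator A \<omega> * h \<omega>) \<omega> = indicator A \<omega> * real_cond_exp M F h \<omega>"
      by (rule F.real_cond_exp_mult[OF ind_F _ hint]) measurable
    moreover have "AE \<omega> in M. real_cond_exp M F (\<lambda>\<omega>. indicator A \<omega> * h \<omega>) \<omega> = real_cond_exp M F f \<omega>"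
      by (rule F.real_cond_exp_cong[OF hf]) (use f_int in auto)
    moreover have "AE \<omega> in M. real_cond_exp M F f \<omega> = (\<Sum>i\<in>I. \<Sum>j\<in>I. b a i \<omega> * b c j \<omega> * cprod i j \<omega>)"
      unfolding f_def[abs_def] by (rule cond_exp_quadratic_form[OF w])
    ultimately show ?thesis unfolding cv by eventually_elim auto
  qed
  have "AE \<omega> in M. \<forall>a\<in>UNIV. \<forall>c\<in>UNIV. \<omega> \<in> A \<longrightarrow> vec_nth (vec_nth (cond_var M F S \<omega>) a) c
      = (\<Sum>i\<in>I. \<Sum>j\<in>I. b a i \<omega> * b c j \<omega> * cprod i j \<omega>)"
    by (intro AE_finite_allI) (auto intro: main)
  then show ?thesis by eventually_elim auto
qed

end

section \<open>The variance estimator for a fixed sample size\<close>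

definition LZ_target :: "'a measure \<Rightarrow> nat \<Rightarrow> nat \<Rightarrow> (nat \<Rightarrow> 'a \<Rightarrow> nat \<Rightarrow> real) \<Rightarrow> (nat \<Rightarrow> 'a \<Rightarrow> real^'d) \<Rightarrow>
    (nat \<Rightarrow> 'a \<Rightarrow> real) \<Rightarrow> nat \<Rightarrow> (nat \<Rightarrow> nat set) \<Rightarrow> 'a \<Rightarrow> real^'d^'d" where
  "LZ_target P n K w x u G T \<omega> = (1 / real n) *\<^sub>R
        (\<Sum>g1=1..G. \<Sum>g2=1..G. \<Sum>i1\<in>T g1. \<Sum>j1\<in>T g1. \<Sum>i2\<in>T g2. \<Sum>j2\<in>T g2.
          (resid_mat n K w i1 j2 \<omega> * resid_mat n K w j1 i2 \<omega> *
           real_cond_exp P (sigma_XW P n K x w) (\<lambda>\<omega>'. u i2 \<omega>' * u j2 \<omega>') \<omega>) *\<^sub>R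
          outer (v_hat n K w x i1 \<omega>) (v_hat n K w x j1 \<omega>))"

text \<open>Every condition depends on (X, W) only, so the event can carry \<open>weight\<close>
  functions. \<open>C1\<close> bounds the mean of the squared norms of v, \<eta> their maximum
  divided by n; the bound on the inverse variance enters pathwise and is kept separate.\<close>

definition good_event :: "'a measure \<Rightarrow> nat \<Rightarrow> nat \<Rightarrow> (nat \<Rightarrow> 'a \<Rightarrow> nat \<Rightarrow> real) \<Rightarrow> (nat \<Rightarrow> 'a \<Rightarrow> real^'d) \<Rightarrow>
    (nat \<Rightarrow> 'a \<Rightarrow> real) \<Rightarrow> real \<Rightarrow> real \<Rightarrow> real \<Rightarrow> 'a set" where
  "good_event P n K w x u C C1 \<eta> = {\<omega>\<in>space P. det (gram n K w \<omega>) \<noteq> 0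
      \<and> (\<forall>i\<in>{1..n}. nn_cond_exp P (sigma_XW P n K x w) (\<lambda>\<omega>'. ennreal (u i \<omega>' ^ 4)) \<omega> \<le> ennreal C)
      \<and> (\<Sum>i=1..n. (norm (v_hat n K w x i \<omega>))\<^sup>2) \<le> C1 * real n
      \<and> (\<forall>i\<in>{1..n}. (norm (v_hat n K w x i \<omega>))\<^sup>2 \<le> \<eta> * real n)}"

text \<open>On the good event everything that conditioning on \<open>(X, W)\<close> treats as constant is bounded,
  so that Chebyshev's inequality applies to the random forms in \<open>u\<close>; the remaining steps are
  deterministic.\<close>

lemma (in prob_space) Sigma_LZ_tail:
  fixes x :: "nat \<Rightarrow> 'a \<Rightarrow> real^'d" and u y :: "nat \<Rightarrow> 'a \<Rightarrow> real" and G :: nat and T :: "nat \<Rightarrow> nat set"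
  assumes n: "n > 0"
    and x_meas: "\<And>i. i \<in> {1..n} \<Longrightarrow> x i \<in> borel_measurable M"
    and u_meas: "\<And>i. i \<in> {1..n} \<Longrightarrow> u i \<in> borel_measurable M"
    and w_meas: "\<And>i k. i \<in> {1..n} \<Longrightarrow> k < K \<Longrightarrow> (\<lambda>\<omega>. w i \<omega> k) \<in> borel_measurable M"
    and model: "\<And>i \<omega>. i \<in> {1..n} \<Longrightarrow> \<omega> \<in> space M \<Longrightarrow>
        y i \<omega> = inner \<beta> (x i \<omega>) + (\<Sum>k<K. \<gamma> k * w i \<omega> k) + u i \<omega>"
    and T_disjoint: "disjoint_family_on T {1..G}"
    and T_cover: "(\<Union>g\<in>{1..G}. T g) = {1..n}"
    and T_indep: "cond_indep_vars M (sigma_W M n K w)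
        (\<lambda>g. PiM (T g) (\<lambda>_. borel :: (real \<times> (real^'d)) measure))
        (\<lambda>g \<omega>. \<lambda>i\<in>T g. (u i \<omega>, x i \<omega>)) {1..G}"
    and u_mean: "\<And>i. i \<in> {1..n} \<Longrightarrow> AE \<omega> in M. real_cond_exp M (sigma_XW M n K x w) (u i) \<omega> = 0"
    and T_card: "\<And>g. g \<in> {1..G} \<Longrightarrow> card (T g) \<le> c"
    and C: "C \<ge> 0" and C1: "C1 \<ge> 0" and C2: "C2 \<ge> 0" and \<eta>: "\<eta> \<ge> 0" and t: "t > 0" and \<tau>: "\<tau> > 0"
  defines "d \<equiv> real CARD('d)"
  defines "\<rho> \<equiv> ((1 + 2 * C) * real c)\<^sup>2 * C1 * C2\<^sup>2"
  defines "q \<equiv> \<rho> * (d * t) * sqrt \<eta>"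
  shows "\<exists>D\<in>sets M. prob D \<le> d * d * (2 * (real c)\<^sup>2 * (2 * C + 2 * (1 + 2 * C)\<^sup>2) * (real c * \<eta> * C1) / \<tau>\<^sup>2)
      + d * (real c * (1 + C) * C1 / t\<^sup>2) + real c * (1 + C) * C1 / t
    \<and> (AE \<omega> in M. \<omega> \<in> {\<omega>\<in>good_event M n K w x u C C1 \<eta>. inv_norm (Sigma_cond M n K w x u \<omega>) \<le> ennreal C2
      \<and> real c * (q * (t + C1) + q\<^sup>2 * C1) + d * d * \<tau>
        < norm (Sigma_LZ n K w x y G T \<omega> - LZ_target M n K w x u G T \<omega>)} \<longrightarrow> \<omega> \<in> D)"
    (is "\<exists>D\<in>_. prob D \<le> ?rate \<and> (AE \<omega> in M. \<omega> \<in> ?E \<longrightarrow> _)")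
proof -
  define F where "F = sigma_XW M n K x w"
  define A where "A = good_event M n K w x u C C1 \<eta>"
  let ?I = "{1..n}" and ?Mt = "\<lambda>\<omega> i j. resid_mat n K w i j \<omega>" and ?v = "\<lambda>\<omega> i. v_hat n K w x i \<omega>"
  have F_sub: "subalgebra M F" unfolding F_def by (rule subalgebra_sigma_XW) (use x_meas w_meas in auto)
  have spF: "space F = space M" by (simp add: F_def)
  define cl where "cl i = (SOME g. g \<in> {1..G} \<and> i \<in> T g)" for i
  have cl: "cl i \<in> {1..G} \<and> i \<in> T (cl i)" if "i \<in> ?I" for i
  proof -
    have "i \<in> (\<Union>g\<in>{1..G}. T g)" using that by (simp only: T_cover)
    then have "\<exists>g. g \<in> {1..G} \<and> i \<in> T g" by (rule UN_E) (rule exI, rule conjI)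
    then show ?thesis unfolding cl_def by (rule someI_ex)
  qed
  interpret P: cluster_partition ?I G T cl
    by (rule cluster_partition.intro[OF _ T_cover T_disjoint cl]) simp
  have c: "card {j\<in>?I. cl j = cl i} \<le> c" if "i \<in> ?I" for i
    using T_card[of "cl i"] cl[OF that] P.T_eq[of "cl i"] by simp
  have w_F: "(\<lambda>\<omega>. w i \<omega> k) \<in> borel_measurable F" if "i \<in> ?I" "k < K" for i k
    unfolding F_def using that by (rule sigma_XW_component(1)[where w = w])
  have x_F: "x i \<in> borel_measurable F" if "i \<in> ?I" for i
    unfolding F_def using that by (rule sigma_XW_component(2))
  have Mt_F: "(\<lambda>\<omega>. ?Mt \<omega> i j) \<in> borel_measurable F" if "i \<in> ?I" "j \<in> ?I" for i j
    by (rule resid_mat_measurable[OF w_F that])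
  have v_F: "(\<lambda>\<omega>. ?v \<omega> i) \<in> borel_measurable F" if "i \<in> ?I" for i
    by (rule v_hat_measurable[OF w_F x_F that])
  have nv_F: "(\<lambda>\<omega>. (norm (?v \<omega> i))\<^sup>2) \<in> borel_measurable F" if "i \<in> ?I" for i
    using v_F[OF that] by measurable
  have A_F: "A \<in> sets F"
  proof -
    have [measurable]: "(\<lambda>\<omega>. det (gram n K w \<omega>)) \<in> borel_measurable F" by (rule det_gram_measurable[OF w_F])
    have s [measurable]: "(\<lambda>\<omega>. \<Sum>i=1..n. (norm (?v \<omega> i))\<^sup>2) \<in> borel_measurable F"
      by (intro borel_measurable_sum nv_F)
    have 1: "{\<omega>\<in>space F. det (gram n K w \<omega>) \<noteq> 0} \<in> sets F" by measurable
    have 2: "{\<omega>\<in>space F. \<forall>i\<in>?I. nn_cond_exp M F (\<lambda>\<omega>'. ennreal (u i \<omega>' ^ 4)) \<omega> \<le> ennreal C} \<in> sets F"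
      by measurable
    have 3: "{\<omega>\<in>space F. (\<Sum>i=1..n. (norm (?v \<omega> i))\<^sup>2) \<le> C1 * real n} \<in> sets F" by measurable
    have 4: "{\<omega>\<in>space F. \<forall>i\<in>?I. (norm (?v \<omega> i))\<^sup>2 \<le> \<eta> * real n} \<in> sets F"
    proof (rule sets.sets_Collect_finite_All)
      fix i assume i: "i \<in> ?I"
      note [measurable] = nv_F[OF i]
      show "{\<omega>\<in>space F. (norm (?v \<omega> i))\<^sup>2 \<le> \<eta> * real n} \<in> sets F" by measurable
    qed simp
    have "A = {\<omega>\<in>space F. det (gram n K w \<omega>) \<noteq> 0}
      \<inter> {\<omega>\<in>space F. \<forall>i\<in>?I. nn_cond_exp M F (\<lambda>\<omega>'. ennreal (u i \<omega>' ^ 4)) \<omega> \<le> ennreal C}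
      \<inter> {\<omega>\<in>space F. (\<Sum>i=1..n. (norm (?v \<omega> i))\<^sup>2) \<le> C1 * real n}
      \<inter> {\<omega>\<in>space F. \<forall>i\<in>?I. (norm (?v \<omega> i))\<^sup>2 \<le> \<eta> * real n}"
      unfolding A_def good_event_def F_def by auto
    then show ?thesis using 1 2 3 4 by (simp only: sets.Int)
  qed
  have A_det: "det (gram n K w \<omega>) \<noteq> 0" if "\<omega> \<in> A" for \<omega>
    using that by (simp add: A_def good_event_def)
  have A_mom: "nn_cond_exp M F (\<lambda>\<omega>'. ennreal (u i \<omega>' ^ 4)) \<omega> \<le> ennreal C" if "\<omega> \<in> A" "i \<in> ?I" for \<omega> i
    using that by (simp add: A_def good_event_def F_def)
  have A_sum: "(\<Sum>i=1..n. (norm (?v \<omega> i))\<^sup>2) \<le> C1 * real n" if "\<omega> \<in> A" for \<omega>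
    using that by (simp add: A_def good_event_def)
  have A_max: "(norm (?v \<omega> i))\<^sup>2 \<le> \<eta> * real n" if "\<omega> \<in> A" "i \<in> ?I" for \<omega> i
    using that by (simp add: A_def good_event_def)
  have A_proj: "projection_on ?I (?Mt \<omega>)" if "\<omega> \<in> A" for \<omega>
    by (rule projection_on_resid_mat[OF A_det[OF that]])
  have A_space: "\<omega> \<in> space M" if "\<omega> \<in> A" for \<omega>
    using that by (simp add: A_def good_event_def)
  have "\<exists>Fo. clustered_errors M F Fo ?I cl u"
    unfolding F_def
    by (rule clustered_errors_of_cond_indep[where x = x and u = u and w = w and K = K and n = n and G = G and T = T,
          OF x_meas u_meas w_meas T_cover T_indep u_mean cl])
  then obtain Fo where Fo: "clustered_errors M F Fo ?I cl u" by (rule exE)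
  interpret E: clustered_moments M F Fo ?I cl u A C
    by (intro clustered_moments.intro[OF Fo] clustered_moments_axioms.intro A_F C AE_I2 impI A_mom)
  \<comment> \<open>Truncated weights of the quadratic form for entry (a, b). Their squared
    Frobenius norm is at most \<open>real c * \<eta> * C1\<close>, and a small \<eta> is what makes
    the entry small.\<close>
  define bT where "bT a b k l \<omega> = indicator A \<omega> * P.sandwich (?Mt \<omega>) (real n) (?v \<omega>) a b k l" for a b k l \<omega>
  have sand: "(\<Sum>k\<in>?I. \<Sum>l\<in>?I. (P.sandwich (?Mt \<omega>) (real n) (?v \<omega>) a b k l)\<^sup>2) \<le> real c * \<eta> * C1"
    if "\<omega> \<in> A" for \<omega> a b
    by (rule P.sum_sandwich_square_le[OF A_proj[OF that] _ c A_sum[OF that] A_max[OF that] \<eta>]) (use n in auto)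
  have bT_w: "E.weight (bT a b k l)" if kl: "k \<in> ?I" "l \<in> ?I" for a b k l
    unfolding bT_def[abs_def]
  proof (rule E.weight_indicator)
    show "(\<lambda>\<omega>. P.sandwich (?Mt \<omega>) (real n) (?v \<omega>) a b k l) \<in> borel_measurable F"
      unfolding P.sandwich_def
    proof (intro borel_measurable_sum)
      fix i j assume i: "i \<in> ?I" and j: "j \<in> ?I"
      note [measurable] = Mt_F[OF i kl(1)] Mt_F[OF j kl(2)] vec_nth_measurable[OF v_F[OF i], of a] vec_nth_measurable[OF v_F[OF j], of b]
      show "(\<lambda>\<omega>. ?Mt \<omega> i k * (if cl i = cl j then vec_nth (?v \<omega> i) a * vec_nth (?v \<omega> j) b / real n else 0) * ?Mt \<omega> j l) \<in> borel_measurable F"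
        by measurable
    qed
    fix \<omega> assume \<omega>: "\<omega> \<in> A"
    let ?s = "P.sandwich (?Mt \<omega>) (real n) (?v \<omega>) a b"
    have "(?s k l)\<^sup>2 \<le> (\<Sum>l\<in>?I. (?s k l)\<^sup>2)" using kl by (intro member_le_sum) auto
    also have "\<dots> \<le> (\<Sum>k\<in>?I. \<Sum>l\<in>?I. (?s k l)\<^sup>2)"
      using kl by (intro member_le_sum[where f = "\<lambda>k. \<Sum>l\<in>?I. (?s k l)\<^sup>2"]) (auto intro!: sum_nonneg)
    also have "\<dots> \<le> real c * \<eta> * C1" by (rule sand[OF \<omega>])
    finally show "(?s k l)\<^sup>2 \<le> real c * \<eta> * C1" .
  qed
  define qT where "qT a b \<omega> = (\<Sum>k\<in>?I. \<Sum>l\<in>?I. bT a b k l \<omega> * (u k \<omega> * u l \<omega> - E.cprod k l \<omega>))" for a b \<omega>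
  have qT_int: "integrable M (\<lambda>\<omega>. (qT a b \<omega>)\<^sup>2)" for a b
    unfolding qT_def by (rule E.quadratic_form_variance(1)[OF bT_w c])
  have qT: "prob {\<omega>\<in>space M. \<tau>\<^sup>2 \<le> (qT a b \<omega>)\<^sup>2} \<le> 2 * (real c)\<^sup>2 * E.kap * (real c * \<eta> * C1) / \<tau>\<^sup>2" for a b
  proof (rule prob_ge_le_integral[OF qT_int])
    have int: "integrable M (\<lambda>\<omega>. \<Sum>k\<in>?I. \<Sum>l\<in>?I. (bT a b k l \<omega>)\<^sup>2)"
      by (intro Bochner_Integration.integrable_sum E.weight_integrable_square bT_w)
    have "(\<integral>\<omega>. (\<Sum>k\<in>?I. \<Sum>l\<in>?I. (bT a b k l \<omega>)\<^sup>2) \<partial>M) \<le> real c * \<eta> * C1"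
    proof (rule integral_le_const[OF int AE_I2])
      fix \<omega>
      show "(\<Sum>k\<in>?I. \<Sum>l\<in>?I. (bT a b k l \<omega>)\<^sup>2) \<le> real c * \<eta> * C1"
        using sand[of \<omega> a b] \<eta> C1 by (cases "\<omega> \<in> A") (simp_all add: bT_def)
    qed
    then have "2 * (real c)\<^sup>2 * E.kap * (\<integral>\<omega>. (\<Sum>k\<in>?I. \<Sum>l\<in>?I. (bT a b k l \<omega>)\<^sup>2) \<partial>M) \<le> 2 * (real c)\<^sup>2 * E.kap * (real c * \<eta> * C1)"
      using E.kap_nonneg by (intro mult_left_mono mult_nonneg_nonneg) auto
    with E.quadratic_form_variance(2)[OF bT_w[of _ _ a b] c]
    show "(\<integral>\<omega>. (qT a b \<omega>)\<^sup>2 \<partial>M) \<le> 2 * (real c)\<^sup>2 * E.kap * (real c * \<eta> * C1)"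
      unfolding qT_def by (rule order_trans)
  qed (use \<tau> in auto)
  \<comment> \<open>Coefficients of coordinate \<open>a\<close> of the score, scaled by 1 / sqrt n
    and truncated to \<open>A\<close>.\<close>
  define bS where "bS a k \<omega> = indicator A \<omega> * (vec_nth (?v \<omega> k) a / sqrt (real n))" for a k \<omega>
  have vS: "(\<Sum>k\<in>?I. (vec_nth (?v \<omega> k) a / sqrt (real n))\<^sup>2) \<le> C1" if "\<omega> \<in> A" for \<omega> a
  proof -
    have "(\<Sum>k\<in>?I. (vec_nth (?v \<omega> k) a / sqrt (real n))\<^sup>2) \<le> (\<Sum>k\<in>?I. (norm (?v \<omega> k))\<^sup>2 / real n)"
    proof (rule sum_mono)
      fix k
      have "(vec_nth (?v \<omega> k) a)\<^sup>2 \<le> (norm (?v \<omega> k))\<^sup>2"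
        using component_le_norm_cart[of "?v \<omega> k" a] by (simp add: abs_le_square_iff[symmetric])
      then show "(vec_nth (?v \<omega> k) a / sqrt (real n))\<^sup>2 \<le> (norm (?v \<omega> k))\<^sup>2 / real n"
        by (simp add: power_divide divide_right_mono)
    qed
    also have "\<dots> \<le> C1" using A_sum[OF that] n by (simp add: sum_divide_distrib[symmetric] field_simps)
    finally show ?thesis .
  qed
  have bS_w: "E.weight (bS a k)" if k: "k \<in> ?I" for a k
    unfolding bS_def[abs_def]
  proof (rule E.weight_indicator)
    note [measurable] = vec_nth_measurable[OF v_F[OF k], of a]
    show "(\<lambda>\<omega>. vec_nth (?v \<omega> k) a / sqrt (real n)) \<in> borel_measurable F" by measurable
    fix \<omega> assume \<omega>: "\<omega> \<in> A"
    have "(vec_nth (?v \<omega> k) a / sqrt (real n))\<^sup>2 \<le> (\<Sum>k\<in>?I. (vec_nth (?v \<omega> k) a / sqrt (real n))\<^sup>2)"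
      using k by (intro member_le_sum) auto
    also have "\<dots> \<le> C1" by (rule vS[OF \<omega>])
    finally show "(vec_nth (?v \<omega> k) a / sqrt (real n))\<^sup>2 \<le> C1" .
  qed
  define sS where "sS a \<omega> = (\<Sum>k\<in>?I. bS a k \<omega> * u k \<omega>)" for a \<omega>
  have sS_int: "integrable M (\<lambda>\<omega>. (sS a \<omega>)\<^sup>2)" for a
    unfolding sS_def by (rule E.linear_form_variance(1)[OF bS_w c])
  have sS: "prob {\<omega>\<in>space M. t\<^sup>2 \<le> (sS a \<omega>)\<^sup>2} \<le> real c * (1 + C) * C1 / t\<^sup>2" for a
  proof (rule prob_ge_le_integral[OF sS_int])
    have int: "integrable M (\<lambda>\<omega>. \<Sum>k\<in>?I. (bS a k \<omega>)\<^sup>2)"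
      by (intro Bochner_Integration.integrable_sum E.weight_integrable_square bS_w)
    have "(\<integral>\<omega>. (\<Sum>k\<in>?I. (bS a k \<omega>)\<^sup>2) \<partial>M) \<le> C1"
    proof (rule integral_le_const[OF int AE_I2])
      fix \<omega>
      show "(\<Sum>k\<in>?I. (bS a k \<omega>)\<^sup>2) \<le> C1"
        using vS[of \<omega> a] C1 by (cases "\<omega> \<in> A") (simp_all add: bS_def)
    qed
    then have "real c * (1 + C) * (\<integral>\<omega>. (\<Sum>k\<in>?I. (bS a k \<omega>)\<^sup>2) \<partial>M) \<le> real c * (1 + C) * C1"
      using C by (intro mult_left_mono mult_nonneg_nonneg) auto
    with E.linear_form_variance(2)[OF bS_w[of _ a] c]
    show "(\<integral>\<omega>. (sS a \<omega>)\<^sup>2 \<partial>M) \<le> real c * (1 + C) * C1"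
      unfolding sS_def by (rule order_trans)
  qed (use t in auto)
  \<comment> \<open>Chosen so that on \<open>A\<close> the squared forms add up to the mean of
    |v_i|^2 (M u)_i^2. Each row of M has norm at most one, so the total squared weight is at most
    \<open>C1\<close>.\<close>
  define bR where "bR i k \<omega> = indicator A \<omega> * (norm (?v \<omega> i) * ?Mt \<omega> i k / sqrt (real n))" for i k \<omega>
  have vR: "(\<Sum>k\<in>?I. (norm (?v \<omega> i) * ?Mt \<omega> i k / sqrt (real n))\<^sup>2) \<le> (norm (?v \<omega> i))\<^sup>2 / real n"
    if "\<omega> \<in> A" "i \<in> ?I" for \<omega> i
  proof -
    have "(\<Sum>k\<in>?I. (norm (?v \<omega> i) * ?Mt \<omega> i k / sqrt (real n))\<^sup>2) = (norm (?v \<omega> i))\<^sup>2 / real n * (\<Sum>k\<in>?I. (?Mt \<omega> i k)\<^sup>2)"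
      by (simp add: power_divide power_mult_distrib sum_distrib_left)
    also have "\<dots> \<le> (norm (?v \<omega> i))\<^sup>2 / real n * 1"
      by (intro mult_left_mono projection_on_row_le[OF A_proj[OF that(1)] that(2)]) simp
    finally show ?thesis by simp
  qed
  have vR': "(\<Sum>i\<in>?I. (norm (?v \<omega> i))\<^sup>2 / real n) \<le> C1" if "\<omega> \<in> A" for \<omega>
    using A_sum[OF that] n by (simp add: sum_divide_distrib[symmetric] field_simps)
  have bR_w: "E.weight (bR i k)" if i: "i \<in> ?I" and k: "k \<in> ?I" for i k
    unfolding bR_def[abs_def]
  proof (rule E.weight_indicator)
    note [measurable] = v_F[OF i] Mt_F[OF i k]
    show "(\<lambda>\<omega>. norm (?v \<omega> i) * ?Mt \<omega> i k / sqrt (real n)) \<in> borel_measurable F" by measurable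
    fix \<omega> assume \<omega>: "\<omega> \<in> A"
    have "(norm (?v \<omega> i) * ?Mt \<omega> i k / sqrt (real n))\<^sup>2 \<le> (\<Sum>k\<in>?I. (norm (?v \<omega> i) * ?Mt \<omega> i k / sqrt (real n))\<^sup>2)"
      using k by (intro member_le_sum) auto
    also have "\<dots> \<le> (norm (?v \<omega> i))\<^sup>2 / real n" by (rule vR[OF \<omega> i])
    also have "\<dots> \<le> (\<Sum>i\<in>?I. (norm (?v \<omega> i))\<^sup>2 / real n)" using i by (intro member_le_sum) auto
    also have "\<dots> \<le> C1" by (rule vR'[OF \<omega>])
    finally show "(norm (?v \<omega> i) * ?Mt \<omega> i k / sqrt (real n))\<^sup>2 \<le> C1" .
  qed
  define sR where "sR \<omega> = (\<Sum>i\<in>?I. (\<Sum>k\<in>?I. bR i k \<omega> * u k \<omega>)\<^sup>2)" for \<omega>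
  have sR_int: "integrable M sR"
    unfolding sR_def[abs_def]
    by (rule Bochner_Integration.integrable_sum) (rule E.linear_form_variance(1)[OF bR_w c])
  have sR: "prob {\<omega>\<in>space M. t \<le> sR \<omega>} \<le> real c * (1 + C) * C1 / t"
  proof (rule prob_ge_le_integral[OF sR_int])
    have int: "integrable M (\<lambda>\<omega>. \<Sum>k\<in>?I. (bR i k \<omega>)\<^sup>2)" if "i \<in> ?I" for i
      by (rule Bochner_Integration.integrable_sum) (rule E.weight_integrable_square[OF bR_w[OF that]])
    have "(\<integral>\<omega>. sR \<omega> \<partial>M) = (\<Sum>i\<in>?I. \<integral>\<omega>. (\<Sum>k\<in>?I. bR i k \<omega> * u k \<omega>)\<^sup>2 \<partial>M)"
      unfolding sR_def by (rule Bochner_Integration.integral_sum) (rule E.linear_form_variance(1)[OF bR_w c])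
    also have "\<dots> \<le> (\<Sum>i\<in>?I. real c * (1 + C) * (\<integral>\<omega>. (\<Sum>k\<in>?I. (bR i k \<omega>)\<^sup>2) \<partial>M))"
      by (rule sum_mono) (rule E.linear_form_variance(2)[OF bR_w c])
    also have "\<dots> = real c * (1 + C) * (\<integral>\<omega>. (\<Sum>i\<in>?I. \<Sum>k\<in>?I. (bR i k \<omega>)\<^sup>2) \<partial>M)"
      by (subst Bochner_Integration.integral_sum[OF int]) (simp_all only: sum_distrib_left)
    also have "\<dots> \<le> real c * (1 + C) * C1"
    proof (rule mult_left_mono)
      show "(\<integral>\<omega>. (\<Sum>i\<in>?I. \<Sum>k\<in>?I. (bR i k \<omega>)\<^sup>2) \<partial>M) \<le> C1"
      proof (rule integral_le_const[OF Bochner_Integration.integrable_sum[OF int] AE_I2])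
        fix \<omega>
        show "(\<Sum>i\<in>?I. \<Sum>k\<in>?I. (bR i k \<omega>)\<^sup>2) \<le> C1"
        proof (cases "\<omega> \<in> A")
          case True
          have "(\<Sum>i\<in>?I. \<Sum>k\<in>?I. (bR i k \<omega>)\<^sup>2) \<le> (\<Sum>i\<in>?I. (norm (?v \<omega> i))\<^sup>2 / real n)"
            using vR[OF True] True by (intro sum_mono) (simp add: bR_def)
          then show ?thesis using vR'[OF True] by simp
        qed (use C1 in \<open>simp add: bR_def\<close>)
      qed
    qed (use C in simp)
    finally show "(\<integral>\<omega>. sR \<omega> \<partial>M) \<le> real c * (1 + C) * C1" .
  qed (use t in \<open>auto simp: sR_def intro!: sum_nonneg\<close>)
  define S where "S \<omega> = (1 / sqrt (real n)) *\<^sub>R (\<Sum>i=1..n. u i \<omega> *\<^sub>R ?v \<omega> i)" for \<omega>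
  have S_meas: "S \<in> borel_measurable M"
    unfolding S_def[abs_def]
    by (intro borel_measurable_scaleR borel_measurable_const borel_measurable_sum u_meas
        measurable_from_subalg[OF F_sub v_F])
  have S_eq: "indicator A \<omega> * vec_nth (S \<omega>) a = (\<Sum>i\<in>?I. bS a i \<omega> * u i \<omega>)" for a \<omega>
    by (simp add: S_def bS_def sum_component sum_distrib_left mult_ac)
  have Sig: "Sigma_cond M n K w x u = cond_var M F S"
    by (simp add: Sigma_cond_def F_def S_def[abs_def])
  have AE_S: "AE \<omega> in M. \<omega> \<in> A \<longrightarrow> (\<forall>a b. vec_nth (vec_nth (Sigma_cond M n K w x u \<omega>) a) b
      = (\<Sum>i\<in>?I. \<Sum>j\<in>?I. bS a i \<omega> * bS b j \<omega> * E.cprod i j \<omega>))"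
    unfolding Sig by (rule E.cond_var_score[OF bS_w S_meas S_eq])
  have AE_0: "AE \<omega> in M. \<forall>i\<in>?I. \<forall>j\<in>?I. cl i \<noteq> cl j \<longrightarrow> \<omega> \<in> A \<longrightarrow> E.cprod i j \<omega> = 0"
    by (intro AE_finite_allI) (auto intro: E.cprod_zero)
  have AE_b: "AE \<omega> in M. \<forall>i\<in>?I. \<forall>j\<in>?I. \<omega> \<in> A \<longrightarrow> \<bar>E.cprod i j \<omega>\<bar> \<le> 1 + 2 * C"
    by (intro AE_finite_allI) (auto intro: E.cprod_bound)

  \<comment> \<open>One event for each matrix entry, one for each coordinate of the score, and one
    for the weighted sum of squares of M u; they account for the three terms of the probability
    bound.\<close>
  define \<B> where "\<B> = (\<Union>z\<in>UNIV. {\<omega>\<in>space M. \<tau>\<^sup>2 \<le> (qT (fst z) (snd z) \<omega>)\<^sup>2})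
     \<union> (\<Union>a\<in>UNIV. {\<omega>\<in>space M. t\<^sup>2 \<le> (sS a \<omega>)\<^sup>2}) \<union> {\<omega>\<in>space M. t \<le> sR \<omega>}"
  have ET: "{\<omega>\<in>space M. \<tau>\<^sup>2 \<le> (qT (fst z) (snd z) \<omega>)\<^sup>2} \<in> sets M" for z
    using borel_measurable_integrable[OF qT_int[of "fst z" "snd z"]] by measurable
  have ES: "{\<omega>\<in>space M. t\<^sup>2 \<le> (sS a \<omega>)\<^sup>2} \<in> sets M" for a
    using borel_measurable_integrable[OF sS_int[of a]] by measurable
  have ER: "{\<omega>\<in>space M. t \<le> sR \<omega>} \<in> sets M"
    using borel_measurable_integrable[OF sR_int] by measurable
  have \<B>_M: "\<B> \<in> sets M" unfolding \<B>_def using ET ES ER by (intro sets.Un sets.finite_UN) auto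

  \<comment> \<open>Here \<open>det\<close> stands for deterministic: outside \<open>\<B>\<close>
    the argument is pathwise, once the almost sure facts about \<open>cprod\<close> and the
    conditional variance are in force.\<close>
  have det_part: "AE \<omega> in M. \<omega> \<in> ?E \<longrightarrow> \<omega> \<in> \<B>"
    using AE_S AE_0 AE_b
  proof eventually_elim
    case (elim \<omega>)
    show ?case
    proof (rule impI, rule ccontr)
      assume E: "\<omega> \<in> ?E" and nB: "\<omega> \<notin> \<B>"
      then have A: "\<omega> \<in> A" by (simp add: A_def)
      note sp = A_space[OF A]
      have qT_lt: "\<bar>qT a b \<omega>\<bar> \<le> \<tau>" for a b
      proof -
        have "\<not> \<tau>\<^sup>2 \<le> (qT a b \<omega>)\<^sup>2" using nB sp by (auto simp: \<B>_def)
        then have "(qT a b \<omega>)\<^sup>2 \<le> \<tau>\<^sup>2" by simp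
        then show ?thesis using \<tau> by (simp add: abs_le_square_iff[symmetric])
      qed
      have sS_lt: "\<bar>sS a \<omega>\<bar> \<le> t" for a
      proof -
        have "\<not> t\<^sup>2 \<le> (sS a \<omega>)\<^sup>2" using nB sp by (auto simp: \<B>_def)
        then have "(sS a \<omega>)\<^sup>2 \<le> t\<^sup>2" by simp
        then show ?thesis using t by (simp add: abs_le_square_iff[symmetric])
      qed
      have sR_lt: "sR \<omega> \<le> t"
      proof -
        have "\<not> t \<le> sR \<omega>" using nB sp by (auto simp: \<B>_def)
        then show ?thesis by simp
      qed
      have SigE: "vec_nth (vec_nth (Sigma_cond M n K w x u \<omega>) a) b
          = (\<Sum>i\<in>?I. \<Sum>j\<in>?I. bS a i \<omega> * bS b j \<omega> * E.cprod i j \<omega>)" for a b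
        using elim(1) A by simp
      have c0: "E.cprod i j \<omega> = 0" if "i \<in> ?I" "j \<in> ?I" "cl i \<noteq> cl j" for i j
        using elim(2) A that by simp
      have cb: "\<bar>E.cprod i j \<omega>\<bar> \<le> 1 + 2 * C" if "i \<in> ?I" "j \<in> ?I" for i j
        using elim(3) A that by simp
      let ?\<Sigma> = "Sigma_cond M n K w x u \<omega>"
      \<comment> \<open>Expanded in v, the bilinear form weights the conditional covariances by
        inner products of \<open>p\<close> and \<open>r\<close> with v. Only pairs within clusters
        survive, and there the covariances are at most 1 + 2 C.\<close>
      have bil: "(real n * (p \<bullet> (?\<Sigma> *v r)))\<^sup>2
          \<le> ((1 + 2 * C) * real c)\<^sup>2 * ((\<Sum>i\<in>?I. (p \<bullet> ?v \<omega> i)\<^sup>2) * (\<Sum>i\<in>?I. (r \<bullet> ?v \<omega> i)\<^sup>2))" for p r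
      proof -
        have e: "vec_nth (vec_nth ?\<Sigma> a) b = (\<Sum>i\<in>?I. \<Sum>j\<in>?I. vec_nth (?v \<omega> i) a * vec_nth (?v \<omega> j) b * E.cprod i j \<omega> / real n)" for a b
          unfolding SigE using A n by (intro sum.cong refl) (simp add: bS_def)
        have "real n * (p \<bullet> (?\<Sigma> *v r)) = (\<Sum>a\<in>UNIV. \<Sum>b\<in>UNIV. vec_nth p a * vec_nth r b * (real n * vec_nth (vec_nth ?\<Sigma> a) b))"
          by (simp add: inner_vec_def matrix_vector_mult_def sum_distrib_left mult_ac)
        also have "\<dots> = (\<Sum>a\<in>UNIV. \<Sum>b\<in>UNIV. \<Sum>i\<in>?I. \<Sum>j\<in>?I.
            vec_nth p a * vec_nth r b * (vec_nth (?v \<omega> i) a * vec_nth (?v \<omega> j) b * E.cprod i j \<omega>))"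
          unfolding e using n by (simp add: sum_distrib_left)
        also have "\<dots> = (\<Sum>a\<in>UNIV. \<Sum>i\<in>?I. \<Sum>b\<in>UNIV. \<Sum>j\<in>?I.
            vec_nth p a * vec_nth r b * (vec_nth (?v \<omega> i) a * vec_nth (?v \<omega> j) b * E.cprod i j \<omega>))"
          by (rule sum.cong[OF refl], rule sum.swap)
        also have "\<dots> = (\<Sum>i\<in>?I. \<Sum>a\<in>UNIV. \<Sum>j\<in>?I. \<Sum>b\<in>UNIV.
            vec_nth p a * vec_nth r b * (vec_nth (?v \<omega> i) a * vec_nth (?v \<omega> j) b * E.cprod i j \<omega>))"
          by (subst sum.swap) (rule sum.cong[OF refl], rule sum.cong[OF refl], rule sum.swap)
        also have "\<dots> = (\<Sum>i\<in>?I. \<Sum>j\<in>?I. \<Sum>a\<in>UNIV. \<Sum>b\<in>UNIV.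
            vec_nth p a * vec_nth r b * (vec_nth (?v \<omega> i) a * vec_nth (?v \<omega> j) b * E.cprod i j \<omega>))"
          by (rule sum.cong[OF refl], rule sum.swap)
        also have "\<dots> = (\<Sum>i\<in>?I. \<Sum>j\<in>?I. (p \<bullet> ?v \<omega> i) * (r \<bullet> ?v \<omega> j) * E.cprod i j \<omega>)"
        proof (rule sum.cong[OF refl], rule sum.cong[OF refl])
          fix i j
          have "(p \<bullet> ?v \<omega> i) * (r \<bullet> ?v \<omega> j) * E.cprod i j \<omega> = (\<Sum>a\<in>UNIV. \<Sum>b\<in>UNIV.
              vec_nth p a * vec_nth (?v \<omega> i) a * (vec_nth r b * vec_nth (?v \<omega> j) b) * E.cprod i j \<omega>)"
            unfolding inner_vec_def inner_real_def sum_product unfolding sum_distrib_right ..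
          then show "(\<Sum>a\<in>UNIV. \<Sum>b\<in>UNIV.
              vec_nth p a * vec_nth r b * (vec_nth (?v \<omega> i) a * vec_nth (?v \<omega> j) b * E.cprod i j \<omega>))
            = (p \<bullet> ?v \<omega> i) * (r \<bullet> ?v \<omega> j) * E.cprod i j \<omega>"
            by (simp add: mult_ac)
        qed
        also have "\<dots> = (\<Sum>i\<in>?I. \<Sum>j\<in>?I. if cl i = cl j then (p \<bullet> ?v \<omega> i) * (r \<bullet> ?v \<omega> j) * E.cprod i j \<omega> else 0)"
          using c0 by (intro sum.cong refl) simp
        finally show ?thesis using P.cluster_bilinear_le[where p = "\<lambda>i. p \<bullet> ?v \<omega> i" and q = "\<lambda>i. r \<bullet> ?v \<omega> i"
            and \<sigma> = "\<lambda>i j. E.cprod i j \<omega>", OF c cb] by simp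
      qed
      have inv_le: "inv_norm ?\<Sigma> \<le> ennreal C2" using E by simp
      have inv: "invertible ?\<Sigma>"
      proof (rule ccontr)
        assume "\<not> invertible ?\<Sigma>"
        then show False using inv_le by (simp add: inv_norm_def top_unique)
      qed
      have nC2: "norm (matrix_inv ?\<Sigma>) \<le> C2" using inv_le inv C2 by (simp add: inv_norm_def)
      have lb: "real n * (norm a)\<^sup>2 \<le> \<rho> * (\<Sum>i\<in>?I. (a \<bullet> ?v \<omega> i)\<^sup>2)" for a
        unfolding \<rho>_def
        by (rule design_lower_bound[OF inv nC2 _ _ A_sum[OF A] bil]) (use n in auto)
      have \<rho>0: "\<rho> \<ge> 0" unfolding \<rho>_def using C1 by simp
      define \<delta> where "\<delta> = beta_hat n K w x y \<omega> - \<beta>"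
      have invG: "invertible (\<Sum>i=1..n. outer (?v \<omega> i) (?v \<omega> i))"
        by (rule invertible_sum_outer[OF lb]) (use n in simp)
      have model': "y i \<omega> = inner \<beta> (x i \<omega>) + (\<Sum>k<K. \<gamma> k * w i \<omega> k) + u i \<omega>" if "i \<in> ?I" for i
        using model[OF that sp] .
      note bh = beta_hat_error[where y = y and \<beta> = \<beta> and \<gamma> = \<gamma> and u = u, OF A_det[OF A] model' invG, folded \<delta>_def]
      have "real n * norm \<delta> \<le> \<rho> * norm (\<Sum>i=1..n. u i \<omega> *\<^sub>R ?v \<omega> i)"
        by (rule norm_error_le[OF lb \<rho>0 bh(1)])
      also have "(\<Sum>i=1..n. u i \<omega> *\<^sub>R ?v \<omega> i) = sqrt (real n) *\<^sub>R S \<omega>" using n by (simp add: S_def)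
      \<comment> \<open>Each coordinate of the scaled score is at most \<open>t\<close> off
        \<open>\<B>\<close>; the factor \<open>d\<close> comes from bounding the norm by the sum of
        the coordinates.\<close>
      also have "norm (S \<omega>) \<le> d * t"
      proof -
        have "norm (S \<omega>) \<le> (\<Sum>a\<in>UNIV. \<bar>vec_nth (S \<omega>) a\<bar>)" by (rule norm_le_l1_cart)
        also have "\<dots> \<le> (\<Sum>a\<in>(UNIV::'d set). t)"
        proof (rule sum_mono)
          fix a
          have "vec_nth (S \<omega>) a = sS a \<omega>" using S_eq[of \<omega> a] A by (simp add: sS_def)
          then show "\<bar>vec_nth (S \<omega>) a\<bar> \<le> t" using sS_lt by simp
        qed
        finally show ?thesis by (simp add: d_def)
      qed
      then have "sqrt (real n) * (\<rho> * norm (S \<omega>)) \<le> sqrt (real n) * (\<rho> * (d * t))"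
        using \<rho>0 by (intro mult_left_mono) auto
      then have "\<rho> * norm (sqrt (real n) *\<^sub>R S \<omega>) \<le> sqrt (real n) * (\<rho> * (d * t))"
        by (simp add: mult_ac)
      finally have "real n * norm \<delta> \<le> sqrt (real n) * (\<rho> * (d * t))" .
      moreover have "real n * norm \<delta> = sqrt (real n) * (sqrt (real n) * norm \<delta>)"
        by (simp add: mult.assoc[symmetric])
      ultimately have \<delta>: "sqrt (real n) * norm \<delta> \<le> \<rho> * (d * t)" using n by simp
      \<comment> \<open>The contribution of the slope error to the residuals. The norm of v is at
        most sqrt(\<eta> n), and sqrt n times the norm of \<delta> is at most
        \<open>\<rho> * (d * t)\<close>; this is the origin of \<open>q\<close>.\<close>
      define e where "e i = \<delta> \<bullet> ?v \<omega> i" for i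
      have e: "\<bar>e i\<bar> \<le> q" if i: "i \<in> ?I" for i
      proof -
        have "norm (?v \<omega> i) \<le> sqrt (\<eta> * real n)" by (rule real_le_rsqrt[OF A_max[OF A i]])
        then have "norm \<delta> * norm (?v \<omega> i) \<le> norm \<delta> * sqrt (\<eta> * real n)" by (rule mult_left_mono) simp
        also have "\<dots> = (sqrt (real n) * norm \<delta>) * sqrt \<eta>" by (simp add: real_sqrt_mult)
        also have "\<dots> \<le> (\<rho> * (d * t)) * sqrt \<eta>" using \<delta> \<eta> by (intro mult_right_mono) auto
        finally show ?thesis using Cauchy_Schwarz_ineq2[of \<delta> "?v \<omega> i"] unfolding e_def q_def by linarith
      qed
      have q0: "q \<ge> 0" unfolding q_def d_def using \<rho>0 t \<eta> by simp
      define \<upsilon> where "\<upsilon> i = (\<Sum>j=1..n. ?Mt \<omega> i j * u j \<omega>)" for i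
      have R: "(\<Sum>i\<in>?I. (norm (?v \<omega> i) * \<upsilon> i)\<^sup>2) \<le> t * real n"
      proof -
        have "(\<Sum>k\<in>?I. bR i k \<omega> * u k \<omega>) = norm (?v \<omega> i) * \<upsilon> i / sqrt (real n)" for i
          using A by (simp add: bR_def \<upsilon>_def sum_distrib_left sum_divide_distrib mult_ac)
        then have "sR \<omega> = (\<Sum>i\<in>?I. (norm (?v \<omega> i) * \<upsilon> i)\<^sup>2) / real n"
          by (simp add: sR_def power_divide sum_divide_distrib)
        then have "(\<Sum>i\<in>?I. (norm (?v \<omega> i) * \<upsilon> i)\<^sup>2) = real n * sR \<omega>" using n by simp
        then show ?thesis using mult_left_mono[OF sR_lt, of "real n"] by (simp add: mult.commute)
      qed
      \<comment> \<open>The variance estimator with M u in place of the residuals; \<open>d1\<close>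
        compares it with the estimator, \<open>d2\<close> with the target.\<close>
      define Mid where "Mid = (1 / real n) *\<^sub>R (\<Sum>g=1..G. \<Sum>i\<in>T g. \<Sum>j\<in>T g. (\<upsilon> i * \<upsilon> j) *\<^sub>R outer (?v \<omega> i) (?v \<omega> j))"
      have LZ: "Sigma_LZ n K w x y G T \<omega>
          = (1 / real n) *\<^sub>R (\<Sum>g=1..G. \<Sum>i\<in>T g. \<Sum>j\<in>T g. ((\<upsilon> i - e i) * (\<upsilon> j - e j)) *\<^sub>R outer (?v \<omega> i) (?v \<omega> j))"
      proof -
        have "u_hat n K w x y i \<omega> = \<upsilon> i - e i" if "i \<in> ?I" for i
          unfolding \<upsilon>_def e_def by (rule bh(2)) (use that in simp_all)
        then show ?thesis unfolding Sigma_LZ_def P.sum_cluster_pairs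
          by (intro arg_cong[of _ _ "(*\<^sub>R) _"] sum.cong refl) simp
      qed
      have d1: "norm (Sigma_LZ n K w x y G T \<omega> - Mid) \<le> real c * (q * (t + C1) + q\<^sup>2 * C1)"
        unfolding LZ Mid_def
        using n by (intro P.clustered_outer_perturbation[OF c e q0 _ A_sum[OF A] R]) simp_all
      have ent: "vec_nth (vec_nth (Mid - LZ_target M n K w x u G T \<omega>) a) b = qT a b \<omega>" for a b
      proof -
        have "LZ_target M n K w x u G T \<omega> = (1 / real n) *\<^sub>R
          (\<Sum>g1=1..G. \<Sum>g2=1..G. \<Sum>i1\<in>T g1. \<Sum>j1\<in>T g1. \<Sum>i2\<in>T g2. \<Sum>j2\<in>T g2.
          (?Mt \<omega> i1 j2 * ?Mt \<omega> j1 i2 * E.cprod i2 j2 \<omega>) *\<^sub>R outer (?v \<omega> i1) (?v \<omega> j1))"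
          unfolding LZ_target_def F_def[symmetric] E.cprod_def ..
        then have "vec_nth (vec_nth (Mid - LZ_target M n K w x u G T \<omega>) a) b
          = (\<Sum>k\<in>?I. \<Sum>l\<in>?I. P.sandwich (?Mt \<omega>) (real n) (?v \<omega>) a b k l * (u k \<omega> * u l \<omega> - E.cprod k l \<omega>))"
          unfolding Mid_def \<upsilon>_def
          by (simp only:) (rule P.clustered_entry_diff[where s = "\<lambda>i j. E.cprod i j \<omega>" and u = "\<lambda>i. u i \<omega>"],
              use c0 fun_cong[OF E.cprod_commute] in auto)
        then show ?thesis using A by (simp add: qT_def bT_def)
      qed
      have "norm (Mid - LZ_target M n K w x u G T \<omega>)
          \<le> (\<Sum>a\<in>UNIV. \<Sum>b\<in>UNIV. \<bar>vec_nth (vec_nth (Mid - LZ_target M n K w x u G T \<omega>) a) b\<bar>)"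
        by (rule norm_matrix_le_sum_entries)
      also have "\<dots> \<le> (\<Sum>a\<in>(UNIV::'d set). \<Sum>b\<in>(UNIV::'d set). \<tau>)"
        unfolding ent by (intro sum_mono qT_lt)
      also have "\<dots> = d * d * \<tau>" by (simp add: d_def)
      finally have d2: "norm (Mid - LZ_target M n K w x u G T \<omega>) \<le> d * d * \<tau>" .
      have "norm (Sigma_LZ n K w x y G T \<omega> - LZ_target M n K w x u G T \<omega>)
          \<le> norm (Sigma_LZ n K w x y G T \<omega> - Mid) + norm (Mid - LZ_target M n K w x u G T \<omega>)"
        using norm_triangle_ineq[of "Sigma_LZ n K w x y G T \<omega> - Mid" "Mid - LZ_target M n K w x u G T \<omega>"] by simp
      then show False using d1 d2 E by simp
    qed
  qed
  have "prob \<B> \<le> (prob (\<Union>z\<in>UNIV. {\<omega>\<in>space M. \<tau>\<^sup>2 \<le> (qT (fst z) (snd z) \<omega>)\<^sup>2})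
     + prob (\<Union>a\<in>UNIV. {\<omega>\<in>space M. t\<^sup>2 \<le> (sS a \<omega>)\<^sup>2})) + prob {\<omega>\<in>space M. t \<le> sR \<omega>}"
    unfolding \<B>_def using ET ES ER
    by (intro order_trans[OF measure_Un_le] add_mono order_refl measure_Un_le sets.Un sets.finite_UN) auto
  also have "\<dots> \<le> (\<Sum>z\<in>(UNIV :: ('d \<times> 'd) set). 2 * (real c)\<^sup>2 * E.kap * (real c * \<eta> * C1) / \<tau>\<^sup>2)
     + (\<Sum>a\<in>(UNIV :: 'd set). real c * (1 + C) * C1 / t\<^sup>2) + real c * (1 + C) * C1 / t"
  proof (intro add_mono sR)
    show "prob (\<Union>z\<in>UNIV. {\<omega>\<in>space M. \<tau>\<^sup>2 \<le> (qT (fst z) (snd z) \<omega>)\<^sup>2})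
        \<le> (\<Sum>z\<in>(UNIV :: ('d \<times> 'd) set). 2 * (real c)\<^sup>2 * E.kap * (real c * \<eta> * C1) / \<tau>\<^sup>2)"
      by (rule order_trans[OF measure_UNION_le sum_mono]) (use ET qT in auto)
    show "prob (\<Union>a\<in>UNIV. {\<omega>\<in>space M. t\<^sup>2 \<le> (sS a \<omega>)\<^sup>2}) \<le> (\<Sum>a\<in>(UNIV :: 'd set). real c * (1 + C) * C1 / t\<^sup>2)"
      by (rule order_trans[OF measure_UNION_le sum_mono]) (use ES sS in auto)
  qed
  also have "\<dots> = d * d * (2 * (real c)\<^sup>2 * (2 * C + 2 * (1 + 2 * C)\<^sup>2) * (real c * \<eta> * C1) / \<tau>\<^sup>2)
      + d * (real c * (1 + C) * C1 / t\<^sup>2) + real c * (1 + C) * C1 / t"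
    by (simp add: d_def E.kap_def)
  finally have "prob \<B> \<le> ?rate" .
  with det_part \<B>_M show ?thesis by blast
qed

section \<open>The limit\<close>

lemma outer_measurable:
  fixes f :: "'a \<Rightarrow> real^'m" and g :: "'a \<Rightarrow> real^'k"
  assumes "f \<in> borel_measurable N" "g \<in> borel_measurable N"
  shows "(\<lambda>\<omega>. outer (f \<omega>) (g \<omega>)) \<in> borel_measurable N"
proof (rule matrix_measurable)
  fix a b
  show "(\<lambda>\<omega>. vec_nth (vec_nth (outer (f \<omega>) (g \<omega>)) a) b) \<in> borel_measurable N"
    using borel_measurable_times[OF vec_nth_measurable[OF assms(1), of a] vec_nth_measurable[OF assms(2), of b]]
    by (simp add: outer_def)
qed

text \<open>\<open>op1\<close> bounds probabilities from below, and a non-measurable event has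
  measure 0 by convention. Measurability of the estimator is therefore part of the claim, singular
  designs included.\<close>

lemma Sigma_LZ_measurable:
  fixes x :: "nat \<Rightarrow> 'a \<Rightarrow> real^'d"
  assumes w: "\<And>i k. i \<in> {1..n} \<Longrightarrow> k < K \<Longrightarrow> (\<lambda>\<omega>. w i \<omega> k) \<in> borel_measurable N"
    and x: "\<And>i. i \<in> {1..n} \<Longrightarrow> x i \<in> borel_measurable N"
    and y: "\<And>i. i \<in> {1..n} \<Longrightarrow> y i \<in> borel_measurable N"
    and T: "\<And>g i. g \<in> {1..G} \<Longrightarrow> i \<in> T g \<Longrightarrow> i \<in> {1..n}"
  shows "Sigma_LZ n K w x y G T \<in> borel_measurable N"
proof -
  have v: "v_hat n K w x i \<in> borel_measurable N" if "i \<in> {1..n}" for i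
    by (rule v_hat_measurable[OF w x that])
  have b: "beta_hat n K w x y \<in> borel_measurable N"
    unfolding beta_hat_def[abs_def]
    by (intro matrix_inv_mult_measurable borel_measurable_sum outer_measurable borel_measurable_scaleR v y)
  have uh: "u_hat n K w x y i \<in> borel_measurable N" if i: "i \<in> {1..n}" for i
    unfolding u_hat_def[abs_def]
    by (intro borel_measurable_sum borel_measurable_times borel_measurable_diff borel_measurable_inner
        resid_mat_measurable[OF w i] y b x)
  show ?thesis
    unfolding Sigma_LZ_def[abs_def]
    by (intro borel_measurable_scaleR borel_measurable_const borel_measurable_sum borel_measurable_times
        outer_measurable uh v T)
qed

lemma LZ_target_measurable:
  fixes x :: "nat \<Rightarrow> 'a \<Rightarrow> real^'d"
  assumes w: "\<And>i k. i \<in> {1..n} \<Longrightarrow> k < K \<Longrightarrow> (\<lambda>\<omega>. w i \<omega> k) \<in> borel_measurable P"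
    and x: "\<And>i. i \<in> {1..n} \<Longrightarrow> x i \<in> borel_measurable P"
    and T: "\<And>g i. g \<in> {1..G} \<Longrightarrow> i \<in> T g \<Longrightarrow> i \<in> {1..n}"
  shows "LZ_target P n K w x u G T \<in> borel_measurable P"
  unfolding LZ_target_def[abs_def]
proof (intro borel_measurable_scaleR[OF borel_measurable_const] borel_measurable_sum)
  fix g1 g2 i1 j1 i2 j2
  assume g: "g1 \<in> {1..G}" "g2 \<in> {1..G}" "i1 \<in> T g1" "j1 \<in> T g1" "i2 \<in> T g2" "j2 \<in> T g2"
  note i = T[OF g(1,3)] T[OF g(1,4)] T[OF g(2,5)] T[OF g(2,6)]
  show "(\<lambda>\<omega>. (resid_mat n K w i1 j2 \<omega> * resid_mat n K w j1 i2 \<omega> *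
      real_cond_exp P (sigma_XW P n K x w) (\<lambda>\<omega>'. u i2 \<omega>' * u j2 \<omega>') \<omega>) *\<^sub>R
      outer (v_hat n K w x i1 \<omega>) (v_hat n K w x j1 \<omega>)) \<in> borel_measurable P"
    by (intro borel_measurable_scaleR borel_measurable_times outer_measurable borel_measurable_cond_exp2
        resid_mat_measurable[OF w i(1,4)] resid_mat_measurable[OF w i(2,3)]
        v_hat_measurable[OF w x i(1)] v_hat_measurable[OF w x i(2)])
qed

section \<open>From tail bounds to convergence in probability\<close>

text \<open>By the convention for non-measurable sets, a positive lower bound on the probability of
  a hypothesis event carries its measurability.\<close>

lemma in_sets_of_measure_pos: "0 < measure M S \<Longrightarrow> S \<in> sets M"
  using measure_notin_sets by fastforce

lemma tendsto_measure_1I: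
  assumes "\<And>n. prob_space (P n)"
    and "\<And>\<epsilon>. \<epsilon> > 0 \<Longrightarrow> \<forall>\<^sub>F n in sequentially. measure (P n) (S n) \<ge> 1 - \<epsilon>"
  shows "(\<lambda>n. measure (P n) (S n)) \<longlonglongrightarrow> 1"
proof (rule tendstoI)
  fix e :: real assume e: "e > 0"
  from assms(2)[of "e / 2"] e have "\<forall>\<^sub>F n in sequentially. measure (P n) (S n) \<ge> 1 - e / 2" by simp
  then show "\<forall>\<^sub>F n in sequentially. dist (measure (P n) (S n)) 1 < e"
  proof eventually_elim
    case (elim n)
    have "measure (P n) (S n) \<le> 1" using prob_space.prob_le_1[OF assms(1)] .
    then show ?case using elim e by (simp add: dist_real_def)
  qed
qed

text \<open>The summands are nonnegative in \<open>ennreal\<close>, so a bound on the sum bounds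
  each of them.\<close>

lemma C_n_bounds:
  fixes x :: "nat \<Rightarrow> 'a \<Rightarrow> real^'d"
  assumes "C_n P n K w x u \<omega> \<le> c" "i \<in> {1..n}"
  shows "nn_cond_exp P (sigma_XW P n K x w) (\<lambda>\<omega>'. ennreal ((u i \<omega>') ^ 4)) \<omega> \<le> c"
    and "nn_cond_exp P (sigma_W P n K w) (\<lambda>\<omega>'. ennreal ((norm (V_err P n K w x i \<omega>')) ^ 4)) \<omega> \<le> c"
proof -
  let ?a = "\<lambda>i. nn_cond_exp P (sigma_XW P n K x w) (\<lambda>\<omega>'. ennreal ((u i \<omega>') ^ 4)) \<omega>"
  let ?b = "\<lambda>i. nn_cond_exp P (sigma_W P n K w) (\<lambda>\<omega>'. ennreal ((norm (V_err P n K w x i \<omega>')) ^ 4)) \<omega>"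
  let ?c = "\<lambda>i. 1 / nn_cond_exp P (sigma_XW P n K x w) (\<lambda>\<omega>'. ennreal ((u i \<omega>')\<^sup>2)) \<omega>"
  have "?a i + ?b i + ?c i \<le> (MAX i\<in>{1..n}. ?a i + ?b i + ?c i)"
    using assms(2) by (intro Max_ge) auto
  also have "\<dots> \<le> C_n P n K w x u \<omega>" by (simp add: C_n_def)
  also have "\<dots> \<le> c" by (rule assms(1))
  finally have abc: "?a i + ?b i + ?c i \<le> c" .
  have "?a i \<le> ?a i + ?b i + ?c i" by (simp add: add.assoc)
  then show "?a i \<le> c" using abc by (rule order_trans)
  have "?b i \<le> ?a i + ?b i + ?c i" by (simp add: add.assoc add.left_commute[of "?a i"])
  then show "?b i \<le> c" using abc by (rule order_trans)
qed

text \<open>A union bound over complements. The cover is required almost surely only, because the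
  tail bounds are inclusions up to null sets.\<close>

lemma (in prob_space) prob_complement_cover:
  assumes cover: "AE \<omega> in M. \<omega> \<in> space M - X \<longrightarrow> (\<exists>S\<in>\<S>. \<omega> \<notin> S)"
    and X: "X \<in> sets M" and fin: "finite \<S>" and S: "\<And>S. S \<in> \<S> \<Longrightarrow> S \<in> sets M \<and> prob S \<ge> 1 - r"
  shows "prob X \<ge> 1 - real (card \<S>) * r"
proof -
  have "prob (space M - X) \<le> prob (\<Union>S\<in>\<S>. space M - S)"
  proof (rule finite_measure_mono_AE)
    show "AE \<omega> in M. \<omega> \<in> space M - X \<longrightarrow> \<omega> \<in> (\<Union>S\<in>\<S>. space M - S)"
      using cover by eventually_elim auto
    show "(\<Union>S\<in>\<S>. space M - S) \<in> sets M" using fin S by (intro sets.finite_UN) auto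
  qed
  also have "\<dots> \<le> (\<Sum>S\<in>\<S>. prob (space M - S))"
    using fin S by (intro measure_UNION_le) auto
  also have "\<dots> \<le> (\<Sum>S\<in>\<S>. r)"
  proof (rule sum_mono)
    fix T assume "T \<in> \<S>"
    then show "prob (space M - T) \<le> r" using S[of T] prob_compl[of T] by simp
  qed
  finally have "prob (space M - X) \<le> real (card \<S>) * r" by simp
  then show ?thesis using prob_compl[OF X] by simp
qed

lemma small_scale:
  fixes W1 W2 \<epsilon> r :: real
  assumes "W1 \<ge> 0" "W2 \<ge> 0" "\<epsilon> > 0" "r > 0"
  obtains s where "s > 0" "s \<le> 1" "s * W1 \<le> \<epsilon>" "s * W2 \<le> r"
proof
  \<comment> \<open>Adding 1 to \<open>W1\<close> and \<open>W2\<close> avoids division by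
    zero.\<close>
  let ?s = "min 1 (min (\<epsilon> / (W1 + 1)) (r / (W2 + 1)))"
  show "?s > 0" "?s \<le> 1" using assms by auto
  have "?s * W1 \<le> (\<epsilon> / (W1 + 1)) * (W1 + 1)" using assms by (intro mult_mono) auto
  then show "?s * W1 \<le> \<epsilon>" using assms by simp
  have "?s * W2 \<le> (r / (W2 + 1)) * (W2 + 1)" using assms by (intro mult_mono) auto
  then show "?s * W2 \<le> r" using assms by simp
qed

text \<open>Given a level \<open>r\<close>, the stochastic bounds \<open>C\<close>,
  \<open>C2\<close> and \<open>c0\<close> come from the hypotheses, \<open>C1\<close> and
  \<open>t\<close> are made large enough for the remaining tails, and \<tau> spends half of
  \<epsilon>. Only then is \<open>s\<close> fixed, the bound on the scaled maximum of v: it may be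
  taken arbitrarily small, and both the slope error and the variance of the quadratic form are at
  most a multiple of it.\<close>

theorem corollary1:
  fixes P :: "nat \<Rightarrow> 'a measure"
    and K G :: "nat \<Rightarrow> nat"
    and T :: "nat \<Rightarrow> nat \<Rightarrow> nat set"
    and \<beta> :: "real^'d"
    and \<gamma> :: "nat \<Rightarrow> nat \<Rightarrow> real"
    and x :: "nat \<Rightarrow> nat \<Rightarrow> 'a \<Rightarrow> real^'d"
    and w :: "nat \<Rightarrow> nat \<Rightarrow> 'a \<Rightarrow> nat \<Rightarrow> real"
    and u y :: "nat \<Rightarrow> nat \<Rightarrow> 'a \<Rightarrow> real"
  assumes prob: "\<And>n. prob_space (P n)"
    and K_pos: "\<And>n. K n \<ge> 1"
    and x_meas: "\<And>n i. i \<in> {1..n} \<Longrightarrow> x n i \<in> borel_measurable (P n)"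
    and u_meas: "\<And>n i. i \<in> {1..n} \<Longrightarrow> u n i \<in> borel_measurable (P n)"
    and w_meas: "\<And>n i k. i \<in> {1..n} \<Longrightarrow> k < K n \<Longrightarrow> (\<lambda>\<omega>. w n i \<omega> k) \<in> borel_measurable (P n)"
    and model: "\<And>n i \<omega>. i \<in> {1..n} \<Longrightarrow> \<omega> \<in> space (P n) \<Longrightarrow>
        y n i \<omega> = inner \<beta> (x n i \<omega>) + (\<Sum>k<K n. \<gamma> n k * w n i \<omega> k) + u n i \<omega>"
    \<comment> \<open>the expectations in the definition of v exist\<close>
    and ww_int: "\<And>n i k l. i \<in> {1..n} \<Longrightarrow> k < K n \<Longrightarrow> l < K n \<Longrightarrow>
        integrable (P n) (\<lambda>\<omega>. w n i \<omega> k * w n i \<omega> l)"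
    and xw_int: "\<And>n i k. i \<in> {1..n} \<Longrightarrow> k < K n \<Longrightarrow>
        integrable (P n) (\<lambda>\<omega>. w n i \<omega> k *\<^sub>R x n i \<omega>)"
    and T_nonempty: "\<And>n g. g \<in> {1..G n} \<Longrightarrow> T n g \<noteq> {}"
    and T_disjoint: "\<And>n. disjoint_family_on (T n) {1..G n}"
    and T_cover: "\<And>n. (\<Union>g\<in>{1..G n}. T n g) = {1..n}"
    and T_indep: "\<And>n. cond_indep_vars (P n) (sigma_W (P n) n (K n) (w n))
        (\<lambda>g. PiM (T n g) (\<lambda>_. borel :: (real \<times> (real^'d)) measure))
        (\<lambda>g \<omega>. \<lambda>i\<in>T n g. (u n i \<omega>, x n i \<omega>)) {1..G n}"
    and T_card: "(\<lambda>n. real (MAX g\<in>{1..G n}. card (T n g))) \<in> O(\<lambda>_. 1)"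
    and gram_pd: "(\<lambda>n. measure (P n)
        {\<omega> \<in> space (P n). lambda_min_mat (gram n (K n) (w n) \<omega>) > 0}) \<longlonglongrightarrow> 1"
    and K_rate: "limsup (\<lambda>n. ereal (real (K n) / real n)) < 1"
    and C_bdd: "Op1 P (\<lambda>n. C_n (P n) n (K n) (w n) (x n) (u n))"
    and Sigma_inv: "Op1 P (\<lambda>n \<omega>. inv_norm (Sigma_cond (P n) n (K n) (w n) (x n) (u n) \<omega>))"
    and u_mean: "\<And>n i. i \<in> {1..n} \<Longrightarrow>
        AE \<omega> in P n. real_cond_exp (P n) (sigma_XW (P n) n (K n) (x n) (w n)) (u n i) \<omega> = 0"
    and chi_bdd: "\<exists>C::real. \<forall>\<^sub>F n in sequentially. chi_n (P n) n (K n) (w n) (x n) \<le> ennreal C"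
    and v_hat_max: "op1 P (\<lambda>n \<omega>.
        (MAX i\<in>{1..n}. norm (v_hat n (K n) (w n) (x n) i \<omega>)) / sqrt (real n))"
  shows "op1 P (\<lambda>n \<omega>. norm (Sigma_LZ n (K n) (w n) (x n) (y n) (G n) (T n) \<omega> -
      (1 / real n) *\<^sub>R
        (\<Sum>g1=1..G n. \<Sum>g2=1..G n. \<Sum>i1\<in>T n g1. \<Sum>j1\<in>T n g1. \<Sum>i2\<in>T n g2. \<Sum>j2\<in>T n g2.
          (resid_mat n (K n) (w n) i1 j2 \<omega> * resid_mat n (K n) (w n) j1 i2 \<omega> *
           real_cond_exp (P n) (sigma_XW (P n) n (K n) (x n) (w n))
             (\<lambda>\<omega>'. u n i2 \<omega>' * u n j2 \<omega>') \<omega>) *\<^sub>R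
          outer (v_hat n (K n) (w n) (x n) i1 \<omega>) (v_hat n (K n) (w n) (x n) j1 \<omega>))))"
  unfolding LZ_target_def[symmetric] op1_def
proof (intro allI impI tendsto_measure_1I prob)
  fix \<epsilon> r0 :: real assume \<epsilon>: "\<epsilon> > 0" and r0: "r0 > 0"
  define X where "X n \<omega> = norm (Sigma_LZ n (K n) (w n) (x n) (y n) (G n) (T n) \<omega>
    - LZ_target (P n) n (K n) (w n) (x n) (u n) (G n) (T n) \<omega>)" for n \<omega>
  \<comment> \<open>At most six sets are discarded, each of probability at most \<open>r\<close>.
    Being below 1, \<open>r\<close> leaves positive lower bounds, which make the four hypothesis
    events measurable.\<close>
  define r where "r = min (r0 / 6) (1 / 2)"
  have r: "r > 0" "r < 1" "6 * r \<le> r0" using r0 by (auto simp: r_def min_def)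
  obtain C' where C': "\<forall>\<^sub>F n in sequentially.
      measure (P n) {\<omega>\<in>space (P n). C_n (P n) n (K n) (w n) (x n) (u n) \<omega> \<le> ennreal C'} \<ge> 1 - r"
    using C_bdd r(1) unfolding Op1_def by blast
  obtain C2' where C2': "\<forall>\<^sub>F n in sequentially.
      measure (P n) {\<omega>\<in>space (P n). inv_norm (Sigma_cond (P n) n (K n) (w n) (x n) (u n) \<omega>) \<le> ennreal C2'} \<ge> 1 - r"
    using Sigma_inv r(1) unfolding Op1_def by blast
  obtain c0' where c0': "\<forall>\<^sub>F n in sequentially. chi_n (P n) n (K n) (w n) (x n) \<le> ennreal c0'"
    using chi_bdd by blast
  \<comment> \<open>A negative bound acts as 0 under \<open>ennreal\<close>, so the constants may be
    taken nonnegative.\<close>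
  define C where "C = max C' 0"
  define C2 where "C2 = max C2' 0"
  define c0 where "c0 = max c0' 0"
  have nn: "C \<ge> 0" "C2 \<ge> 0" "c0 \<ge> 0" by (auto simp: C_def C2_def c0_def)
  have enn: "ennreal C' = ennreal C" "ennreal C2' = ennreal C2" "ennreal c0' = ennreal c0"
    by (auto simp: C_def C2_def c0_def max_def ennreal_neg)
  from T_card obtain c' where "\<forall>\<^sub>F n in sequentially. norm (real (MAX g\<in>{1..G n}. card (T n g))) \<le> c' * norm (1::real)"
    by (rule landau_o.bigE)
  then have c'_ev: "\<forall>\<^sub>F n in sequentially. real (MAX g\<in>{1..G n}. card (T n g)) \<le> c'" by simp
  define c where "c = nat \<lceil>c'\<rceil>"
  \<comment> \<open>Makes the tail bound for the mean of |v_i|^2 equal to \<open>r\<close>; the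
    threshold there is 4 \<open>t0\<close>, hence the value of \<open>C1\<close>.\<close>
  define t0 where "t0 = (1 + C + c0) / r"
  have t0: "t0 > 0" using nn r by (simp add: t0_def)
  have t0_r: "(1 + C + c0) / t0 = r" using nn r by (simp add: t0_def)
  define C1 where "C1 = 4 * t0"
  have C1: "C1 \<ge> 0" using t0 by (simp add: C1_def)
  define d where "d = real CARD('d)"
  have d: "d \<ge> 1" by (simp add: d_def)
  \<comment> \<open>As \<open>t\<close> will be at least 1, 1 / t^2 is at most 1 / t, so the
    \<open>d\<close> tails of the score and the one of the weighted squares of M u add up to at most
    \<open>Lc / t\<close>.\<close>
  define Lc where "Lc = (d + 1) * (real c * (1 + C) * C1)"
  have Lc: "Lc \<ge> 0" using d nn C1 by (simp add: Lc_def)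
  define t where "t = max 1 (2 * Lc / r)"
  have t: "t \<ge> 1" by (simp add: t_def)
  have t_r: "d * (real c * (1 + C) * C1 / t\<^sup>2) + real c * (1 + C) * C1 / t \<le> r / 2"
  proof -
    let ?z = "real c * (1 + C) * C1"
    have z: "?z \<ge> 0" using nn C1 by simp
    have "t \<le> t\<^sup>2" using t by (simp add: power2_eq_square)
    then have "?z / t\<^sup>2 \<le> ?z / t" using z t by (intro divide_left_mono) auto
    then have "d * (?z / t\<^sup>2) + ?z / t \<le> d * (?z / t) + ?z / t" using d by (intro add_right_mono mult_left_mono) auto
    also have "\<dots> = Lc / t" by (simp add: Lc_def add_divide_distrib distrib_right)
    also have "\<dots> \<le> r / 2"
    proof -
      have "2 * Lc / r \<le> t" by (simp add: t_def)
      then show ?thesis using t r by (simp add: field_simps)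
    qed
    finally show ?thesis .
  qed
  \<comment> \<open>The d^2 entries of the quadratic form together use half of \<epsilon>; the slope
    error gets the other half.\<close>
  define \<tau> where "\<tau> = \<epsilon> / (2 * d * d)"
  have \<tau>: "\<tau> > 0" using \<epsilon> d by (simp add: \<tau>_def)
  have d\<tau>: "d * d * \<tau> = \<epsilon> / 2" using d by (simp add: \<tau>_def)
  define \<rho> where "\<rho> = ((1 + 2 * C) * real c)\<^sup>2 * C1 * C2\<^sup>2"
  define Z where "Z = \<rho> * (d * t)"
  have Z: "Z \<ge> 0" unfolding Z_def \<rho>_def using C1 d t by simp
  \<comment> \<open>With \<eta> equal to s^2 and s at most 1, the slope error is at most
    \<open>s * W1\<close>, and the Chebyshev bound for the entries is
    \<open>s\<^sup>2 * W2\<close>.\<close>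
  define W1 where "W1 = real c * (Z * (t + C1) + Z\<^sup>2 * C1)"
  define W2 where "W2 = d * d * (2 * (real c)\<^sup>2 * (2 * C + 2 * (1 + 2 * C)\<^sup>2) * (real c * C1) / \<tau>\<^sup>2)"
  have W: "W1 \<ge> 0" "W2 \<ge> 0" unfolding W1_def W2_def using Z t C1 nn d by simp_all
  obtain s where s: "s > 0" "s \<le> 1" "s * W1 \<le> \<epsilon> / 2" "s * W2 \<le> r / 2"
    using small_scale[OF W, of "\<epsilon> / 2" "r / 2"] \<epsilon> r by auto
  have s2: "s\<^sup>2 \<le> s" using s mult_right_mono[of s 1 s] by (simp add: power2_eq_square)
  have bound: "real c * ((\<rho> * (d * t) * sqrt (s\<^sup>2)) * (t + C1) + (\<rho> * (d * t) * sqrt (s\<^sup>2))\<^sup>2 * C1) + d * d * \<tau> \<le> \<epsilon>"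
  proof -
    have "real c * ((Z * s) * (t + C1) + (Z * s)\<^sup>2 * C1) \<le> real c * (s * (Z * (t + C1)) + s * (Z\<^sup>2 * C1))"
    proof (intro mult_left_mono add_mono)
      show "(Z * s)\<^sup>2 * C1 \<le> s * (Z\<^sup>2 * C1)"
        using mult_right_mono[OF s2, of "Z\<^sup>2 * C1"] C1 by (simp add: power_mult_distrib mult_ac)
    qed (auto simp: mult_ac)
    also have "\<dots> = s * W1" by (simp add: W1_def algebra_simps)
    finally show ?thesis using s d\<tau> by (simp add: Z_def)
  qed
  have rate: "d * d * (2 * (real c)\<^sup>2 * (2 * C + 2 * (1 + 2 * C)\<^sup>2) * (real c * s\<^sup>2 * C1) / \<tau>\<^sup>2)
      + d * (real c * (1 + C) * C1 / t\<^sup>2) + real c * (1 + C) * C1 / t \<le> r"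
  proof -
    have "d * d * (2 * (real c)\<^sup>2 * (2 * C + 2 * (1 + 2 * C)\<^sup>2) * (real c * s\<^sup>2 * C1) / \<tau>\<^sup>2) = s\<^sup>2 * W2"
      by (simp add: W2_def)
    also have "\<dots> \<le> s * W2" by (rule mult_right_mono[OF s2 W(2)])
    finally show ?thesis using s(4) t_r by linarith
  qed
  have ev_gram: "\<forall>\<^sub>F n in sequentially. measure (P n) {\<omega> \<in> space (P n). lambda_min_mat (gram n (K n) (w n) \<omega>) > 0} \<ge> 1 - r"
    using order_tendstoD(1)[OF gram_pd, of "1 - r"] r by (auto elim: eventually_mono)
  have ev_max: "\<forall>\<^sub>F n in sequentially. measure (P n) {\<omega> \<in> space (P n).
      \<bar>(MAX i\<in>{1..n}. norm (v_hat n (K n) (w n) (x n) i \<omega>)) / sqrt (real n)\<bar> \<le> s} \<ge> 1 - r"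
    using order_tendstoD(1)[OF v_hat_max[unfolded op1_def, rule_format, OF s(1)], of "1 - r"] r
    by (auto elim: eventually_mono)
  have "\<forall>\<^sub>F n in sequentially. measure (P n) {\<omega>\<in>space (P n). \<bar>X n \<omega>\<bar> \<le> \<epsilon>} \<ge> 1 - r0"
    using C' C2' c0' c'_ev ev_gram ev_max eventually_gt_at_top[of 0]
  proof eventually_elim
    case (elim n)
    interpret prob_space "P n" by (rule prob)
    let ?M = "P n"
    have T_card': "card (T n g) \<le> c" if g: "g \<in> {1..G n}" for g
    proof -
      have "card (T n g) \<le> (MAX g\<in>{1..G n}. card (T n g))" using g by (intro Max_ge) auto
      then have "real (card (T n g)) \<le> c'" using elim(4) by simp
      then show ?thesis unfolding c_def by linarith
    qed
    have T_in: "i \<in> {1..n}" if "g \<in> {1..G n}" "i \<in> T n g" for g i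
      unfolding T_cover[of n, symmetric] using that by (rule UN_I)
    have y_meas: "y n i \<in> borel_measurable ?M" if i: "i \<in> {1..n}" for i
    proof -
      have "(\<lambda>\<omega>. inner \<beta> (x n i \<omega>) + (\<Sum>k<K n. \<gamma> n k * w n i \<omega> k) + u n i \<omega>) \<in> borel_measurable ?M"
        by (intro borel_measurable_add borel_measurable_sum borel_measurable_times borel_measurable_const
            borel_measurable_inner x_meas[OF i] u_meas[OF i] w_meas[OF i]) auto
      then show ?thesis by (rule measurable_cong[THEN iffD1, rotated]) (simp add: model[OF i])
    qed
    have LZ_meas: "Sigma_LZ n (K n) (w n) (x n) (y n) (G n) (T n) \<in> borel_measurable ?M"
      by (rule Sigma_LZ_measurable[where w = "w n" and x = "x n" and y = "y n" and T = "T n" and G = "G n",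
            OF w_meas x_meas y_meas T_in])
    have LT_meas: "LZ_target ?M n (K n) (w n) (x n) (u n) (G n) (T n) \<in> borel_measurable ?M"
      by (rule LZ_target_measurable[where w = "w n" and x = "x n" and T = "T n" and G = "G n",
            OF w_meas x_meas T_in])
    have X_meas: "X n \<in> borel_measurable ?M"
      unfolding X_def[abs_def] by (rule measurable_compose[OF borel_measurable_diff[OF LZ_meas LT_meas] borel_measurable_norm])
    define S1 where "S1 = {\<omega>\<in>space ?M. C_n ?M n (K n) (w n) (x n) (u n) \<omega> \<le> ennreal C}"
    define S2 where "S2 = {\<omega>\<in>space ?M. inv_norm (Sigma_cond ?M n (K n) (w n) (x n) (u n) \<omega>) \<le> ennreal C2}"
    define S3 where "S3 = {\<omega>\<in>space ?M. lambda_min_mat (gram n (K n) (w n) \<omega>) > 0}"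
    define S4 where "S4 = {\<omega>\<in>space ?M. \<bar>(MAX i\<in>{1..n}. norm (v_hat n (K n) (w n) (x n) i \<omega>)) / sqrt (real n)\<bar> \<le> s}"
    have S: "measure ?M S1 \<ge> 1 - r" "measure ?M S2 \<ge> 1 - r" "measure ?M S3 \<ge> 1 - r" "measure ?M S4 \<ge> 1 - r"
      using elim(1,2,5,6) unfolding S1_def S2_def S3_def S4_def enn by simp_all
    have S_sets: "S1 \<in> sets ?M" "S2 \<in> sets ?M" "S3 \<in> sets ?M" "S4 \<in> sets ?M"
      using S r by (auto intro!: in_sets_of_measure_pos)
    note n = elim(7)
    obtain D1 where D1: "D1 \<in> sets ?M" "prob D1 \<le> r"
      and D1_AE: "AE \<omega> in ?M. \<omega> \<in> {\<omega>\<in>space ?M. det (gram n (K n) (w n) \<omega>) \<noteq> 0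
      \<and> (\<forall>i\<in>{1..n}. nn_cond_exp ?M (sigma_W ?M n (K n) (w n)) (\<lambda>\<omega>'. ennreal ((norm (V_err ?M n (K n) (w n) (x n) i \<omega>')) ^ 4)) \<omega> \<le> ennreal C)
      \<and> 4 * t0 * real n < (\<Sum>i=1..n. (norm (v_hat n (K n) (w n) (x n) i \<omega>))\<^sup>2)} \<longrightarrow> \<omega> \<in> D1"
      by (rule bexE[OF sum_v_hat_square_tail[where x = "x n" and w = "w n" and K = "K n" and C = C and ?c0.0 = c0 and t = t0,
          OF x_meas w_meas n nn(1) nn(3) t0 elim(3)[unfolded enn], unfolded t0_r]], assumption+, elim conjE, rule that)
    obtain D2 where D2: "D2 \<in> sets ?M" "prob D2 \<le> r"
      and D2_AE: "AE \<omega> in ?M. \<omega> \<in> {\<omega>\<in>good_event ?M n (K n) (w n) (x n) (u n) C C1 (s\<^sup>2).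
          inv_norm (Sigma_cond ?M n (K n) (w n) (x n) (u n) \<omega>) \<le> ennreal C2
        \<and> real c * ((\<rho> * (d * t) * sqrt (s\<^sup>2)) * (t + C1) + (\<rho> * (d * t) * sqrt (s\<^sup>2))\<^sup>2 * C1) + d * d * \<tau> < X n \<omega>} \<longrightarrow> \<omega> \<in> D2"
    proof -
      have t_pos: "t > 0" using t by simp
      from Sigma_LZ_tail[where x = "x n" and u = "u n" and y = "y n" and w = "w n" and K = "K n" and \<beta> = \<beta> and \<gamma> = "\<gamma> n"
          and G = "G n" and T = "T n" and c = c and C = C and ?C1.0 = C1 and ?C2.0 = C2 and \<eta> = "s\<^sup>2" and t = t and \<tau> = \<tau>,
          OF n x_meas u_meas w_meas model T_disjoint T_cover T_indep u_mean T_card' nn(1) C1 nn(2) zero_le_power2 t_pos \<tau>,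
          folded d_def \<rho>_def]
      obtain D where "D \<in> sets ?M" "prob D \<le> d * d * (2 * (real c)\<^sup>2 * (2 * C + 2 * (1 + 2 * C)\<^sup>2) * (real c * s\<^sup>2 * C1) / \<tau>\<^sup>2)
          + d * (real c * (1 + C) * C1 / t\<^sup>2) + real c * (1 + C) * C1 / t"
        "AE \<omega> in ?M. \<omega> \<in> {\<omega>\<in>good_event ?M n (K n) (w n) (x n) (u n) C C1 (s\<^sup>2).
          inv_norm (Sigma_cond ?M n (K n) (w n) (x n) (u n) \<omega>) \<le> ennreal C2
        \<and> real c * ((\<rho> * (d * t) * sqrt (s\<^sup>2)) * (t + C1) + (\<rho> * (d * t) * sqrt (s\<^sup>2))\<^sup>2 * C1) + d * d * \<tau> < X n \<omega>} \<longrightarrow> \<omega> \<in> D"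
        unfolding X_def by blast
      then show ?thesis using rate by (intro that[of D]) auto
    qed
    \<comment> \<open>The rank condition and the moment bound for V hold on these events, so lying
      outside \<open>D1\<close> forces the bound on the mean of |v_i|^2.\<close>
    have good: "\<omega> \<in> good_event ?M n (K n) (w n) (x n) (u n) C C1 (s\<^sup>2)"
      if \<omega>: "\<omega> \<in> S1" "\<omega> \<in> S3" "\<omega> \<in> S4" and D: "\<omega> \<in> {\<omega>\<in>space ?M. det (gram n (K n) (w n) \<omega>) \<noteq> 0
      \<and> (\<forall>i\<in>{1..n}. nn_cond_exp ?M (sigma_W ?M n (K n) (w n)) (\<lambda>\<omega>'. ennreal ((norm (V_err ?M n (K n) (w n) (x n) i \<omega>')) ^ 4)) \<omega> \<le> ennreal C)
      \<and> 4 * t0 * real n < (\<Sum>i=1..n. (norm (v_hat n (K n) (w n) (x n) i \<omega>))\<^sup>2)} \<longrightarrow> \<omega> \<in> D1" "\<omega> \<notin> D1" for \<omega>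
    proof -
      have sp: "\<omega> \<in> space ?M" and CC: "C_n ?M n (K n) (w n) (x n) (u n) \<omega> \<le> ennreal C" using \<omega>(1) by (simp_all add: S1_def)
      have det: "det (gram n (K n) (w n) \<omega>) \<noteq> 0"
        using \<omega>(2) by (intro det_gram_nonzero[OF K_pos]) (simp add: S3_def)
      have vmax: "(norm (v_hat n (K n) (w n) (x n) i \<omega>))\<^sup>2 \<le> s\<^sup>2 * real n" if i: "i \<in> {1..n}" for i
      proof -
        have "norm (v_hat n (K n) (w n) (x n) i \<omega>) \<le> (MAX i\<in>{1..n}. norm (v_hat n (K n) (w n) (x n) i \<omega>))"
          using i by (intro Max_ge) auto
        also have "\<dots> \<le> s * sqrt (real n)"
        proof -
          have "(MAX i\<in>{1..n}. norm (v_hat n (K n) (w n) (x n) i \<omega>)) / sqrt (real n) \<le> s"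
            using abs_le_D1 \<omega>(3) unfolding S4_def mem_Collect_eq by blast
          then show ?thesis using n by (simp add: pos_divide_le_eq)
        qed
        finally have "(norm (v_hat n (K n) (w n) (x n) i \<omega>))\<^sup>2 \<le> (s * sqrt (real n))\<^sup>2"
          by (rule power_mono) simp
        then show ?thesis by (simp add: power_mult_distrib)
      qed
      have "\<not> 4 * t0 * real n < (\<Sum>i=1..n. (norm (v_hat n (K n) (w n) (x n) i \<omega>))\<^sup>2)"
        using D det sp C_n_bounds(2)[OF CC] by blast
      then have vsum: "(\<Sum>i=1..n. (norm (v_hat n (K n) (w n) (x n) i \<omega>))\<^sup>2) \<le> C1 * real n" by (simp add: C1_def)
      show ?thesis unfolding good_event_def
        using sp det vsum vmax C_n_bounds(1)[OF CC] by blast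
    qed
    let ?\<S> = "{S1, S2, S3, S4, space ?M - D1, space ?M - D2}"
    have cover: "AE \<omega> in ?M. \<omega> \<in> space ?M - {\<omega>\<in>space ?M. \<bar>X n \<omega>\<bar> \<le> \<epsilon>} \<longrightarrow> (\<exists>S\<in>?\<S>. \<omega> \<notin> S)"
      using D1_AE D2_AE
    proof eventually_elim
      case D: (elim \<omega>)
      show ?case
      proof (rule impI, rule ccontr)
        assume \<omega>: "\<omega> \<in> space ?M - {\<omega>\<in>space ?M. \<bar>X n \<omega>\<bar> \<le> \<epsilon>}" and "\<not> (\<exists>S\<in>?\<S>. \<omega> \<notin> S)"
        then have in_S: "\<omega> \<in> S1" "\<omega> \<in> S2" "\<omega> \<in> S3" "\<omega> \<in> S4" "\<omega> \<notin> D1" "\<omega> \<notin> D2" by auto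
        have ge: "\<omega> \<in> good_event ?M n (K n) (w n) (x n) (u n) C C1 (s\<^sup>2)"
          by (rule good[OF in_S(1,3,4) D(1) in_S(5)])
        have "\<bar>X n \<omega>\<bar> = X n \<omega>" by (simp add: X_def)
        then have "\<epsilon> < X n \<omega>" using \<omega> by (auto simp: not_le)
        then have "real c * ((\<rho> * (d * t) * sqrt (s\<^sup>2)) * (t + C1) + (\<rho> * (d * t) * sqrt (s\<^sup>2))\<^sup>2 * C1) + d * d * \<tau> < X n \<omega>"
          using bound by (rule le_less_trans[rotated])
        moreover have "inv_norm (Sigma_cond ?M n (K n) (w n) (x n) (u n) \<omega>) \<le> ennreal C2"
          using in_S(2) by (simp add: S2_def)
        ultimately have "\<omega> \<in> D2" using D(2) ge by blast
        then show False using in_S by simp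
      qed
    qed
    have "1 - real (card ?\<S>) * r \<le> prob {\<omega>\<in>space ?M. \<bar>X n \<omega>\<bar> \<le> \<epsilon>}"
    proof (rule prob_complement_cover[OF cover])
      show "{\<omega>\<in>space ?M. \<bar>X n \<omega>\<bar> \<le> \<epsilon>} \<in> sets ?M" using X_meas by measurable
      fix S' assume "S' \<in> ?\<S>"
      then show "S' \<in> sets ?M \<and> 1 - r \<le> prob S'"
        using S S_sets D1 D2 prob_compl[OF D1(1)] prob_compl[OF D2(1)] by (auto simp: sets.compl_sets)
    qed simp
    \<comment> \<open>Some of the six sets may coincide, so their number is only bounded
      above.\<close>
    moreover have "real (card ?\<S>) * r \<le> 6 * r"
    proof (rule mult_right_mono)
      have "card ?\<S> \<le> 6" by (intro card_insert_le_m1) auto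
      then show "real (card ?\<S>) \<le> 6" by simp
    qed (use r in simp)
    ultimately show ?case using r(3) by linarith
  qed
  then show "\<forall>\<^sub>F n in sequentially. 1 - r0 \<le> measure (P n) {\<omega> \<in> space (P n). \<bar>norm (Sigma_LZ n (K n) (w n) (x n) (y n) (G n) (T n) \<omega>
    - LZ_target (P n) n (K n) (w n) (x n) (u n) (G n) (T n) \<omega>)\<bar> \<le> \<epsilon>}"
    by (simp only: X_def)
qed

end
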